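(* The correspondence which associates to a symplectic Lie algebra with Lagrangian ideal $(\mathfrak g,\omega,\mathfrak a)$ the extension triple $(\mathfrak h,\nabla,[\alpha])$ induces a bijection between the set of isomorphism classes of symplectic Lie algebras with Lagrangian ideal and the set of isomorphism classes of flat Lie algebras with symplectic extension cohomology class.
   Context: All Lie algebras are finite-dimensional over a fixed field $k$ of characteristic $0$. A symplectic Lie algebra $(\mathfrak g,\omega)$ is a Lie algebra with a non-degenerate alternating form $\omega$ satisfying $\omega([u,v],w)+\omega([w,u],v)+\omega([v,w],u)=0$. A Lagrangian ideal $\mathfrak a$ is an ideal equal to its $\omega$-orthogonal. An isomorphism of symplectic Lie algebras with Lagrangian ideal $(\mathfrak g,\omega,\mathfrak a)\to(\mathfrak g',\omega',\mathfrak a')$ is a Lie algebra isomorphism $\Phi$ with $\Phi^*\omega'=\omega$ and $\Phi(\mathfrak a)=\mathfrak a'$. A flat Lie algebra $(\mathfrak h,\nabla)$ is a Lie algebra with a bilinear map $\nabla:\mathfrak h\times\mathfrak h\to\mathfrak h$, $(u,v)\mapsto\nabla_uv$, with $\nabla_uv-\nabla_vu=[u,v]$ and $\nabla_u\nabla_v-\nabla_v\nabla_u=\nabla_{[u,v]}$. Let $\rho:\mathfrak h\to\mathrm{End}(\mathfrak h^* )$, $\rho(u)\xi=-\xi\circ\nabla_u$. Let $\mathcal C^1_L(\mathfrak h,\mathfrak h^* )=\{\varphi\in\mathrm{Hom}(\mathfrak h,\mathfrak h^* ):\varphi(u)(v)=\varphi(v)(u)\}$, $(\partial_\nabla\varphi)(u,v)=\rho(u)\varphi(v)-\rho(v)\varphi(u)-\varphi([u,v])$,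 and let $Z^2_{L,\nabla}(\mathfrak h,\mathfrak h^* )$ be the space of Chevalley–Eilenberg two-cocycles $\alpha\in\mathrm{Hom}(\bigwedge^2\mathfrak h,\mathfrak h^* )$ with respect to $\rho$ which satisfy $\alpha(u,v)(w)+\alpha(w,u)(v)+\alpha(v,w)(u)=0$. Put $H^2_{L,\nabla}(\mathfrak h,\mathfrak h^* )=Z^2_{L,\nabla}(\mathfrak h,\mathfrak h^* )/\partial_\nabla\mathcal C^1_L(\mathfrak h,\mathfrak h^* )$. A flat Lie algebra with symplectic extension cohomology class is a triple $(\mathfrak h,\nabla,[\alpha])$ with $(\mathfrak h,\nabla)$ a flat Lie algebra and $[\alpha]\in H^2_{L,\nabla}(\mathfrak h,\mathfrak h^* )$. An isomorphism $(\mathfrak h,\nabla,[\alpha])\to(\mathfrak h',\nabla',[\alpha'])$ is a Lie algebra isomorphism $\varphi:\mathfrak h\to\mathfrak h'$ with $\varphi(\nabla_uv)=\nabla'_{\varphi u}\varphi v$ and $\varphi^*[\alpha']=[\alpha]$, where $(\varphi^*\alpha')(u,v)(w)=\alpha'(\varphi u,\varphi v)(\varphi w)$. The extension triple of $(\mathfrak g,\omega,\mathfrak a)$: $\mathfrak h=\mathfrak g/\mathfrak a$; $\nabla$ is the flat torsion-free connection determined by $\omega(\widetilde{\nabla_uv},a)=-\omega(\tilde v,[\tilde u,a])$ for all $a\in\mathfrak a$ (tildes denoting lifts to $\mathfrak g$); $[\alpha]$ is the class of $\alpha(u,v)(w)=\omega(\pi_{\mathfrak a}([\tilde u,\tilde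 v]),\tilde w)$, where $N$ is any Lagrangian subspace complementary to $\mathfrak a$, $\tilde u,\tilde v,\tilde w$ are the lifts in $N$ and $\pi_{\mathfrak a}$ is the projection to $\mathfrak a$ along $N$; the class does not depend on $N$. *)

theory Defs
  imports "HOL-Algebra.AbelCoset" "Jordan_Normal_Form.Missing_VectorSpace"
begin

section \<open>Finite-dimensional Lie algebras\<close>

text \<open>As always for HOL-Algebra modules, the record components \<open>mult\<close> and \<open>one\<close> inherited
  from \<open>ring\<close> carry no meaning here.\<close>

record ('k, 'v) lie_algebra = "('k, 'v) module" +
  bracket :: "'v \<Rightarrow> 'v \<Rightarrow> 'v"

definition char_zero :: "('k, 'm) ring_scheme \<Rightarrow> bool" where
  "char_zero K \<longleftrightarrow> (\<forall>n::nat. 0 < n \<longrightarrow> [n] \<cdot>\<^bsub>K\<^esub> \<one>\<^bsub>K\<^esub> \<noteq> \<zero>\<^bsub>K\<^esub>)"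

definition scalar_space :: "('k, 'm) ring_scheme \<Rightarrow> ('k, 'k) module" where
  "scalar_space K = \<lparr>carrier = carrier K, mult = mult K, one = one K,
     zero = zero K, add = add K, smult = mult K\<rparr>"

definition bilinear_map ::
    "('k, 'm) ring_scheme \<Rightarrow> ('k, 'u, 'a) module_scheme \<Rightarrow> ('k, 'v, 'b) module_scheme
      \<Rightarrow> ('k, 'w, 'c) module_scheme \<Rightarrow> ('u \<Rightarrow> 'v \<Rightarrow> 'w) \<Rightarrow> bool" where
  "bilinear_map K U V W f \<longleftrightarrow>
     (\<forall>u\<in>carrier U. f u \<in> module_hom K V W) \<and>
     (\<forall>v\<in>carrier V. (\<lambda>u. f u v) \<in> module_hom K U W)"

locale fin_dim_lie_algebra = vectorspace K L
  for K :: "('k, 'm) ring_scheme" and L :: "('k, 'v, 'n) lie_algebra_scheme" +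
  assumes finite_dimensional: "fin_dim"
    and bracket_bilinear: "bilinear_map K L L L (bracket L)"
    and bracket_self: "x \<in> carrier L \<Longrightarrow> bracket L x x = \<zero>\<^bsub>L\<^esub>"
    and jacobi: "\<lbrakk>x \<in> carrier L; y \<in> carrier L; z \<in> carrier L\<rbrakk> \<Longrightarrow>
      bracket L x (bracket L y z) \<oplus>\<^bsub>L\<^esub> bracket L y (bracket L z x)
        \<oplus>\<^bsub>L\<^esub> bracket L z (bracket L x y) = \<zero>\<^bsub>L\<^esub>"

definition lie_iso ::
    "('k, 'm) ring_scheme \<Rightarrow> ('k, 'v) lie_algebra \<Rightarrow> ('k, 'w) lie_algebra \<Rightarrow> ('v \<Rightarrow> 'w) \<Rightarrow> bool" where
  "lie_iso K L L' f \<longleftrightarrow>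
     f \<in> module_hom K L L' \<and> bij_betw f (carrier L) (carrier L') \<and>
     (\<forall>x\<in>carrier L. \<forall>y\<in>carrier L. f (bracket L x y) = bracket L' (f x) (f y))"

definition lie_ideal :: "('k, 'm) ring_scheme \<Rightarrow> ('k, 'v) lie_algebra \<Rightarrow> 'v set \<Rightarrow> bool" where
  "lie_ideal K L I \<longleftrightarrow>
     subspace K I L \<and> (\<forall>x\<in>carrier L. \<forall>y\<in>I. bracket L x y \<in> I)"

definition quotient_lie :: "('k, 'v) lie_algebra \<Rightarrow> 'v set \<Rightarrow> ('k, 'v set) lie_algebra" where
  "quotient_lie L I = \<lparr>carrier = a_rcosets\<^bsub>L\<^esub> I, mult = undefined, one = undefined,
     zero = I, add = set_add L,
     smult = (\<lambda>r A. \<Union>x\<in>A. I +>\<^bsub>L\<^esub> (r \<odot>\<^bsub>L\<^esub> x)),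
     bracket = (\<lambda>A B. \<Union>x\<in>A. \<Union>y\<in>B. I +>\<^bsub>L\<^esub> bracket L x y)\<rparr>"


section \<open>Symplectic Lie algebras with Lagrangian ideal\<close>

definition symplectic_form ::
    "('k, 'm) ring_scheme \<Rightarrow> ('k, 'v) lie_algebra \<Rightarrow> ('v \<Rightarrow> 'v \<Rightarrow> 'k) \<Rightarrow> bool" where
  "symplectic_form K L \<omega> \<longleftrightarrow>
     bilinear_map K L L (scalar_space K) \<omega> \<and>
     (\<forall>u\<in>carrier L. \<omega> u u = \<zero>\<^bsub>K\<^esub>) \<and>
     (\<forall>u\<in>carrier L. (\<forall>v\<in>carrier L. \<omega> u v = \<zero>\<^bsub>K\<^esub>) \<longrightarrow> u = \<zero>\<^bsub>L\<^esub>) \<and>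
     (\<forall>u\<in>carrier L. \<forall>v\<in>carrier L. \<forall>w\<in>carrier L.
        \<omega> (bracket L u v) w \<oplus>\<^bsub>K\<^esub> \<omega> (bracket L w u) v \<oplus>\<^bsub>K\<^esub> \<omega> (bracket L v w) u = \<zero>\<^bsub>K\<^esub>)"

definition orthogonal ::
    "('k, 'm) ring_scheme \<Rightarrow> ('k, 'v) lie_algebra \<Rightarrow> ('v \<Rightarrow> 'v \<Rightarrow> 'k) \<Rightarrow> 'v set \<Rightarrow> 'v set" where
  "orthogonal K L \<omega> S = {x \<in> carrier L. \<forall>y\<in>S. \<omega> x y = \<zero>\<^bsub>K\<^esub>}"

type_synonym ('k, 'v) sympl_lagr = "('k, 'v) lie_algebra \<times> ('v \<Rightarrow> 'v \<Rightarrow> 'k) \<times> 'v set"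

definition sympl_lagr_algebras :: "('k, 'm) ring_scheme \<Rightarrow> ('k, 'v) sympl_lagr set" where
  "sympl_lagr_algebras K = {(L, \<omega>, \<aa>).
     fin_dim_lie_algebra K L \<and> symplectic_form K L \<omega> \<and>
     lie_ideal K L \<aa> \<and> orthogonal K L \<omega> \<aa> = \<aa>}"

fun sympl_lagr_iso ::
    "('k, 'm) ring_scheme \<Rightarrow> ('k, 'v) sympl_lagr \<Rightarrow> ('k, 'w) sympl_lagr \<Rightarrow> bool" where
  "sympl_lagr_iso K (L, \<omega>, \<aa>) (L', \<omega>', \<aa>') \<longleftrightarrow>
     (\<exists>\<Phi>. lie_iso K L L' \<Phi> \<and>
        (\<forall>x\<in>carrier L. \<forall>y\<in>carrier L. \<omega>' (\<Phi> x) (\<Phi> y) = \<omega> x y) \<and> \<Phi> ` \<aa> = \<aa>')"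

definition sympl_lagr_classes :: "('k, 'm) ring_scheme \<Rightarrow> ('k, 'v) sympl_lagr set set" where
  "sympl_lagr_classes K = sympl_lagr_algebras K //
     {(X, Y). X \<in> sympl_lagr_algebras K \<and> Y \<in> sympl_lagr_algebras K \<and> sympl_lagr_iso K X Y}"


section \<open>Flat Lie algebras and the cohomology space\<close>

definition flat_connection ::
    "('k, 'm) ring_scheme \<Rightarrow> ('k, 'v) lie_algebra \<Rightarrow> ('v \<Rightarrow> 'v \<Rightarrow> 'v) \<Rightarrow> bool" where
  "flat_connection K L D \<longleftrightarrow>
     bilinear_map K L L L D \<and>
     (\<forall>u\<in>carrier L. \<forall>v\<in>carrier L. D u v \<ominus>\<^bsub>L\<^esub> D v u = bracket L u v) \<and>
     (\<forall>u\<in>carrier L. \<forall>v\<in>carrier L. \<forall>w\<in>carrier L.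
        D u (D v w) \<ominus>\<^bsub>L\<^esub> D v (D u w) = D (bracket L u v) w)"

text \<open>Linear maps that serve as elements of a function space are extensional
  (\<open>undefined\<close> off the carrier), so that equality of maps is equality on the carrier.\<close>

definition dual_space ::
    "('k, 'm) ring_scheme \<Rightarrow> ('k, 'v) lie_algebra \<Rightarrow> ('k, 'v \<Rightarrow> 'k) module" where
  "dual_space K L = (ring.func_space K (carrier L))
     \<lparr>carrier := module_hom K L (scalar_space K) \<inter> extensional (carrier L)\<rparr>"

definition dual_rep ::
    "('k, 'm) ring_scheme \<Rightarrow> ('k, 'v) lie_algebra \<Rightarrow> ('v \<Rightarrow> 'v \<Rightarrow> 'v)
      \<Rightarrow> 'v \<Rightarrow> ('v \<Rightarrow> 'k) \<Rightarrow> ('v \<Rightarrow> 'k)" where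
  "dual_rep K L D u \<xi> = (\<lambda>v\<in>carrier L. \<ominus>\<^bsub>K\<^esub> \<xi> (D u v))"

definition lagr_cochains1 ::
    "('k, 'm) ring_scheme \<Rightarrow> ('k, 'v) lie_algebra \<Rightarrow> ('v \<Rightarrow> 'v \<Rightarrow> 'k) set" where
  "lagr_cochains1 K L = {\<phi> \<in> module_hom K L (dual_space K L) \<inter> extensional (carrier L).
     \<forall>u\<in>carrier L. \<forall>v\<in>carrier L. \<phi> u v = \<phi> v u}"

definition coboundary1 ::
    "('k, 'm) ring_scheme \<Rightarrow> ('k, 'v) lie_algebra \<Rightarrow> ('v \<Rightarrow> 'v \<Rightarrow> 'v)
      \<Rightarrow> ('v \<Rightarrow> 'v \<Rightarrow> 'k) \<Rightarrow> ('v \<Rightarrow> 'v \<Rightarrow> 'v \<Rightarrow> 'k)" where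
  "coboundary1 K L D \<phi> = (\<lambda>u\<in>carrier L. \<lambda>v\<in>carrier L.
     dual_rep K L D u (\<phi> v) \<ominus>\<^bsub>dual_space K L\<^esub> dual_rep K L D v (\<phi> u)
       \<ominus>\<^bsub>dual_space K L\<^esub> \<phi> (bracket L u v))"

text \<open>\<open>Hom(\<Lambda>\<^sup>2 L, L\<^sup>*)\<close>, as the space of alternating bilinear maps.\<close>

definition cochains2 ::
    "('k, 'm) ring_scheme \<Rightarrow> ('k, 'v) lie_algebra \<Rightarrow> ('v \<Rightarrow> 'v \<Rightarrow> 'v \<Rightarrow> 'k) set" where
  "cochains2 K L = {\<alpha> \<in> carrier L \<rightarrow>\<^sub>E carrier L \<rightarrow>\<^sub>E carrier (dual_space K L).
     bilinear_map K L L (dual_space K L) \<alpha> \<and>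
     (\<forall>u\<in>carrier L. \<alpha> u u = \<zero>\<^bsub>dual_space K L\<^esub>)}"

definition coboundary2 ::
    "('k, 'm) ring_scheme \<Rightarrow> ('k, 'v) lie_algebra \<Rightarrow> ('v \<Rightarrow> 'v \<Rightarrow> 'v)
      \<Rightarrow> ('v \<Rightarrow> 'v \<Rightarrow> 'v \<Rightarrow> 'k) \<Rightarrow> 'v \<Rightarrow> 'v \<Rightarrow> 'v \<Rightarrow> ('v \<Rightarrow> 'k)" where
  "coboundary2 K L D \<alpha> u v w =
     dual_rep K L D u (\<alpha> v w) \<ominus>\<^bsub>dual_space K L\<^esub> dual_rep K L D v (\<alpha> u w)
       \<oplus>\<^bsub>dual_space K L\<^esub> dual_rep K L D w (\<alpha> u v)
       \<ominus>\<^bsub>dual_space K L\<^esub> \<alpha> (bracket L u v) w \<oplus>\<^bsub>dual_space K L\<^esub> \<alpha> (bracket L u w) v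
       \<ominus>\<^bsub>dual_space K L\<^esub> \<alpha> (bracket L v w) u"

definition lagr_cocycles2 ::
    "('k, 'm) ring_scheme \<Rightarrow> ('k, 'v) lie_algebra \<Rightarrow> ('v \<Rightarrow> 'v \<Rightarrow> 'v)
      \<Rightarrow> ('v \<Rightarrow> 'v \<Rightarrow> 'v \<Rightarrow> 'k) set" where
  "lagr_cocycles2 K L D = {\<alpha> \<in> cochains2 K L.
     (\<forall>u\<in>carrier L. \<forall>v\<in>carrier L. \<forall>w\<in>carrier L.
        coboundary2 K L D \<alpha> u v w = \<zero>\<^bsub>dual_space K L\<^esub>) \<and>
     (\<forall>u\<in>carrier L. \<forall>v\<in>carrier L. \<forall>w\<in>carrier L.
        \<alpha> u v w \<oplus>\<^bsub>K\<^esub> \<alpha> w u v \<oplus>\<^bsub>K\<^esub> \<alpha> v w u = \<zero>\<^bsub>K\<^esub>)}"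

definition cohomology_class ::
    "('k, 'm) ring_scheme \<Rightarrow> ('k, 'v) lie_algebra \<Rightarrow> ('v \<Rightarrow> 'v \<Rightarrow> 'v)
      \<Rightarrow> ('v \<Rightarrow> 'v \<Rightarrow> 'v \<Rightarrow> 'k) \<Rightarrow> ('v \<Rightarrow> 'v \<Rightarrow> 'v \<Rightarrow> 'k) set" where
  "cohomology_class K L D \<alpha> =
     (\<lambda>\<beta>. \<lambda>u\<in>carrier L. \<lambda>v\<in>carrier L. \<alpha> u v \<oplus>\<^bsub>dual_space K L\<^esub> \<beta> u v) `
       (coboundary1 K L D ` lagr_cochains1 K L)"

definition lagr_cohomology2 ::
    "('k, 'm) ring_scheme \<Rightarrow> ('k, 'v) lie_algebra \<Rightarrow> ('v \<Rightarrow> 'v \<Rightarrow> 'v)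
      \<Rightarrow> ('v \<Rightarrow> 'v \<Rightarrow> 'v \<Rightarrow> 'k) set set" where
  "lagr_cohomology2 K L D = cohomology_class K L D ` lagr_cocycles2 K L D"

type_synonym ('k, 'v) flat_triple =
  "('k, 'v) lie_algebra \<times> ('v \<Rightarrow> 'v \<Rightarrow> 'v) \<times> ('v \<Rightarrow> 'v \<Rightarrow> 'v \<Rightarrow> 'k) set"

definition flat_triples :: "('k, 'm) ring_scheme \<Rightarrow> ('k, 'v) flat_triple set" where
  "flat_triples K = {(H, D, c).
     fin_dim_lie_algebra K H \<and> flat_connection K H D \<and> c \<in> lagr_cohomology2 K H D}"

definition pullback2 ::
    "('k, 'v) lie_algebra \<Rightarrow> ('v \<Rightarrow> 'w) \<Rightarrow> ('w \<Rightarrow> 'w \<Rightarrow> 'w \<Rightarrow> 'k) \<Rightarrow> ('v \<Rightarrow> 'v \<Rightarrow> 'v \<Rightarrow> 'k)" where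
  "pullback2 H f \<alpha> =
     (\<lambda>u\<in>carrier H. \<lambda>v\<in>carrier H. \<lambda>w\<in>carrier H. \<alpha> (f u) (f v) (f w))"

fun flat_triple_iso ::
    "('k, 'm) ring_scheme \<Rightarrow> ('k, 'v) flat_triple \<Rightarrow> ('k, 'w) flat_triple \<Rightarrow> bool" where
  "flat_triple_iso K (H, D, c) (H', D', c') \<longleftrightarrow>
     (\<exists>f. lie_iso K H H' f \<and>
        (\<forall>u\<in>carrier H. \<forall>v\<in>carrier H. f (D u v) = D' (f u) (f v)) \<and>
        pullback2 H f ` c' = c)"

definition flat_triple_classes :: "('k, 'm) ring_scheme \<Rightarrow> ('k, 'v) flat_triple set set" where
  "flat_triple_classes K = flat_triples K //
     {(S, T). S \<in> flat_triples K \<and> T \<in> flat_triples K \<and> flat_triple_iso K S T}"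


section \<open>The extension triple\<close>

definition extension_connection ::
    "('k, 'm) ring_scheme \<Rightarrow> ('k, 'v) sympl_lagr \<Rightarrow> 'v set \<Rightarrow> 'v set \<Rightarrow> 'v set" where
  "extension_connection K = (\<lambda>(L, \<omega>, \<aa>) U V.
     THE W. W \<in> carrier (quotient_lie L \<aa>) \<and>
       (\<forall>u\<in>U. \<forall>v\<in>V. \<forall>w\<in>W. \<forall>a\<in>\<aa>. \<omega> w a = \<ominus>\<^bsub>K\<^esub> \<omega> v (bracket L u a)))"

definition lagr_complement ::
    "('k, 'm) ring_scheme \<Rightarrow> ('k, 'v) sympl_lagr \<Rightarrow> 'v set \<Rightarrow> bool" where
  "lagr_complement K = (\<lambda>(L, \<omega>, \<aa>) N.
     subspace K N L \<and> orthogonal K L \<omega> N = N \<and>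
     N \<inter> \<aa> = {\<zero>\<^bsub>L\<^esub>} \<and> N <+>\<^bsub>L\<^esub> \<aa> = carrier L)"

definition proj_along :: "('k, 'v) lie_algebra \<Rightarrow> 'v set \<Rightarrow> 'v set \<Rightarrow> 'v \<Rightarrow> 'v" where
  "proj_along L \<aa> N x = (THE a. a \<in> \<aa> \<and> (\<exists>n\<in>N. x = a \<oplus>\<^bsub>L\<^esub> n))"

definition coset_lift :: "'v set \<Rightarrow> 'v set \<Rightarrow> 'v" where
  "coset_lift N U = (THE u. u \<in> U \<and> u \<in> N)"

definition extension_cocycle ::
    "('k, 'v) sympl_lagr \<Rightarrow> 'v set \<Rightarrow> 'v set \<Rightarrow> 'v set \<Rightarrow> 'v set \<Rightarrow> 'k" where
  "extension_cocycle = (\<lambda>(L, \<omega>, \<aa>) N.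
     \<lambda>U\<in>carrier (quotient_lie L \<aa>). \<lambda>V\<in>carrier (quotient_lie L \<aa>).
     \<lambda>W\<in>carrier (quotient_lie L \<aa>).
       \<omega> (proj_along L \<aa> N (bracket L (coset_lift N U) (coset_lift N V))) (coset_lift N W))"

text \<open>The description below is meaningful because a Lagrangian complement exists and all of them
  give the same class.\<close>

definition extension_class ::
    "('k, 'm) ring_scheme \<Rightarrow> ('k, 'v) sympl_lagr
      \<Rightarrow> ('v set \<Rightarrow> 'v set \<Rightarrow> 'v set \<Rightarrow> 'k) set" where
  "extension_class K = (\<lambda>(L, \<omega>, \<aa>).
     THE c. \<forall>N. lagr_complement K (L, \<omega>, \<aa>) N \<longrightarrow>
       c = cohomology_class K (quotient_lie L \<aa>) (extension_connection K (L, \<omega>, \<aa>))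
             (extension_cocycle (L, \<omega>, \<aa>) N))"

definition extension_triple ::
    "('k, 'm) ring_scheme \<Rightarrow> ('k, 'v) sympl_lagr \<Rightarrow> ('k, 'v set) flat_triple" where
  "extension_triple K = (\<lambda>(L, \<omega>, \<aa>).
     (quotient_lie L \<aa>, extension_connection K (L, \<omega>, \<aa>), extension_class K (L, \<omega>, \<aa>)))"

text \<open>Isomorphism classes are taken among structures whose elements form a subset of a fixed type.
  The extension triple of an algebra with elements in \<open>'g\<close> has elements in \<open>'g set\<close>; since
  isomorphisms may relate different types, its class is compared with triples in any type \<open>'h\<close>.
  A type into which the field injects contains a copy of every finite-dimensional space: a field of
  characteristic \<open>0\<close> is infinite, hence as large as each of its finite powers.\<close>

definition extension_class_map ::
    "('k, 'm) ring_scheme \<Rightarrow> ('k, 'g) sympl_lagr set \<Rightarrow> ('k, 'h) flat_triple set" where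
  "extension_class_map K C =
     {T \<in> flat_triples K. \<exists>X\<in>C. flat_triple_iso K (extension_triple K X) T}"

end

theory Submission
  imports Defs "HOL-Library.Equipollence"
begin

text \<open>
  Choose an isotropic linear section \<open>s\<close> of the projection \<open>p : \<gg> \<rightarrow> \<hh> = \<gg>/\<aa>\<close>. Every vector \<open>x\<close> is
  determined by \<open>p x\<close> and by the functional \<open>\<omega>(x, s(\<cdot>))\<close> on \<open>\<hh>\<close>, and the trilinear form
  \<open>\<omega>([x, y], z)\<close> is given by a universal formula in these data, the connection \<open>\<nabla>\<close> and the cocycle
  \<open>\<alpha>(U, V)(W) = \<omega>([s U, s V], s W)\<close>. Hence two algebras with the same \<open>(\<hh>, \<nabla>, \<alpha>)\<close> are isomorphic.
  Applied to the images of a second isotropic section \<open>t\<close>, the same formula shows that \<open>\<alpha>\<close> changes by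
  \<open>\<partial>\<^sub>\<nabla>\<phi>\<close> with \<open>\<phi>(U)(V) = \<omega>(t U, s V)\<close>; every symmetric \<open>\<phi>\<close> arises in this way because each functional
  on \<open>\<hh>\<close> is represented by an element of \<open>\<aa>\<close>. Conversely \<open>\<hh> \<oplus> \<hh>\<^sup>*\<close> with the bracket twisted by \<open>\<alpha>\<close>
  realises every triple.
\<close>

section \<open>Linear maps\<close>

text \<open>The extension triple is awkward to compare directly: its elements are cosets, it is
  built from definite descriptions, and it has to be compared with triples whose elements have an
  unrelated type. All arguments therefore run through the relation \<open>presents K X T\<close>,
  witnessed by a surjection with kernel \<aa> together with an isotropic section. For fixed
  \<open>T\<close> the algebras presenting it form an isomorphism class, and for fixed
  \<open>X\<close> the triples presented by it form an isomorphism class. Once every algebra and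
  every triple is known to take part in the relation, the bijection on classes is formal.
  Characteristic 0 enters twice. One half is needed to make a linear section isotropic. The field
  must also be infinite, so that through the injections \<iota> and \<kappa> the two given types
  have room for a copy of the model and of the quotient.\<close>

lemma module_homI:
  assumes "\<And>x. x \<in> carrier V \<Longrightarrow> f x \<in> carrier W"
    and "\<And>x y. \<lbrakk>x \<in> carrier V; y \<in> carrier V\<rbrakk> \<Longrightarrow> f (x \<oplus>\<^bsub>V\<^esub> y) = f x \<oplus>\<^bsub>W\<^esub> f y"
    and "\<And>r x. \<lbrakk>r \<in> carrier K; x \<in> carrier V\<rbrakk> \<Longrightarrow> f (r \<odot>\<^bsub>V\<^esub> x) = r \<odot>\<^bsub>W\<^esub> f x"
  shows "f \<in> module_hom K V W"
  using assms by (auto simp: module_hom_def)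

lemma module_hom_in_carrier: "\<lbrakk>f \<in> module_hom K V W; x \<in> carrier V\<rbrakk> \<Longrightarrow> f x \<in> carrier W"
  by (auto simp: module_hom_def)

lemma module_hom_comp:
  "\<lbrakk>f \<in> module_hom K V W; g \<in> module_hom K W Z\<rbrakk> \<Longrightarrow> (\<lambda>x. g (f x)) \<in> module_hom K V Z"
  by (auto simp: module_hom_def Pi_iff)

lemma module_hom_inv_into:
  assumes f: "f \<in> module_hom K V W" and "module K V" and bij: "bij_betw f (carrier V) (carrier W)"
  shows "inv_into (carrier V) f \<in> module_hom K W V"
proof (rule module_homI)
  interpret V: module K V by fact
  let ?g = "inv_into (carrier V) f"
  have g: "?g y \<in> carrier V" "f (?g y) = y" if "y \<in> carrier W" for y
    using that bij by (auto simp: bij_betw_def inv_into_into f_inv_into_f)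
  have fg: "?g (f x) = x" if "x \<in> carrier V" for x
    using that bij by (simp add: bij_betw_def)
  fix x y assume x: "x \<in> carrier W"
  show "?g x \<in> carrier V" using g x by simp
  { assume y: "y \<in> carrier W"
    have "f (?g x \<oplus>\<^bsub>V\<^esub> ?g y) = x \<oplus>\<^bsub>W\<^esub> y"
      using module_hom_add[OF f] x y g by simp
    then show "?g (x \<oplus>\<^bsub>W\<^esub> y) = ?g x \<oplus>\<^bsub>V\<^esub> ?g y"
      using fg[of "?g x \<oplus>\<^bsub>V\<^esub> ?g y"] g x y by simp }
  fix r assume r: "r \<in> carrier K"
  have "f (r \<odot>\<^bsub>V\<^esub> ?g x) = r \<odot>\<^bsub>W\<^esub> x"
    using module_hom_smult[OF f] x r g by simp
  then show "?g (r \<odot>\<^bsub>W\<^esub> x) = r \<odot>\<^bsub>V\<^esub> ?g x"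
    using fg[of "r \<odot>\<^bsub>V\<^esub> ?g x"] g x r by simp
qed

lemma module_hom_finsum:
  assumes "module K V" "module K W" and f: "f \<in> module_hom K V W" and g: "g \<in> I \<rightarrow> carrier V"
  shows "f (\<Oplus>\<^bsub>V\<^esub>i\<in>I. g i) = (\<Oplus>\<^bsub>W\<^esub>i\<in>I. f (g i))"
proof -
  interpret V: module K V by fact
  interpret W: module K W by fact
  interpret mod_hom K V W f
    using assms by (simp add: mod_hom_def mod_hom_axioms_def)
  show ?thesis
    using g
  \<comment> \<open>Over an infinite index set both sums are zero by convention, and
    \<open>f\<close> preserves zero.\<close>
  proof (induct I rule: infinite_finite_induct)
    case (insert a A)
    then have "(\<Oplus>\<^bsub>W\<^esub>i\<in>insert a A. f (g i)) = f (g a) \<oplus>\<^bsub>W\<^esub> (\<Oplus>\<^bsub>W\<^esub>i\<in>A. f (g i))"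
      by (intro W.finsum_insert) auto
    with insert show ?case by simp
  qed auto
qed

lemma scalar_space_simps [simp]:
  "carrier (scalar_space K) = carrier K" "x \<oplus>\<^bsub>scalar_space K\<^esub> y = x \<oplus>\<^bsub>K\<^esub> y"
  "\<zero>\<^bsub>scalar_space K\<^esub> = \<zero>\<^bsub>K\<^esub>" "r \<odot>\<^bsub>scalar_space K\<^esub> x = r \<otimes>\<^bsub>K\<^esub> x"
  by (simp_all add: scalar_space_def)

lemma a_inv_scalar_space [simp]: "a_inv (scalar_space K) = a_inv K"
  by (rule ext) (simp add: a_inv_def m_inv_def scalar_space_def)

lemma module_scalar_space: "cring K \<Longrightarrow> module K (scalar_space K)"
proof -
  assume "cring K"
  then interpret cring K .
  show ?thesis
    by (rule module_criteria)
      (auto simp: a_ac m_ac r_distr l_distr cring_axioms intro: a_inv_closed r_neg)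
qed

section \<open>Extension of linear maps, splittings, and representation of functionals\<close>

context vectorspace
begin

lemma hom_eq_on_gen_set:
  assumes f: "f \<in> module_hom K V W" and g: "g \<in> module_hom K V W" and W: "module K W"
    and B: "finite B" "B \<subseteq> carrier V" "gen_set B"
    and eq: "\<And>b. b \<in> B \<Longrightarrow> f b = g b" and x: "x \<in> carrier V"
  shows "f x = g x"
proof -
  interpret W: module K W by fact
  obtain a where a: "a \<in> B \<rightarrow> carrier K" "lincomb a B = x"
    using finite_in_span[OF B(1,2)] B(3) x by auto
  have ab: "(\<lambda>b. a b \<odot>\<^bsub>V\<^esub> b) \<in> B \<rightarrow> carrier V"
    using a B by auto
  have "f x = (\<Oplus>\<^bsub>W\<^esub>b\<in>B. f (a b \<odot>\<^bsub>V\<^esub> b))"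
    using module_hom_finsum[OF module_axioms W f ab] a by (simp add: lincomb_def)
  also have "\<dots> = (\<Oplus>\<^bsub>W\<^esub>b\<in>B. g (a b \<odot>\<^bsub>V\<^esub> b))"
  proof (rule W.finsum_cong')
    show "(\<lambda>b. g (a b \<odot>\<^bsub>V\<^esub> b)) \<in> B \<rightarrow> carrier W"
      using ab module_hom_in_carrier[OF g] by auto
    fix b assume b: "b \<in> B"
    then have "b \<in> carrier V" "a b \<in> carrier K" using a B by auto
    then show "f (a b \<odot>\<^bsub>V\<^esub> b) = g (a b \<odot>\<^bsub>V\<^esub> b)"
      using module_hom_smult[OF f] module_hom_smult[OF g] eq b by simp
  qed simp
  also have "\<dots> = g x"
    using module_hom_finsum[OF module_axioms W g ab] a by (simp add: lincomb_def)
  finally show ?thesis .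
qed

lemma lincomb_bij:
  assumes "finite B" "basis B"
  shows "bij_betw (\<lambda>a. lincomb a B) (carrier (func_space B)) (carrier V)"
proof -
  have B: "B \<subseteq> carrier V" using assms by (simp add: basis_def)
  have *: "\<exists>!a. a \<in> B \<rightarrow>\<^sub>E carrier K \<and> lincomb a B = v" if "v \<in> carrier V" for v
    using basis_criterion[OF assms(1) B] assms(2) that by blast
  have cl: "lincomb a B \<in> carrier V" if "a \<in> B \<rightarrow>\<^sub>E carrier K" for a
    using that B by (intro lincomb_closed) auto
  show ?thesis
    unfolding bij_betw_def
  proof
    show "inj_on (\<lambda>a. lincomb a B) (carrier (func_space B))"
      using * cl by (auto simp: inj_on_def func_space_def)
    show "(\<lambda>a. lincomb a B) ` carrier (func_space B) = carrier V"
    proof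
      show "carrier V \<subseteq> (\<lambda>a. lincomb a B) ` carrier (func_space B)"
      proof
        fix x assume "x \<in> carrier V"
        from ex1_implies_ex[OF *[OF this]] obtain a where "a \<in> B \<rightarrow>\<^sub>E carrier K" "lincomb a B = x"
          by blast
        then show "x \<in> (\<lambda>a. lincomb a B) ` carrier (func_space B)"
          unfolding func_space_def by (auto intro: rev_image_eqI)
      qed
    qed (use cl in \<open>auto simp: func_space_def\<close>)
  qed
qed

lemma coordinates:
  assumes "finite B" "basis B"
  obtains c where "c \<in> module_hom K V (func_space B)"
    "\<And>x. x \<in> carrier V \<Longrightarrow> lincomb (c x) B = x"
    "bij_betw c (carrier V) (carrier (func_space B))"
proof
  let ?l = "\<lambda>a. lincomb a B"
  let ?c = "inv_into (carrier (func_space B)) ?l"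
  have B: "B \<subseteq> carrier V" using assms by (simp add: basis_def)
  have bij: "bij_betw ?l (carrier (func_space B)) (carrier V)"
    using lincomb_bij[OF assms] .
  have "?l \<in> module_hom K (func_space B) V"
    using lincomb_is_mod_hom[OF assms(1) B] by (simp add: mod_hom_def mod_hom_axioms_def)
  then show "?c \<in> module_hom K V (func_space B)"
    using module_hom_inv_into func_space_is_module bij by blast
  show "bij_betw ?c (carrier V) (carrier (func_space B))"
    using bij by (rule bij_betw_inv_into)
  show "lincomb (?c x) B = x" if "x \<in> carrier V" for x
    using bij_betw_inv_into_right[OF bij that] .
qed

text \<open>The coordinates of \<open>x\<close> serve as coefficients of the prescribed vectors. An
  arbitrary module as target covers lifts into \<gg> as well as scalar functionals.\<close>

lemma extend_hom:
  assumes B: "finite B" "basis B" and W: "module K W" and v: "v \<in> B \<rightarrow> carrier W"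
  obtains e where "e \<in> module_hom K V W" "\<And>b. b \<in> B \<Longrightarrow> e b = v b"
proof -
  interpret W: module K W by fact
  have BV: "B \<subseteq> carrier V" using B by (simp add: basis_def)
  obtain c where c: "c \<in> module_hom K V (func_space B)"
    and lc: "\<And>x. x \<in> carrier V \<Longrightarrow> lincomb (c x) B = x"
    and bij: "bij_betw c (carrier V) (carrier (func_space B))"
    using coordinates[OF B] by blast
  have cB: "c x b \<in> carrier K" if "x \<in> carrier V" "b \<in> B" for x b
    using module_hom_in_carrier[OF c that(1)] that(2) by (auto simp: func_space_def)
  have vB: "v b \<in> carrier W" if "b \<in> B" for b using that v by auto
  define e where "e = (\<lambda>x. \<Oplus>\<^bsub>W\<^esub>b\<in>B. c x b \<odot>\<^bsub>W\<^esub> v b)"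
  have e: "e \<in> module_hom K V W"
  proof (rule module_homI)
    fix x y assume x: "x \<in> carrier V"
    show "e x \<in> carrier W"
      unfolding e_def using cB[OF x] vB by (auto intro!: W.finsum_closed)
    { assume y: "y \<in> carrier V"
      have "c (x \<oplus>\<^bsub>V\<^esub> y) b = c x b \<oplus>\<^bsub>K\<^esub> c y b" if "b \<in> B" for b
        using module_hom_add[OF c x y] that by (simp add: func_space_def)
      then have "e (x \<oplus>\<^bsub>V\<^esub> y) = (\<Oplus>\<^bsub>W\<^esub>b\<in>B. c x b \<odot>\<^bsub>W\<^esub> v b \<oplus>\<^bsub>W\<^esub> c y b \<odot>\<^bsub>W\<^esub> v b)"
        unfolding e_def using x y cB vB by (intro W.finsum_cong') (auto simp: W.smult_l_distr)
      also have "\<dots> = e x \<oplus>\<^bsub>W\<^esub> e y"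
        unfolding e_def using x y cB vB by (intro W.finsum_addf) auto
      finally show "e (x \<oplus>\<^bsub>V\<^esub> y) = e x \<oplus>\<^bsub>W\<^esub> e y" . }
    fix r assume r: "r \<in> carrier K"
    have "c (r \<odot>\<^bsub>V\<^esub> x) b = r \<otimes>\<^bsub>K\<^esub> c x b" if "b \<in> B" for b
      using module_hom_smult[OF c r x] that by (simp add: func_space_def)
    then have "e (r \<odot>\<^bsub>V\<^esub> x) = (\<Oplus>\<^bsub>W\<^esub>b\<in>B. r \<odot>\<^bsub>W\<^esub> (c x b \<odot>\<^bsub>W\<^esub> v b))"
      unfolding e_def using x r cB vB by (intro W.finsum_cong') (auto simp: W.smult_assoc1)
    also have "\<dots> = r \<odot>\<^bsub>W\<^esub> e x"
      unfolding e_def using x r B cB vB by (intro W.finsum_smult_ldistr[symmetric]) auto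
    finally show "e (r \<odot>\<^bsub>V\<^esub> x) = r \<odot>\<^bsub>W\<^esub> e x" .
  qed
  have "e b = v b" if b: "b \<in> B" for b
  proof -
    have bV: "b \<in> carrier V" using b BV by auto
    \<comment> \<open>\<open>?d\<close> is the Kronecker vector of \<open>b\<close>; injectivity of
      \<open>lincomb\<close> on extensional coefficient functions identifies it with the coordinates
      of \<open>b\<close>.\<close>
    let ?d = "\<lambda>i\<in>B. if i = b then \<one>\<^bsub>K\<^esub> else \<zero>\<^bsub>K\<^esub>"
    have d: "?d \<in> carrier (func_space B)" by (auto simp: func_space_def)
    have "lincomb ?d B = (\<Oplus>\<^bsub>V\<^esub>i\<in>B. if b = i then i else \<zero>\<^bsub>V\<^esub>)"
      unfolding lincomb_def using BV by (intro M.finsum_cong') auto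
    also have "\<dots> = b"
      using M.finsum_singleton[OF b B(1), of "\<lambda>i. i"] BV by auto
    finally have "lincomb ?d B = lincomb (c b) B" using lc[OF bV] by simp
    then have "c b = ?d"
      using lincomb_bij[OF B] d module_hom_in_carrier[OF c bV] by (auto simp: bij_betw_def inj_on_def)
    then have "e b = (\<Oplus>\<^bsub>W\<^esub>i\<in>B. if b = i then v i else \<zero>\<^bsub>W\<^esub>)"
      unfolding e_def using vB by (intro W.finsum_cong') auto
    also have "\<dots> = v b"
      using W.finsum_singleton[OF b B(1), of v] v by auto
    finally show ?thesis .
  qed
  with e show ?thesis using that by blast
qed

text \<open>A surjection onto a finite-dimensional space splits, because it is enough to lift a
  basis. This provides linear sections of the projection onto \<hh>, not yet isotropic ones.\<close>

lemma section_exists: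
  assumes "fin_dim" and W: "module K W" and p: "p \<in> module_hom K W V"
    and surj: "p ` carrier W = carrier V"
  obtains s where "s \<in> module_hom K V W" "\<And>x. x \<in> carrier V \<Longrightarrow> p (s x) = x"
proof -
  obtain B where B: "finite B" "basis B" using finite_basis_exists assms(1) by blast
  then have BV: "B \<subseteq> carrier V" "gen_set B" by (auto simp: basis_def)
  have v: "inv_into (carrier W) p \<in> B \<rightarrow> carrier W"
    using surj BV by (auto intro!: inv_into_into)
  obtain s where s: "s \<in> module_hom K V W" "\<And>b. b \<in> B \<Longrightarrow> s b = inv_into (carrier W) p b"
    using extend_hom[OF B W v] by blast
  have "p (s x) = x" if x: "x \<in> carrier V" for x
  proof (rule hom_eq_on_gen_set[where f="\<lambda>x. p (s x)" and g="\<lambda>x. x" and W=V and B=B])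
    show "(\<lambda>x. p (s x)) \<in> module_hom K V V" using s(1) p by (rule module_hom_comp)
    show "(\<lambda>x. x) \<in> module_hom K V V" by (auto simp: module_hom_def)
    show "p (s b) = b" if "b \<in> B" for b
      using s(2)[OF that] that BV surj by (auto simp: f_inv_into_f)
  qed (use x BV B module_axioms in auto)
  with s show ?thesis using that by blast
qed

text \<open>An injective map sends a basis to an independent set of the same size, which is again a
  basis. This is the dimension count behind \<open>nondegenerate_represents\<close>.\<close>

lemma inj_endo_surj:
  assumes fd: fin_dim and T: "T \<in> module_hom K V V" and inj: "inj_on T (carrier V)"
  shows "T ` carrier V = carrier V"
proof -
  interpret T: linear_map K V V T
    using T by (simp add: linear_map_def mod_hom_def mod_hom_axioms_def vectorspace_axioms module_axioms)
  obtain B where B: "finite B" "basis B" using finite_basis_exists fd by blast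
  then have BV: "B \<subseteq> carrier V" "gen_set B" "lin_indpt B" by (auto simp: basis_def)
  have TB: "T ` B \<subseteq> carrier V" using BV by auto
  have injB: "inj_on T B" using inj BV by (meson inj_on_subset)
  have "lin_indpt (T ` B)"
  proof (rule finite_lin_indpt2)
    fix a assume a: "a \<in> T ` B \<rightarrow> carrier K" and "lincomb a (T ` B) = \<zero>\<^bsub>V\<^esub>"
    then have 0: "T (lincomb (a \<circ> T) B) = \<zero>\<^bsub>V\<^esub>"
      using T.lincomb_linear_image[OF inj BV(1) a B(1)] by simp
    have aT: "a \<circ> T \<in> B \<rightarrow> carrier K" using a by auto
    have "lincomb (a \<circ> T) B = \<zero>\<^bsub>V\<^esub>"
    proof (rule inj_onD[OF inj])
      show "T (lincomb (a \<circ> T) B) = T \<zero>\<^bsub>V\<^esub>" using 0 by simp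
      show "lincomb (a \<circ> T) B \<in> carrier V" by (rule lincomb_closed[OF BV(1) aT])
    qed simp
    then have "a \<circ> T \<in> B \<rightarrow> {\<zero>\<^bsub>K\<^esub>}"
      using not_lindepD[OF BV(3) B(1) subset_refl aT] by blast
    then show "\<forall>v\<in>T ` B. a v = \<zero>\<^bsub>K\<^esub>" by auto
  qed (use B TB in auto)
  moreover have "card (T ` B) = dim"
    using dim_basis[OF B] card_image[OF injB] by simp
  ultimately have "basis (T ` B)"
    using dim_li_is_basis[OF fd] B TB by simp
  then have g: "gen_set (T ` B)" by (simp add: basis_def)
  have "carrier V \<subseteq> T ` carrier V"
  proof
    fix x assume "x \<in> carrier V"
    then obtain a where a: "a \<in> T ` B \<rightarrow> carrier K" "lincomb a (T ` B) = x"
      using finite_in_span[of "T ` B" x] B TB g by auto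
    have "x = T (lincomb (a \<circ> T) B)"
      using T.lincomb_linear_image[OF inj BV(1) a(1) B(1)] a by simp
    moreover have "lincomb (a \<circ> T) B \<in> carrier V"
      using a BV by (intro lincomb_closed) auto
    ultimately show "x \<in> T ` carrier V" by blast
  qed
  then show ?thesis by auto
qed

text \<open>With a fixed basis \<open>B\<close>, the functional \<omega>(x, .) is encoded by the
  vector of \<open>V\<close> with coordinates \<omega>(x, b). Passing from \<open>x\<close> to this
  vector is an endomorphism of \<open>V\<close>, injective by nondegeneracy and hence surjective; a
  preimage of the vector with coordinates \<open>f b\<close> represents \<open>f\<close>.\<close>

lemma nondegenerate_represents:
  assumes fd: fin_dim and \<omega>: "bilinear_map K V V (scalar_space K) \<omega>"
    and nd: "\<And>u. \<lbrakk>u \<in> carrier V; \<And>v. v \<in> carrier V \<Longrightarrow> \<omega> u v = \<zero>\<^bsub>K\<^esub>\<rbrakk> \<Longrightarrow> u = \<zero>\<^bsub>V\<^esub>"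
    and f: "f \<in> module_hom K V (scalar_space K)"
  obtains x where "x \<in> carrier V" "\<And>y. y \<in> carrier V \<Longrightarrow> \<omega> x y = f y"
proof -
  have K: "cring K" and SK: "module K (scalar_space K)"
    using module_scalar_space R.cring_axioms by (auto intro: R.cring_axioms)
  obtain B where B: "finite B" "basis B" using finite_basis_exists fd by blast
  then have BV: "B \<subseteq> carrier V" "gen_set B" "lin_indpt B" by (auto simp: basis_def)
  have r: "\<omega> x \<in> module_hom K V (scalar_space K)" if "x \<in> carrier V" for x
    using \<omega> that by (simp add: bilinear_map_def)
  have l: "(\<lambda>x. \<omega> x y) \<in> module_hom K V (scalar_space K)" if "y \<in> carrier V" for y
    using \<omega> that by (simp add: bilinear_map_def)
  have cl: "\<omega> x y \<in> carrier K" if "x \<in> carrier V" "y \<in> carrier V" for x y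
    using module_hom_in_carrier[OF r[OF that(1)] that(2)] by simp
  interpret lc: mod_hom K "func_space B" V "\<lambda>a. lincomb a B"
    by (rule lincomb_is_mod_hom[OF B(1) BV(1)])
  define T where "T = (\<lambda>x. lincomb (\<lambda>b\<in>B. \<omega> x b) B)"
  have fs: "(\<lambda>b\<in>B. \<omega> x b) \<in> carrier (func_space B)" if "x \<in> carrier V" for x
    using cl[OF that] BV by (auto simp: func_space_def)
  have T: "T \<in> module_hom K V V"
  proof (rule module_homI)
    fix x y assume x: "x \<in> carrier V"
    show "T x \<in> carrier V" unfolding T_def using fs[OF x] by simp
    { assume y: "y \<in> carrier V"
      have "(\<lambda>b\<in>B. \<omega> (x \<oplus>\<^bsub>V\<^esub> y) b) = (\<lambda>b\<in>B. \<omega> x b) \<oplus>\<^bsub>func_space B\<^esub> (\<lambda>b\<in>B. \<omega> y b)"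
        using module_hom_add[OF l x y] BV by (auto simp: func_space_def fun_eq_iff)
      then show "T (x \<oplus>\<^bsub>V\<^esub> y) = T x \<oplus>\<^bsub>V\<^esub> T y"
        unfolding T_def using lc.f_add fs x y by simp }
    fix r assume r: "r \<in> carrier K"
    have "(\<lambda>b\<in>B. \<omega> (r \<odot>\<^bsub>V\<^esub> x) b) = r \<odot>\<^bsub>func_space B\<^esub> (\<lambda>b\<in>B. \<omega> x b)"
      using module_hom_smult[OF l r x] BV by (auto simp: func_space_def fun_eq_iff)
    then show "T (r \<odot>\<^bsub>V\<^esub> x) = r \<odot>\<^bsub>V\<^esub> T x"
      unfolding T_def using lc.f_smult fs x r by simp
  qed
  interpret T: linear_map K V V T
    using T by (simp add: linear_map_def mod_hom_def mod_hom_axioms_def vectorspace_axioms module_axioms)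
  have lin: "\<omega> x y = f y" if "x \<in> carrier V" "f \<in> module_hom K V (scalar_space K)"
    "\<And>b. b \<in> B \<Longrightarrow> \<omega> x b = f b" "y \<in> carrier V" for x y f
    using hom_eq_on_gen_set[OF r[OF that(1)] that(2) SK B(1) BV(1,2) that(3,4)] .
  have lbij: "inj_on (\<lambda>a. lincomb a B) (carrier (func_space B))"
    using lincomb_bij[OF B] by (simp add: bij_betw_def)
  have z: "(\<lambda>y. \<zero>\<^bsub>K\<^esub>) \<in> module_hom K V (scalar_space K)" by (auto simp: module_hom_def)
  have "x = \<zero>\<^bsub>V\<^esub>" if x: "x \<in> carrier V" and "T x = \<zero>\<^bsub>V\<^esub>" for x
  proof -
    have "lincomb (\<lambda>b\<in>B. \<omega> x b) B = lincomb \<zero>\<^bsub>func_space B\<^esub> B"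
      using that unfolding T_def by simp
    then have eq: "(\<lambda>b\<in>B. \<omega> x b) = \<zero>\<^bsub>func_space B\<^esub>"
      using lbij fs[OF x] lc.M.M.zero_closed unfolding inj_on_def by blast
    have "\<omega> x b = \<zero>\<^bsub>K\<^esub>" if "b \<in> B" for b
      using that fun_cong[OF eq, of b] by (simp add: func_space_def)
    then have "\<omega> x y = \<zero>\<^bsub>K\<^esub>" if "y \<in> carrier V" for y
      using lin[OF x z] that by blast
    then show ?thesis using nd x by blast
  qed
  then have "carrier (vs T.kerT) = {\<zero>\<^bsub>V\<^esub>}" by (auto simp: T.ker_def)
  then have "inj_on T (carrier V)" by (rule T.Ke0_imp_inj)
  then have surj: "T ` carrier V = carrier V" using inj_endo_surj[OF fd T] by simp
  have fB: "(\<lambda>b\<in>B. f b) \<in> carrier (func_space B)"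
    using module_hom_in_carrier[OF f] BV by (auto simp: func_space_def)
  then obtain x where x: "x \<in> carrier V" "T x = lincomb (\<lambda>b\<in>B. f b) B"
    using surj lc.f_im[OF fB] by (metis (no_types, lifting) image_iff)
  then have eq: "(\<lambda>b\<in>B. \<omega> x b) = (\<lambda>b\<in>B. f b)"
    using lbij fs[OF x(1)] fB unfolding inj_on_def T_def by blast
  have "\<omega> x b = f b" if "b \<in> B" for b
  proof -
    have "(\<lambda>b\<in>B. \<omega> x b) b = (\<lambda>b\<in>B. f b) b" by (simp only: eq)
    then show ?thesis using that by simp
  qed
  then show ?thesis using that[OF x(1)] lin[OF x(1) f] by blast
qed

end


section \<open>Cardinality of finite-dimensional spaces\<close>

text \<open>One coordinate is split off at a time, and the square of an infinite set is absorbed by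
  the set.\<close>

lemma lepoll_PiE_finite:
  assumes "finite B" "infinite A"
  shows "(B \<rightarrow>\<^sub>E A) \<lesssim> A"
  using assms(1)
proof induct
  case empty
  obtain a where "a \<in> A" using infinite_imp_nonempty[OF assms(2)] by blast
  then show ?case by (auto simp: lepoll_def')
next
  case (insert x B)
  have "(insert x B \<rightarrow>\<^sub>E A) \<lesssim> A \<times> (B \<rightarrow>\<^sub>E A)"
    unfolding lepoll_def'
  proof (intro exI conjI)
    let ?f = "\<lambda>h. (h x, restrict h B)"
    show "inj_on ?f (insert x B \<rightarrow>\<^sub>E A)"
    proof (rule inj_onI, rule PiE_ext)
      fix g h i assume "?f g = ?f h" "i \<in> insert x B"
      then show "g i = h i" by (metis insert_iff prod.inject restrict_apply')
    qed
  qed auto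
  also have "A \<times> (B \<rightarrow>\<^sub>E A) \<lesssim> A \<times> A"
    using insert by (intro times_lepoll_mono) auto
  also have "A \<times> A \<approx> A"
    using card_of_Times_same_infinite[OF assms(2)] by (simp add: eqpoll_iff_card_of_ordIso)
  finally show ?case .
qed

text \<open>If two multiples of the unit coincide, the multiple by the difference of the factors
  vanishes, so the factors agree.\<close>

lemma char_zero_infinite:
  assumes "field K" "char_zero K"
  shows "infinite (carrier K)"
proof -
  interpret field K by fact
  have "inj (\<lambda>n::nat. [n] \<cdot>\<^bsub>K\<^esub> \<one>\<^bsub>K\<^esub>)"
  proof (rule injI)
    have *: "m = n" if "[m] \<cdot>\<^bsub>K\<^esub> \<one>\<^bsub>K\<^esub> = [n] \<cdot>\<^bsub>K\<^esub> \<one>\<^bsub>K\<^esub>" "m \<le> n" for m n :: nat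
    proof -
      have "[n] \<cdot>\<^bsub>K\<^esub> \<one>\<^bsub>K\<^esub> = [m] \<cdot>\<^bsub>K\<^esub> \<one>\<^bsub>K\<^esub> \<oplus>\<^bsub>K\<^esub> [(n - m)] \<cdot>\<^bsub>K\<^esub> \<one>\<^bsub>K\<^esub>"
        using that(2) by (simp add: add.nat_pow_mult)
      then have "[(n - m)] \<cdot>\<^bsub>K\<^esub> \<one>\<^bsub>K\<^esub> = \<zero>\<^bsub>K\<^esub>"
        using that(1) by (metis add.l_cancel_one add.nat_pow_closed one_closed)
      then have "\<not> 0 < n - m" using assms(2) unfolding char_zero_def by blast
      then show ?thesis using that(2) by simp
    qed
    show "m = n" if "[m] \<cdot>\<^bsub>K\<^esub> \<one>\<^bsub>K\<^esub> = [n] \<cdot>\<^bsub>K\<^esub> \<one>\<^bsub>K\<^esub>" for m n :: nat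
      using *[of m n] *[of n m] that by (cases "m \<le> n") auto
  qed
  moreover have "range (\<lambda>n::nat. [n] \<cdot>\<^bsub>K\<^esub> \<one>\<^bsub>K\<^esub>) \<subseteq> carrier K" by auto
  ultimately show ?thesis using finite_subset range_inj_infinite by blast
qed

text \<open>A vector amounts to a finite tuple of coordinates, and finite powers of an infinite set
  inject into it. This is why a type containing the field contains a copy of each space.\<close>

lemma (in vectorspace) carrier_lepoll_field:
  assumes "fin_dim" "infinite (carrier K)"
  shows "carrier V \<lesssim> carrier K"
proof -
  obtain B where B: "finite B" "basis B" using finite_basis_exists assms(1) by blast
  have "(B \<rightarrow>\<^sub>E carrier K) \<approx> carrier V"
    using lincomb_bij[OF B] by (auto simp: func_space_def eqpoll_def)
  then have "carrier V \<approx> (B \<rightarrow>\<^sub>E carrier K)" by (rule eqpoll_sym)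
  then show ?thesis
    using lepoll_PiE_finite[OF B(1) assms(2)] lepoll_trans1 by blast
qed

section \<open>Images of spaces and of Lie algebras\<close>

text \<open>\<open>W\<close> is only a record of operations; surjectivity makes each of them the
  image of an operation of \<open>V\<close>, and the axioms are inherited. It serves for cosets, for
  copies in another type and for the model.\<close>

lemma vectorspace_hom_image:
  assumes "vectorspace K V" and p: "p \<in> module_hom K V W"
    and surj: "p ` carrier V = carrier W" and zero: "p \<zero>\<^bsub>V\<^esub> = \<zero>\<^bsub>W\<^esub>"
  shows "vectorspace K W"
proof -
  interpret V: vectorspace K V by fact
  have add: "p x \<oplus>\<^bsub>W\<^esub> p y = p (x \<oplus>\<^bsub>V\<^esub> y)" if "x \<in> carrier V" "y \<in> carrier V" for x y
    using module_hom_add[OF p that] by simp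
  have smult: "r \<odot>\<^bsub>W\<^esub> p x = p (r \<odot>\<^bsub>V\<^esub> x)" if "r \<in> carrier K" "x \<in> carrier V" for r x
    using module_hom_smult[OF p that] by simp
  show ?thesis
    by (rule vs_criteria)
      (auto simp: surj[symmetric] zero[symmetric] add smult V.M.a_ac V.smult_assoc1
        V.smult_l_distr V.smult_r_distr V.field_axioms intro: arg_cong[where f=p] V.M.a_inv_closed V.M.r_neg)
qed

lemma linear_mapI:
  "\<lbrakk>vectorspace K V; vectorspace K W; p \<in> module_hom K V W\<rbrakk> \<Longrightarrow> linear_map K V W p"
  by (simp add: linear_map_def mod_hom_def mod_hom_axioms_def vectorspace_def)

lemma bilinear_mapI:
  assumes "\<And>u v. \<lbrakk>u \<in> carrier U; v \<in> carrier V\<rbrakk> \<Longrightarrow> f u v \<in> carrier W"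
    and "\<And>u v w. \<lbrakk>u \<in> carrier U; v \<in> carrier V; w \<in> carrier V\<rbrakk> \<Longrightarrow> f u (v \<oplus>\<^bsub>V\<^esub> w) = f u v \<oplus>\<^bsub>W\<^esub> f u w"
    and "\<And>u v w. \<lbrakk>u \<in> carrier U; w \<in> carrier U; v \<in> carrier V\<rbrakk> \<Longrightarrow> f (u \<oplus>\<^bsub>U\<^esub> w) v = f u v \<oplus>\<^bsub>W\<^esub> f w v"
    and "\<And>r u v. \<lbrakk>r \<in> carrier K; u \<in> carrier U; v \<in> carrier V\<rbrakk> \<Longrightarrow> f u (r \<odot>\<^bsub>V\<^esub> v) = r \<odot>\<^bsub>W\<^esub> f u v"
    and "\<And>r u v. \<lbrakk>r \<in> carrier K; u \<in> carrier U; v \<in> carrier V\<rbrakk> \<Longrightarrow> f (r \<odot>\<^bsub>U\<^esub> u) v = r \<odot>\<^bsub>W\<^esub> f u v"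
  shows "bilinear_map K U V W f"
  using assms unfolding bilinear_map_def by (auto intro!: module_homI)

lemma bilinear_mapD:
  assumes "bilinear_map K U V W f"
  shows "\<lbrakk>u \<in> carrier U; v \<in> carrier V\<rbrakk> \<Longrightarrow> f u v \<in> carrier W"
    and "\<lbrakk>u \<in> carrier U; v \<in> carrier V; w \<in> carrier V\<rbrakk> \<Longrightarrow> f u (v \<oplus>\<^bsub>V\<^esub> w) = f u v \<oplus>\<^bsub>W\<^esub> f u w"
    and "\<lbrakk>u \<in> carrier U; u' \<in> carrier U; v \<in> carrier V\<rbrakk> \<Longrightarrow> f (u \<oplus>\<^bsub>U\<^esub> u') v = f u v \<oplus>\<^bsub>W\<^esub> f u' v"
    and "\<lbrakk>r \<in> carrier K; u \<in> carrier U; v \<in> carrier V\<rbrakk> \<Longrightarrow> f u (r \<odot>\<^bsub>V\<^esub> v) = r \<odot>\<^bsub>W\<^esub> f u v"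
    and "\<lbrakk>r \<in> carrier K; u \<in> carrier U; v \<in> carrier V\<rbrakk> \<Longrightarrow> f (r \<odot>\<^bsub>U\<^esub> u) v = r \<odot>\<^bsub>W\<^esub> f u v"
  using assms unfolding bilinear_map_def module_hom_def by auto

text \<open>Each identity in \<open>M\<close> is the image of the same identity in \<open>L\<close>.
  Applied to the coset projection and to transport along an injection.\<close>

lemma fin_dim_lie_algebra_hom_image:
  assumes "fin_dim_lie_algebra K L" and p: "p \<in> module_hom K L M"
    and surj: "p ` carrier L = carrier M" and zero: "p \<zero>\<^bsub>L\<^esub> = \<zero>\<^bsub>M\<^esub>"
    and br: "\<And>x y. \<lbrakk>x \<in> carrier L; y \<in> carrier L\<rbrakk> \<Longrightarrow> p (bracket L x y) = bracket M (p x) (p y)"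
  shows "fin_dim_lie_algebra K M"
proof -
  interpret L: fin_dim_lie_algebra K L by fact
  note bil = bilinear_mapD[OF L.bracket_bilinear]
  have vs: "vectorspace K M"
    using vectorspace_hom_image[OF L.vectorspace_axioms p surj zero] .
  interpret linear_map K L M p
    using linear_mapI[OF L.vectorspace_axioms vs p] .
  have fd: "vectorspace.fin_dim K M"
    using surj_fin_dim[OF L.finite_dimensional surj] .
  show ?thesis
  proof (intro fin_dim_lie_algebra.intro fin_dim_lie_algebra_axioms.intro vs fd)
    show "bilinear_map K M M M (bracket M)"
      unfolding surj[symmetric]
      by (rule bilinear_mapI)
        (auto simp: surj[symmetric] br[symmetric] bil f_add[symmetric] f_smult[symmetric] simp del: f_add f_smult)
    show "bracket M x x = \<zero>\<^bsub>M\<^esub>" if "x \<in> carrier M" for x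
      using that L.bracket_self by (auto simp: surj[symmetric] br[symmetric] zero)
    fix x y z assume "x \<in> carrier M" "y \<in> carrier M" "z \<in> carrier M"
    then obtain x' y' z' where *: "x' \<in> carrier L" "y' \<in> carrier L" "z' \<in> carrier L"
      "x = p x'" "y = p y'" "z = p z'" by (auto simp: surj[symmetric])
    show "bracket M x (bracket M y z) \<oplus>\<^bsub>M\<^esub> bracket M y (bracket M z x)
        \<oplus>\<^bsub>M\<^esub> bracket M z (bracket M x y) = \<zero>\<^bsub>M\<^esub>"
      using arg_cong[OF L.jacobi[OF *(1-3)], of p] * by (simp add: bil br zero)
  qed
qed

section \<open>Dual spaces and cochains\<close>

lemma (in module) functional_ops:
  assumes f: "f \<in> module_hom R M (scalar_space R)"
  shows functional_add: "g \<in> module_hom R M (scalar_space R) \<Longrightarrow> (\<lambda>x. f x \<oplus> g x) \<in> module_hom R M (scalar_space R)"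
    and functional_neg: "(\<lambda>x. \<ominus> f x) \<in> module_hom R M (scalar_space R)"
    and functional_smult: "r \<in> carrier R \<Longrightarrow> (\<lambda>x. r \<otimes> f x) \<in> module_hom R M (scalar_space R)"
proof -
  note fD = module_hom_in_carrier[OF f, simplified] module_hom_add[OF f, simplified]
    module_hom_smult[OF f, simplified]
  show "(\<lambda>x. f x \<oplus> g x) \<in> module_hom R M (scalar_space R)" if g: "g \<in> module_hom R M (scalar_space R)"
  proof (rule module_homI)
    note gD = module_hom_in_carrier[OF g, simplified] module_hom_add[OF g, simplified]
      module_hom_smult[OF g, simplified]
    fix x y r assume x: "x \<in> carrier M"
    show "f x \<oplus> g x \<in> carrier (scalar_space R)" using fD gD x by simp
    show "f (x \<oplus>\<^bsub>M\<^esub> y) \<oplus> g (x \<oplus>\<^bsub>M\<^esub> y) = f x \<oplus> g x \<oplus>\<^bsub>scalar_space R\<^esub> (f y \<oplus> g y)"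
      if "y \<in> carrier M" using fD gD x that by (simp add: R.a_ac)
    show "f (r \<odot>\<^bsub>M\<^esub> x) \<oplus> g (r \<odot>\<^bsub>M\<^esub> x) = r \<odot>\<^bsub>scalar_space R\<^esub> (f x \<oplus> g x)"
      if "r \<in> carrier R" using fD gD x that by (simp add: R.r_distr)
  qed
  show "(\<lambda>x. \<ominus> f x) \<in> module_hom R M (scalar_space R)"
    by (rule module_homI) (simp_all add: fD R.minus_add R.r_minus)
  show "(\<lambda>x. r \<otimes> f x) \<in> module_hom R M (scalar_space R)" if "r \<in> carrier R"
    using that by (intro module_homI) (simp_all add: fD R.r_distr R.m_lcomm)
qed

lemma (in module) functional_diff:
  "\<lbrakk>f \<in> module_hom R M (scalar_space R); g \<in> module_hom R M (scalar_space R)\<rbrakk>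
    \<Longrightarrow> (\<lambda>x. f x \<ominus> g x) \<in> module_hom R M (scalar_space R)"
  unfolding a_minus_def by (intro functional_add functional_neg)

lemma (in module) functional_zero: "(\<lambda>x. \<zero>) \<in> module_hom R M (scalar_space R)"
  by (rule module_homI) simp_all

lemma module_hom_cong:
  "(\<And>x. x \<in> carrier V \<Longrightarrow> f x = g x) \<Longrightarrow> module K V \<Longrightarrow> f \<in> module_hom K V W \<longleftrightarrow> g \<in> module_hom K V W"
proof -
  assume eq: "\<And>x. x \<in> carrier V \<Longrightarrow> f x = g x" and "module K V"
  then interpret V: module K V by simp
  show ?thesis using eq by (auto simp: module_hom_def Pi_iff)
qed

text \<open>Elements of the dual are extensional, whereas functionals such as \<omega>(x, s(.)) are
  not; this equivalence passes between the two.\<close>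

lemma (in module) functional_restrict:
  "(restrict f (carrier M) \<in> module_hom R M (scalar_space R)) = (f \<in> module_hom R M (scalar_space R))"
  by (auto simp: module_hom_def Pi_iff)

section \<open>The dual space, and cochains as scalar-valued forms\<close>

locale lie_alg = fin_dim_lie_algebra K L
  for K :: "('k, 'm) ring_scheme" (structure) and L :: "('k, 'v) lie_algebra"
begin

lemmas bracket_bil = bilinear_mapD[OF bracket_bilinear]

lemma dual_space_def': "dual_space K L = (func_space (carrier L))
     \<lparr>carrier := module_hom K L (scalar_space K) \<inter> extensional (carrier L)\<rparr>"
  by (simp add: dual_space_def)

lemma dual_simps:
  "\<xi> \<in> carrier (dual_space K L) \<longleftrightarrow> \<xi> \<in> module_hom K L (scalar_space K) \<and> \<xi> \<in> extensional (carrier L)"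
  "\<xi> \<oplus>\<^bsub>dual_space K L\<^esub> \<eta> = (\<lambda>x\<in>carrier L. \<xi> x \<oplus> \<eta> x)"
  "r \<odot>\<^bsub>dual_space K L\<^esub> \<xi> = (\<lambda>x\<in>carrier L. r \<otimes> \<xi> x)"
  "\<zero>\<^bsub>dual_space K L\<^esub> = (\<lambda>x\<in>carrier L. \<zero>)"
  by (auto simp: dual_space_def' func_space_def)

lemma dual_vectorspace: "vectorspace K (dual_space K L)"
proof -
  interpret F: module K "func_space (carrier L)" by (rule func_space_is_module)
  have "submodule K (module_hom K L (scalar_space K) \<inter> extensional (carrier L)) (func_space (carrier L))"
  proof (rule submodule.intro[OF func_space_is_module])
    show "module_hom K L (scalar_space K) \<inter> extensional (carrier L) \<subseteq> carrier (func_space (carrier L))"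
      by (auto simp: func_space_def module_hom_def PiE_def)
  qed (auto simp: func_space_def functional_restrict functional_add functional_smult functional_zero)
  then have "module K (dual_space K L)"
    using F.submodule_is_module unfolding dual_space_def' by blast
  then show ?thesis by (simp add: vectorspace_def field_axioms)
qed

sublocale dual: vectorspace K "dual_space K L" by (rule dual_vectorspace)

lemma dual_eqI:
  "\<lbrakk>\<xi> \<in> carrier (dual_space K L); \<eta> \<in> carrier (dual_space K L); \<And>x. x \<in> carrier L \<Longrightarrow> \<xi> x = \<eta> x\<rbrakk>
    \<Longrightarrow> \<xi> = \<eta>"
  by (auto simp: dual_simps intro: extensionalityI)

lemma dual_closed [simp]: "\<lbrakk>\<xi> \<in> carrier (dual_space K L); x \<in> carrier L\<rbrakk> \<Longrightarrow> \<xi> x \<in> carrier K"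
  by (auto simp: dual_simps module_hom_def)

lemma dual_add: "x \<in> carrier L \<Longrightarrow> (\<xi> \<oplus>\<^bsub>dual_space K L\<^esub> \<eta>) x = \<xi> x \<oplus> \<eta> x"
  by (simp add: dual_simps(2))

text \<open>Subtraction in the dual comes from the abstract additive inverse of the record, so its
  pointwise value has to be derived from uniqueness of negatives in the field.\<close>

lemma dual_minus:
  assumes "\<xi> \<in> carrier (dual_space K L)" "\<eta> \<in> carrier (dual_space K L)" "x \<in> carrier L"
  shows "(\<xi> \<ominus>\<^bsub>dual_space K L\<^esub> \<eta>) x = \<xi> x \<ominus> \<eta> x"
proof -
  have "(\<ominus>\<^bsub>dual_space K L\<^esub> \<eta> \<oplus>\<^bsub>dual_space K L\<^esub> \<eta>) x = \<zero>"
    using dual.M.l_neg[OF assms(2)] assms(3) by (simp add: dual_simps)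
  then have "(\<ominus>\<^bsub>dual_space K L\<^esub> \<eta>) x \<oplus> \<eta> x = \<zero>" using assms(3) by (simp add: dual_simps)
  moreover have "(\<ominus>\<^bsub>dual_space K L\<^esub> \<eta>) x \<in> carrier K" "\<eta> x \<in> carrier K"
    using assms dual.M.a_inv_closed by auto
  ultimately have "(\<ominus>\<^bsub>dual_space K L\<^esub> \<eta>) x = \<ominus> \<eta> x"
    using R.minus_equality[of "(\<ominus>\<^bsub>dual_space K L\<^esub> \<eta>) x" "\<eta> x"] by simp
  then show ?thesis
    using assms by (simp add: a_minus_def dual_simps)
qed

text \<open>Restriction to a basis of \<open>L\<close> identifies the dual with the space of
  coordinate vectors, and that space is identified with \<open>L\<close>. Inverting the composite
  exhibits the dual as a linear image of \<open>L\<close>.\<close>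

lemma dual_fin_dim: "dual.fin_dim"
proof -
  obtain B where B: "finite B" "basis B" using finite_basis_exists finite_dimensional by blast
  then have BL: "B \<subseteq> carrier L" "gen_set B" by (auto simp: basis_def)
  note SK = module_scalar_space[OF R.cring_axioms]
  let ?r = "\<lambda>\<xi>. restrict \<xi> B"
  let ?l = "\<lambda>a. lincomb a B"
  let ?g = "\<lambda>\<xi>. ?l (?r \<xi>)"
  have r: "?r \<in> module_hom K (dual_space K L) (func_space B)"
  proof (rule module_homI)
    show "?r \<xi> \<in> carrier (func_space B)" if "\<xi> \<in> carrier (dual_space K L)" for \<xi>
      using that BL dual_closed by (auto simp: func_space_def)
  qed (use BL in \<open>auto simp: func_space_def dual_simps(2,3) restrict_def fun_eq_iff\<close>)
  have "?l \<in> module_hom K (func_space B) L"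
    using lincomb_is_mod_hom[OF B(1) BL(1)] by (simp add: mod_hom_def mod_hom_axioms_def)
  then have g: "?g \<in> module_hom K (dual_space K L) L"
    by (rule module_hom_comp[OF r])
  have "bij_betw ?r (carrier (dual_space K L)) (carrier (func_space B))"
    unfolding bij_betw_def
  proof
    show "inj_on ?r (carrier (dual_space K L))"
    proof (rule inj_onI, rule dual_eqI)
      fix \<xi> \<eta> x assume *: "\<xi> \<in> carrier (dual_space K L)" "\<eta> \<in> carrier (dual_space K L)"
        "?r \<xi> = ?r \<eta>" "x \<in> carrier L"
      then have "\<xi> b = \<eta> b" if "b \<in> B" for b
        using that by (metis restrict_apply')
      then show "\<xi> x = \<eta> x"
        using hom_eq_on_gen_set[OF _ _ SK B(1) BL _ *(4), of \<xi> \<eta>] * by (auto simp: dual_simps)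
    qed
    show "?r ` carrier (dual_space K L) = carrier (func_space B)"
    proof
      show "?r ` carrier (dual_space K L) \<subseteq> carrier (func_space B)"
        using module_hom_in_carrier[OF r] by auto
      show "carrier (func_space B) \<subseteq> ?r ` carrier (dual_space K L)"
      proof
        fix a assume a: "a \<in> carrier (func_space B)"
        then have aK: "a \<in> B \<rightarrow> carrier (scalar_space K)" and ae: "a \<in> extensional B"
          by (auto simp: func_space_def PiE_def)
        obtain e where e: "e \<in> module_hom K L (scalar_space K)" "\<And>b. b \<in> B \<Longrightarrow> e b = a b"
          using extend_hom[OF B SK aK] by blast
        have "restrict e (carrier L) \<in> carrier (dual_space K L)"
          using e(1) by (simp add: dual_simps(1) functional_restrict)
        moreover have "a = ?r (restrict e (carrier L))"
          using e(2) BL by (intro extensionalityI[OF ae]) auto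
        ultimately show "a \<in> ?r ` carrier (dual_space K L)" by blast
      qed
    qed
  qed
  from bij_betw_trans[OF this lincomb_bij[OF B]]
  have bij: "bij_betw ?g (carrier (dual_space K L)) (carrier L)" by (simp add: comp_def)
  let ?i = "inv_into (carrier (dual_space K L)) ?g"
  interpret i: linear_map K L "dual_space K L" ?i
    by (intro linear_mapI vectorspace_axioms dual_vectorspace module_hom_inv_into[OF g _ bij]
        dual.module_axioms)
  show ?thesis
    using i.surj_fin_dim[OF finite_dimensional] bij_betw_inv_into[OF bij] by (simp add: bij_betw_def)
qed


text \<open>Equality in the dual is tested pointwise, so linearity can be tested after evaluation at
  each \<open>x\<close>. This reduces maps into the dual to scalar forms.\<close>

lemma dual_hom_iff:
  "\<phi> \<in> module_hom K V (dual_space K L) \<longleftrightarrow>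
    (\<forall>u\<in>carrier V. \<phi> u \<in> carrier (dual_space K L)) \<and>
    (\<forall>x\<in>carrier L. (\<lambda>u. \<phi> u x) \<in> module_hom K V (scalar_space K))" if V: "module K V" for V :: "('k, 'w, 'z) module_scheme"
proof
  interpret V: module K V by (rule V)
  assume \<phi>: "\<phi> \<in> module_hom K V (dual_space K L)"
  have cl: "\<phi> u \<in> carrier (dual_space K L)" if "u \<in> carrier V" for u
    using module_hom_in_carrier[OF \<phi> that] .
  have "(\<lambda>u. \<phi> u x) \<in> module_hom K V (scalar_space K)" if x: "x \<in> carrier L" for x
  proof (rule module_homI)
    fix u v r assume u: "u \<in> carrier V"
    show "\<phi> u x \<in> carrier (scalar_space K)" using cl[OF u] x by simp
    show "\<phi> (u \<oplus>\<^bsub>V\<^esub> v) x = \<phi> u x \<oplus>\<^bsub>scalar_space K\<^esub> \<phi> v x" if "v \<in> carrier V"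
      unfolding module_hom_add[OF \<phi> u that] using x by (simp add: dual_simps(2))
    show "\<phi> (r \<odot>\<^bsub>V\<^esub> u) x = r \<odot>\<^bsub>scalar_space K\<^esub> \<phi> u x" if "r \<in> carrier K"
      unfolding module_hom_smult[OF \<phi> that u] using x by (simp add: dual_simps(3))
  qed
  with cl show "(\<forall>u\<in>carrier V. \<phi> u \<in> carrier (dual_space K L)) \<and>
    (\<forall>x\<in>carrier L. (\<lambda>u. \<phi> u x) \<in> module_hom K V (scalar_space K))" by blast
next
  interpret V: module K V by (rule V)
  assume *: "(\<forall>u\<in>carrier V. \<phi> u \<in> carrier (dual_space K L)) \<and>
    (\<forall>x\<in>carrier L. (\<lambda>u. \<phi> u x) \<in> module_hom K V (scalar_space K))"
  show "\<phi> \<in> module_hom K V (dual_space K L)"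
  proof (rule module_homI)
    fix u v r assume u: "u \<in> carrier V"
    show "\<phi> u \<in> carrier (dual_space K L)" using * u by blast
    show "\<phi> (u \<oplus>\<^bsub>V\<^esub> v) = \<phi> u \<oplus>\<^bsub>dual_space K L\<^esub> \<phi> v" if v: "v \<in> carrier V"
    proof (rule dual_eqI)
      fix x assume x: "x \<in> carrier L"
      show "\<phi> (u \<oplus>\<^bsub>V\<^esub> v) x = (\<phi> u \<oplus>\<^bsub>dual_space K L\<^esub> \<phi> v) x"
        using * x module_hom_add[of "\<lambda>u. \<phi> u x" K V "scalar_space K", OF _ u v] by (simp add: dual_simps(2))
    qed (use * u v in auto)
    show "\<phi> (r \<odot>\<^bsub>V\<^esub> u) = r \<odot>\<^bsub>dual_space K L\<^esub> \<phi> u" if r: "r \<in> carrier K"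
    proof (rule dual_eqI)
      fix x assume x: "x \<in> carrier L"
      show "\<phi> (r \<odot>\<^bsub>V\<^esub> u) x = (r \<odot>\<^bsub>dual_space K L\<^esub> \<phi> u) x"
        using * x module_hom_smult[of "\<lambda>u. \<phi> u x" K V "scalar_space K", OF _ r u]
          by (simp add: dual_simps(3))
    qed (use * u r in auto)
  qed
qed

definition trilinear :: "('v \<Rightarrow> 'v \<Rightarrow> 'v \<Rightarrow> 'k) \<Rightarrow> bool" where
  "trilinear t \<longleftrightarrow> (\<forall>u\<in>carrier L. \<forall>v\<in>carrier L.
     t u v \<in> module_hom K L (scalar_space K) \<and>
     (\<lambda>w. t u w v) \<in> module_hom K L (scalar_space K) \<and>
     (\<lambda>w. t w u v) \<in> module_hom K L (scalar_space K))"

text \<open>Turns two-cochains into alternating trilinear forms with extensional values; the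
  computations with cochains take place at this scalar level.\<close>

lemma cochains2_iff:
  "\<alpha> \<in> cochains2 K L \<longleftrightarrow>
     \<alpha> \<in> carrier L \<rightarrow>\<^sub>E carrier L \<rightarrow>\<^sub>E extensional (carrier L) \<and> trilinear \<alpha> \<and>
     (\<forall>u\<in>carrier L. \<forall>w\<in>carrier L. \<alpha> u u w = \<zero>)" (is "?l \<longleftrightarrow> ?r")
proof
  assume ?l
  then have ex: "\<alpha> \<in> carrier L \<rightarrow>\<^sub>E carrier L \<rightarrow>\<^sub>E carrier (dual_space K L)"
    and bil: "bilinear_map K L L (dual_space K L) \<alpha>"
    and alt: "\<And>u. u \<in> carrier L \<Longrightarrow> \<alpha> u u = \<zero>\<^bsub>dual_space K L\<^esub>"
    by (auto simp: cochains2_def)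
  have "\<alpha> \<in> carrier L \<rightarrow>\<^sub>E carrier L \<rightarrow>\<^sub>E extensional (carrier L)"
    by (rule subsetD[OF PiE_mono[OF PiE_mono] ex]) (simp add: dual_simps(1) subset_iff)
  moreover have "trilinear \<alpha>"
    using bil by (auto simp: trilinear_def bilinear_map_def dual_hom_iff[OF module_axioms] dual_simps(1))
  ultimately show ?r using alt by (auto simp: dual_simps(4))
next
  assume r: ?r
  have dual: "\<alpha> u v \<in> carrier (dual_space K L)" if "u \<in> carrier L" "v \<in> carrier L" for u v
    using r that by (simp add: dual_simps(1) trilinear_def) (meson PiE_mem)
  moreover have "\<alpha> \<in> carrier L \<rightarrow>\<^sub>E carrier L \<rightarrow>\<^sub>E carrier (dual_space K L)"
  proof (rule PiE_I, rule PiE_I)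
    show "\<alpha> u = undefined" if "u \<notin> carrier L" for u using r that by (auto elim: PiE_arb)
    show "\<alpha> u v = undefined" if "u \<in> carrier L" "v \<notin> carrier L" for u v
      using r that by (meson PiE_arb PiE_mem)
  qed (use dual in auto)
  moreover have "bilinear_map K L L (dual_space K L) \<alpha>"
    using r dual by (auto simp: bilinear_map_def dual_hom_iff[OF module_axioms] trilinear_def)
  moreover have "\<alpha> u u = \<zero>\<^bsub>dual_space K L\<^esub>" if "u \<in> carrier L" for u
  proof (rule dual_eqI)
    show "\<alpha> u u x = \<zero>\<^bsub>dual_space K L\<^esub> x" if "x \<in> carrier L" for x
      using r \<open>u \<in> carrier L\<close> that by (simp add: dual_simps(4))
  qed (use dual that in auto)
  ultimately show ?l by (auto simp: cochains2_def)
qed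

lemma cochains2_restrictI:
  assumes t: "trilinear t" and alt: "\<And>u w. \<lbrakk>u \<in> carrier L; w \<in> carrier L\<rbrakk> \<Longrightarrow> t u u w = \<zero>"
  shows "(\<lambda>u\<in>carrier L. \<lambda>v\<in>carrier L. \<lambda>w\<in>carrier L. t u v w) \<in> cochains2 K L" (is "?t \<in> _")
proof -
  have "trilinear ?t"
    unfolding trilinear_def
  proof (intro ballI conjI)
    fix u v assume u: "u \<in> carrier L" "v \<in> carrier L"
    show "?t u v \<in> module_hom K L (scalar_space K)"
      using t u by (simp add: trilinear_def functional_restrict)
    show "(\<lambda>w. ?t u w v) \<in> module_hom K L (scalar_space K)"
      using t u by (subst module_hom_cong[where g="\<lambda>w. t u w v"]) (auto simp: trilinear_def module_axioms)
    show "(\<lambda>w. ?t w u v) \<in> module_hom K L (scalar_space K)"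
      using t u by (subst module_hom_cong[where g="\<lambda>w. t w u v"]) (auto simp: trilinear_def module_axioms)
  qed
  then show ?thesis using alt by (auto simp: cochains2_iff)
qed

text \<open>Extensionality in every argument upgrades agreement on the carrier to equality of
  functions, which is needed because cohomology classes are sets of functions.\<close>

lemma cochains2_eqI:
  assumes "\<alpha> \<in> cochains2 K L" "\<beta> \<in> cochains2 K L"
    and "\<And>u v w. \<lbrakk>u \<in> carrier L; v \<in> carrier L; w \<in> carrier L\<rbrakk> \<Longrightarrow> \<alpha> u v w = \<beta> u v w"
  shows "\<alpha> = \<beta>"
proof (rule PiE_ext)
  show "\<alpha> \<in> carrier L \<rightarrow>\<^sub>E carrier L \<rightarrow>\<^sub>E extensional (carrier L)" using assms(1) cochains2_iff by blast
  show "\<beta> \<in> carrier L \<rightarrow>\<^sub>E carrier L \<rightarrow>\<^sub>E extensional (carrier L)" using assms(2) cochains2_iff by blast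
  fix u assume u: "u \<in> carrier L"
  show "\<alpha> u = \<beta> u"
  proof (rule PiE_ext)
    show "\<alpha> u \<in> carrier L \<rightarrow>\<^sub>E extensional (carrier L)" "\<beta> u \<in> carrier L \<rightarrow>\<^sub>E extensional (carrier L)"
      using assms(1,2) u unfolding cochains2_iff by (meson PiE_mem)+
    fix v assume v: "v \<in> carrier L"
    show "\<alpha> u v = \<beta> u v"
    proof (rule extensionalityI)
      show "\<alpha> u v \<in> extensional (carrier L)" "\<beta> u v \<in> extensional (carrier L)"
        using assms(1,2) u v unfolding cochains2_iff by (meson PiE_mem)+
    qed (use assms(3) u v in blast)
  qed
qed

text \<open>Symmetry carries linearity from the second argument to the first, so one of the two is
  enough.\<close>

lemma cochains1_iff:
  "\<phi> \<in> lagr_cochains1 K L \<longleftrightarrow>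
     \<phi> \<in> carrier L \<rightarrow>\<^sub>E extensional (carrier L) \<and>
     (\<forall>u\<in>carrier L. \<phi> u \<in> module_hom K L (scalar_space K)) \<and>
     (\<forall>u\<in>carrier L. \<forall>v\<in>carrier L. \<phi> u v = \<phi> v u)"
proof -
  have "(\<lambda>u. \<phi> u x) \<in> module_hom K L (scalar_space K)"
    if "\<phi> x \<in> module_hom K L (scalar_space K)" "\<forall>u\<in>carrier L. \<forall>v\<in>carrier L. \<phi> u v = \<phi> v u" "x \<in> carrier L"
      for x
  proof -
    have "restrict (\<lambda>u. \<phi> u x) (carrier L) = restrict (\<phi> x) (carrier L)"
      using that by (intro restrict_ext) auto
    then show ?thesis using that(1) functional_restrict by metis
  qed
  note * = this
  show ?thesis
    unfolding lagr_cochains1_def dual_hom_iff[OF module_axioms] dual_simps(1) PiE_def Pi_def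
      mem_Collect_eq Int_iff
    using * by blast
qed

end

section \<open>Coboundaries, cocycles and cohomology classes\<close>

lemma (in cring) coboundary1_diff_arith:
  assumes "a \<in> carrier R" "b \<in> carrier R" "c \<in> carrier R" "a' \<in> carrier R" "b' \<in> carrier R" "c' \<in> carrier R"
    "z \<in> carrier R"
  shows "z \<oplus> (\<ominus> a \<oplus> b \<ominus> c) = z \<oplus> (\<ominus> a' \<oplus> b' \<ominus> c') \<oplus> (\<ominus> (a \<ominus> a') \<oplus> (b \<ominus> b') \<ominus> (c \<ominus> c'))"
proof -
  have split: "y \<oplus> (x \<ominus> y) = x" if "x \<in> carrier R" "y \<in> carrier R" for x y
    using that by (simp add: a_minus_def a_comm[of x "\<ominus> y"] r_neg2)
  have *: "z \<oplus> (\<ominus> (a' \<oplus> p) \<oplus> (b' \<oplus> q) \<ominus> (c' \<oplus> r)) = z \<oplus> (\<ominus> a' \<oplus> b' \<ominus> c') \<oplus> (\<ominus> p \<oplus> q \<ominus> r)"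
    if "p \<in> carrier R" "q \<in> carrier R" "r \<in> carrier R" for p q r
    using assms that by (simp add: a_minus_def minus_add a_ac)
  show ?thesis
    using *[of "a \<ominus> a'" "b \<ominus> b'" "c \<ominus> c'"] split[of a a'] split[of b b'] split[of c c'] assms by simp
qed

locale flat_lie_alg = lie_alg K L
  for K :: "('k, 'm) ring_scheme" (structure) and L :: "('k, 'v) lie_algebra" +
  fixes D :: "'v \<Rightarrow> 'v \<Rightarrow> 'v"
  assumes flat: "flat_connection K L D"
begin

lemma connection_bilinear: "bilinear_map K L L L D"
  using flat by (simp add: flat_connection_def)

lemmas D_bil = bilinear_mapD[OF connection_bilinear]

lemma torsion_free: "\<lbrakk>u \<in> carrier L; v \<in> carrier L\<rbrakk> \<Longrightarrow> D u v \<ominus>\<^bsub>L\<^esub> D v u = bracket L u v"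
  using flat by (simp add: flat_connection_def)

lemma flatness: "\<lbrakk>u \<in> carrier L; v \<in> carrier L; w \<in> carrier L\<rbrakk> \<Longrightarrow>
    D u (D v w) \<ominus>\<^bsub>L\<^esub> D v (D u w) = D (bracket L u v) w"
  using flat by (simp add: flat_connection_def)

lemma endo_homs:
  assumes "u \<in> carrier L"
  shows "(\<lambda>x. D u x) \<in> module_hom K L L" "(\<lambda>x. D x u) \<in> module_hom K L L"
    "(\<lambda>x. bracket L u x) \<in> module_hom K L L" "(\<lambda>x. bracket L x u) \<in> module_hom K L L"
    "(\<lambda>x. x) \<in> module_hom K L L"
  using assms connection_bilinear bracket_bilinear by (auto simp: bilinear_map_def intro!: module_homI)

lemma dual_rep_closed:
  "\<lbrakk>u \<in> carrier L; \<xi> \<in> carrier (dual_space K L)\<rbrakk> \<Longrightarrow> dual_rep K L D u \<xi> \<in> carrier (dual_space K L)"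
  unfolding dual_rep_def dual_simps(1) functional_restrict
  by (auto intro!: functional_neg module_hom_comp[where f="D u" and g=\<xi>] endo_homs)

lemma dual_rep_apply: "x \<in> carrier L \<Longrightarrow> dual_rep K L D u \<xi> x = \<ominus> \<xi> (D u x)"
  by (simp add: dual_rep_def)

text \<open>The value of \<rho>(u)\<phi>(v) - \<rho>(v)\<phi>(u) - \<phi>([u, v]) at
  \<open>x\<close>; the second term becomes positive because \<rho> itself carries a minus
  sign.\<close>

definition cobd1 :: "('v \<Rightarrow> 'v \<Rightarrow> 'k) \<Rightarrow> 'v \<Rightarrow> 'v \<Rightarrow> 'v \<Rightarrow> 'k" where
  "cobd1 \<phi> u v x = \<ominus> \<phi> v (D u x) \<oplus> \<phi> u (D v x) \<ominus> \<phi> (bracket L u v) x"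

text \<open>The Chevalley-Eilenberg differential of \<alpha> evaluated at \<open>x\<close>, with the
  sign of \<rho> absorbed into the first three terms.\<close>

definition cobd2 :: "('v \<Rightarrow> 'v \<Rightarrow> 'v \<Rightarrow> 'k) \<Rightarrow> 'v \<Rightarrow> 'v \<Rightarrow> 'v \<Rightarrow> 'v \<Rightarrow> 'k" where
  "cobd2 \<alpha> u v w x = \<ominus> \<alpha> v w (D u x) \<oplus> \<alpha> u w (D v x) \<ominus> \<alpha> u v (D w x)
     \<ominus> \<alpha> (bracket L u v) w x \<oplus> \<alpha> (bracket L u w) v x \<ominus> \<alpha> (bracket L v w) u x"

lemma cochains1_dual: "\<lbrakk>\<phi> \<in> lagr_cochains1 K L; u \<in> carrier L\<rbrakk> \<Longrightarrow> \<phi> u \<in> carrier (dual_space K L)"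
  unfolding cochains1_iff dual_simps(1) by (meson PiE_mem)

lemma cochains2_dual: "\<lbrakk>\<alpha> \<in> cochains2 K L; u \<in> carrier L; v \<in> carrier L\<rbrakk> \<Longrightarrow> \<alpha> u v \<in> carrier (dual_space K L)"
  unfolding cochains2_iff dual_simps(1) trilinear_def by (meson PiE_mem)

lemma coboundary1_apply:
  assumes "\<phi> \<in> lagr_cochains1 K L" "u \<in> carrier L" "v \<in> carrier L" "x \<in> carrier L"
  shows "coboundary1 K L D \<phi> u v x = cobd1 \<phi> u v x"
  using assms cochains1_dual[OF assms(1)]
  by (simp add: coboundary1_def cobd1_def dual_minus dual_rep_closed dual_rep_apply bracket_bil D_bil a_minus_def[of K])

lemma cobd1_cochain:
  assumes \<phi>: "\<phi> \<in> lagr_cochains1 K L"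
  shows "(\<lambda>u\<in>carrier L. \<lambda>v\<in>carrier L. \<lambda>x\<in>carrier L. cobd1 \<phi> u v x) \<in> cochains2 K L"
proof -
  have 1: "(\<lambda>x. \<phi> u (f x)) \<in> module_hom K L (scalar_space K)" if "u \<in> carrier L" "f \<in> module_hom K L L"
    for u f
    using that \<phi> by (auto simp: cochains1_iff intro: module_hom_comp[where f=f and g="\<phi> u"])
  have 2: "(\<lambda>x. \<phi> (f x) u) \<in> module_hom K L (scalar_space K)" if "u \<in> carrier L" "f \<in> module_hom K L L"
    for u f
  proof -
    have "restrict (\<lambda>x. \<phi> (f x) u) (carrier L) = restrict (\<lambda>x. \<phi> u (f x)) (carrier L)"
      using \<phi> that module_hom_in_carrier[OF that(2)] by (intro restrict_ext) (auto simp: cochains1_iff)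
    then show ?thesis using 1[OF that] functional_restrict by metis
  qed
  have cl: "\<phi> u v \<in> carrier K" if "u \<in> carrier L" "v \<in> carrier L" for u v
    using dual_closed[OF cochains1_dual[OF \<phi>]] that by simp
  \<comment> \<open>Needed for the alternating property, where the last term of the coboundary has
    the argument [u, u] = 0.\<close>
  have z: "\<phi> \<zero>\<^bsub>L\<^esub> x = \<zero>" if "x \<in> carrier L" for x
  proof -
    have "\<phi> (\<zero>\<^bsub>L\<^esub> \<oplus>\<^bsub>L\<^esub> \<zero>\<^bsub>L\<^esub>) x = \<phi> \<zero>\<^bsub>L\<^esub> x \<oplus> \<phi> \<zero>\<^bsub>L\<^esub> x"
      using module_hom_add[OF 2[OF that endo_homs(5)[OF that]] M.zero_closed M.zero_closed] by simp
    then show ?thesis using cl[OF M.zero_closed that] R.add.l_cancel_one' by simp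
  qed
  have "trilinear (cobd1 \<phi>)"
    unfolding trilinear_def cobd1_def
    by (auto intro!: functional_diff functional_add functional_neg 1 2 endo_homs D_bil bracket_bil)
  moreover have "cobd1 \<phi> u u x = \<zero>" if "u \<in> carrier L" "x \<in> carrier L" for u x
    using that by (simp add: cobd1_def bracket_self z cl D_bil R.l_neg a_minus_def)
  ultimately show ?thesis by (intro cochains2_restrictI)
qed

lemma cochains2_add:
  assumes a: "\<alpha> \<in> cochains2 K L" and b: "\<beta> \<in> cochains2 K L"
  shows "(\<lambda>u\<in>carrier L. \<lambda>v\<in>carrier L. \<lambda>x\<in>carrier L. \<alpha> u v x \<oplus> \<beta> u v x) \<in> cochains2 K L"
proof -
  have "trilinear (\<lambda>u v x. \<alpha> u v x \<oplus> \<beta> u v x)"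
    using a b by (auto simp: cochains2_iff trilinear_def intro!: functional_add)
  moreover have "\<alpha> u u x \<oplus> \<beta> u u x = \<zero>" if "u \<in> carrier L" "x \<in> carrier L" for u x
    using a b that by (simp add: cochains2_iff)
  ultimately show ?thesis by (intro cochains2_restrictI)
qed

text \<open>Coboundaries of symmetric cochains are cochains, so a class stays within the cochains
  and membership reduces to a scalar identity.\<close>

lemma cohomology_class_iff:
  assumes \<alpha>: "\<alpha> \<in> cochains2 K L"
  shows "\<beta> \<in> cohomology_class K L D \<alpha> \<longleftrightarrow> \<beta> \<in> cochains2 K L \<and>
    (\<exists>\<phi>\<in>lagr_cochains1 K L. \<forall>u\<in>carrier L. \<forall>v\<in>carrier L. \<forall>x\<in>carrier L.
       \<beta> u v x = \<alpha> u v x \<oplus> cobd1 \<phi> u v x)"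
proof -
  have *: "(\<lambda>u\<in>carrier L. \<lambda>v\<in>carrier L. \<alpha> u v \<oplus>\<^bsub>dual_space K L\<^esub> coboundary1 K L D \<phi> u v) =
      (\<lambda>u\<in>carrier L. \<lambda>v\<in>carrier L. \<lambda>x\<in>carrier L. \<alpha> u v x \<oplus> cobd1 \<phi> u v x)"
    if "\<phi> \<in> lagr_cochains1 K L" for \<phi>
    using that by (intro restrict_ext) (simp add: dual_simps(2) coboundary1_apply cong: restrict_cong)
  have c: "(\<lambda>u\<in>carrier L. \<lambda>v\<in>carrier L. \<lambda>x\<in>carrier L. \<alpha> u v x \<oplus> cobd1 \<phi> u v x) \<in> cochains2 K L"
    if "\<phi> \<in> lagr_cochains1 K L" for \<phi>
    using cochains2_add[OF \<alpha> cobd1_cochain[OF that]] by (simp cong: restrict_cong)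
  show ?thesis (is "_ \<longleftrightarrow> ?r")
  proof
    assume "\<beta> \<in> cohomology_class K L D \<alpha>"
    then obtain \<phi> where \<phi>: "\<phi> \<in> lagr_cochains1 K L"
      and \<beta>: "\<beta> = (\<lambda>u\<in>carrier L. \<lambda>v\<in>carrier L. \<lambda>x\<in>carrier L. \<alpha> u v x \<oplus> cobd1 \<phi> u v x)"
      using * by (auto simp: cohomology_class_def)
    show ?r using c[OF \<phi>] \<phi> unfolding \<beta> by (intro conjI bexI[of _ \<phi>]) auto
  next
    assume r: ?r
    then obtain \<phi> where \<phi>: "\<phi> \<in> lagr_cochains1 K L" "\<And>u v x. \<lbrakk>u\<in>carrier L; v\<in>carrier L; x\<in>carrier L\<rbrakk> \<Longrightarrow>
       \<beta> u v x = \<alpha> u v x \<oplus> cobd1 \<phi> u v x" by blast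
    have "\<beta> = (\<lambda>u\<in>carrier L. \<lambda>v\<in>carrier L. \<lambda>x\<in>carrier L. \<alpha> u v x \<oplus> cobd1 \<phi> u v x)"
      using r c[OF \<phi>(1)] by (intro cochains2_eqI) (auto simp: \<phi>(2))
    then show "\<beta> \<in> cohomology_class K L D \<alpha>"
      unfolding cohomology_class_def *[OF \<phi>(1), symmetric] using \<phi>(1) by (intro image_eqI) auto
  qed
qed

lemma cochains1_zero: "(\<lambda>u\<in>carrier L. \<lambda>v\<in>carrier L. \<zero>) \<in> lagr_cochains1 K L"
  by (auto simp: cochains1_iff functional_restrict functional_zero)

lemma cochains1_diff:
  "\<lbrakk>\<phi> \<in> lagr_cochains1 K L; \<psi> \<in> lagr_cochains1 K L\<rbrakk> \<Longrightarrow>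
    (\<lambda>u\<in>carrier L. \<lambda>v\<in>carrier L. \<phi> u v \<ominus> \<psi> u v) \<in> lagr_cochains1 K L"
  by (auto simp: cochains1_iff functional_restrict intro!: functional_diff)

lemma cobd1_diff:
  assumes \<phi>: "\<phi> \<in> lagr_cochains1 K L" and \<psi>: "\<psi> \<in> lagr_cochains1 K L"
    and u: "u \<in> carrier L" "v \<in> carrier L" "x \<in> carrier L" and z: "z \<in> carrier K"
  shows "z \<oplus> cobd1 \<phi> u v x = z \<oplus> cobd1 \<psi> u v x \<oplus> cobd1 (\<lambda>u\<in>carrier L. \<lambda>v\<in>carrier L. \<phi> u v \<ominus> \<psi> u v) u v x"
  using coboundary1_diff_arith[of "\<phi> v (D u x)" "\<phi> u (D v x)" "\<phi> (bracket L u v) x"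
      "\<psi> v (D u x)" "\<psi> u (D v x)" "\<psi> (bracket L u v) x" z] z u
    dual_closed[OF cochains1_dual[OF \<phi>]] dual_closed[OF cochains1_dual[OF \<psi>]] D_bil(1)[OF u(1,3)] D_bil(1)[OF u(2,3)]
    bracket_bil(1)[OF u(1,2)]
  by (simp add: cobd1_def)

lemma cohomology_class_self:
  assumes \<alpha>: "\<alpha> \<in> cochains2 K L"
  shows "\<alpha> \<in> cohomology_class K L D \<alpha>"
proof -
  have "\<alpha> u v x \<in> carrier K" if "u\<in>carrier L" "v\<in>carrier L" "x\<in>carrier L" for u v x
    using cochains2_dual[OF \<alpha>] that by simp
  then show ?thesis
    unfolding cohomology_class_iff[OF \<alpha>] using \<alpha> cochains1_zero
    by (intro conjI bexI[of _ "\<lambda>u\<in>carrier L. \<lambda>v\<in>carrier L. \<zero>"])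
      (auto simp: cobd1_def D_bil bracket_bil a_minus_def)
qed

text \<open>If \<gamma> and \<beta> differ from \<alpha> by the coboundaries of \<psi> and \<phi>,
  then \<gamma> differs from \<beta> by the coboundary of \<psi> - \<phi>.\<close>

lemma cohomology_class_subset:
  assumes \<alpha>: "\<alpha> \<in> cochains2 K L" and \<beta>: "\<beta> \<in> cohomology_class K L D \<alpha>"
  shows "cohomology_class K L D \<alpha> \<subseteq> cohomology_class K L D \<beta>"
proof
  fix \<gamma> assume "\<gamma> \<in> cohomology_class K L D \<alpha>"
  then obtain \<psi> where \<gamma>: "\<gamma> \<in> cochains2 K L" and \<psi>: "\<psi> \<in> lagr_cochains1 K L"
      "\<And>u v x. \<lbrakk>u\<in>carrier L; v\<in>carrier L; x\<in>carrier L\<rbrakk> \<Longrightarrow> \<gamma> u v x = \<alpha> u v x \<oplus> cobd1 \<psi> u v x"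
    unfolding cohomology_class_iff[OF \<alpha>] by blast
  obtain \<phi> where \<beta>: "\<beta> \<in> cochains2 K L" and \<phi>: "\<phi> \<in> lagr_cochains1 K L"
      "\<And>u v x. \<lbrakk>u\<in>carrier L; v\<in>carrier L; x\<in>carrier L\<rbrakk> \<Longrightarrow> \<beta> u v x = \<alpha> u v x \<oplus> cobd1 \<phi> u v x"
    using \<beta> unfolding cohomology_class_iff[OF \<alpha>] by blast
  show "\<gamma> \<in> cohomology_class K L D \<beta>"
    unfolding cohomology_class_iff[OF \<beta>]
  proof (intro conjI bexI ballI)
    show "(\<lambda>u\<in>carrier L. \<lambda>v\<in>carrier L. \<psi> u v \<ominus> \<phi> u v) \<in> lagr_cochains1 K L"
      using cochains1_diff[OF \<psi>(1) \<phi>(1)] .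
    fix u v x assume u: "u\<in>carrier L" "v\<in>carrier L" "x\<in>carrier L"
    then have "\<alpha> u v x \<in> carrier K" using cochains2_dual[OF \<alpha>] by simp
    then show "\<gamma> u v x = \<beta> u v x \<oplus> cobd1 (\<lambda>u\<in>carrier L. \<lambda>v\<in>carrier L. \<psi> u v \<ominus> \<phi> u v) u v x"
      using cobd1_diff[OF \<psi>(1) \<phi>(1) u] \<psi>(2)[OF u] \<phi>(2)[OF u] by simp
  qed (rule \<gamma>)
qed

text \<open>One inclusion suffices: since \<alpha> lies in its own class, it lies in the class of
  \<beta>, and the inclusion applies with the roles exchanged.\<close>

lemma cohomology_class_eqI:
  assumes \<alpha>: "\<alpha> \<in> cochains2 K L" and \<beta>: "\<beta> \<in> cohomology_class K L D \<alpha>"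
  shows "cohomology_class K L D \<beta> = cohomology_class K L D \<alpha>"
proof
  show sub: "cohomology_class K L D \<alpha> \<subseteq> cohomology_class K L D \<beta>"
    by (rule cohomology_class_subset[OF assms])
  have "\<beta> \<in> cochains2 K L" using \<beta> by (simp add: cohomology_class_iff[OF \<alpha>])
  then show "cohomology_class K L D \<beta> \<subseteq> cohomology_class K L D \<alpha>"
    using cohomology_class_subset[of \<beta> \<alpha>] sub cohomology_class_self[OF \<alpha>] by blast
qed

lemma lagr_cocycles2_iff:
  "\<alpha> \<in> lagr_cocycles2 K L D \<longleftrightarrow> \<alpha> \<in> cochains2 K L \<and>
    (\<forall>u\<in>carrier L. \<forall>v\<in>carrier L. \<forall>w\<in>carrier L. \<forall>x\<in>carrier L. cobd2 \<alpha> u v w x = \<zero>) \<and>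
    (\<forall>u\<in>carrier L. \<forall>v\<in>carrier L. \<forall>w\<in>carrier L. \<alpha> u v w \<oplus> \<alpha> w u v \<oplus> \<alpha> v w u = \<zero>)"
proof -
  have "coboundary2 K L D \<alpha> u v w = \<zero>\<^bsub>dual_space K L\<^esub> \<longleftrightarrow> (\<forall>x\<in>carrier L. cobd2 \<alpha> u v w x = \<zero>)"
    if \<alpha>: "\<alpha> \<in> cochains2 K L" and u: "u\<in>carrier L" "v\<in>carrier L" "w\<in>carrier L" for u v w
  proof -
    note cl = cochains2_dual[OF \<alpha>]
    have c: "coboundary2 K L D \<alpha> u v w \<in> carrier (dual_space K L)"
      unfolding coboundary2_def using u by (simp add: cl dual_rep_closed bracket_bil)
    have e: "coboundary2 K L D \<alpha> u v w x = cobd2 \<alpha> u v w x" if "x \<in> carrier L" for x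
      unfolding coboundary2_def cobd2_def using u that
      by (simp add: cl dual_rep_closed bracket_bil dual_minus dual_rep_apply dual_add D_bil a_minus_def[of K])
    show ?thesis
    proof
      assume "coboundary2 K L D \<alpha> u v w = \<zero>\<^bsub>dual_space K L\<^esub>"
      then show "\<forall>x\<in>carrier L. cobd2 \<alpha> u v w x = \<zero>" using e by (simp add: dual_simps(4))
    next
      assume "\<forall>x\<in>carrier L. cobd2 \<alpha> u v w x = \<zero>"
      then show "coboundary2 K L D \<alpha> u v w = \<zero>\<^bsub>dual_space K L\<^esub>"
        using e by (intro dual_eqI[OF c dual.M.zero_closed]) (simp add: dual_simps(4))
    qed
  qed
  then show ?thesis unfolding lagr_cocycles2_def by auto
qed

end

section \<open>Pullback of cohomology classes\<close>

lemma pullback2_cochain: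
  assumes "lie_alg K L" "lie_alg K M" and f: "f \<in> module_hom K L M" and \<alpha>: "\<alpha> \<in> cochains2 K M"
  shows "pullback2 L f \<alpha> \<in> cochains2 K L"
proof -
  interpret L: lie_alg K L by fact
  interpret M: lie_alg K M by fact
  note fc = module_hom_in_carrier[OF f]
  have t: "M.trilinear \<alpha>" using \<alpha> by (simp add: M.cochains2_iff)
  have "L.trilinear (\<lambda>u v w. \<alpha> (f u) (f v) (f w))"
    unfolding L.trilinear_def
  proof (intro ballI conjI)
    fix u v assume u: "u \<in> carrier L" "v \<in> carrier L"
    note t' = t[unfolded M.trilinear_def, rule_format, OF fc[OF u(1)] fc[OF u(2)]]
    show "(\<lambda>w. \<alpha> (f u) (f v) (f w)) \<in> module_hom K L (scalar_space K)"
      using t' by (auto intro: module_hom_comp[OF f])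
    show "(\<lambda>w. \<alpha> (f u) (f w) (f v)) \<in> module_hom K L (scalar_space K)"
      using t' module_hom_comp[OF f, of "\<lambda>w. \<alpha> (f u) w (f v)"] by auto
    show "(\<lambda>w. \<alpha> (f w) (f u) (f v)) \<in> module_hom K L (scalar_space K)"
      using t' module_hom_comp[OF f, of "\<lambda>w. \<alpha> w (f u) (f v)"] by auto
  qed
  then show ?thesis
    unfolding pullback2_def using \<alpha> fc by (intro L.cochains2_restrictI) (auto simp: M.cochains2_iff)
qed

text \<open>A morphism compatible with brackets and connections commutes with the coboundary, so the
  pullback of \<phi> is the new witness. In this form it applies to an isomorphism and to its
  inverse.\<close>

lemma pullback2_class_mem:
  assumes "flat_lie_alg K L D" "flat_lie_alg K M E" and f: "f \<in> module_hom K L M"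
    and br: "\<And>u v. \<lbrakk>u \<in> carrier L; v \<in> carrier L\<rbrakk> \<Longrightarrow> f (bracket L u v) = bracket M (f u) (f v)"
    and conn: "\<And>u v. \<lbrakk>u \<in> carrier L; v \<in> carrier L\<rbrakk> \<Longrightarrow> f (D u v) = E (f u) (f v)"
    and \<alpha>: "\<alpha> \<in> cochains2 K M" and \<beta>: "\<beta> \<in> cohomology_class K M E \<alpha>"
  shows "pullback2 L f \<beta> \<in> cohomology_class K L D (pullback2 L f \<alpha>)"
proof -
  interpret L: flat_lie_alg K L D by fact
  interpret M: flat_lie_alg K M E by fact
  note fc = module_hom_in_carrier[OF f]
  note pc = pullback2_cochain[OF L.lie_alg_axioms M.lie_alg_axioms f]
  obtain \<phi> where b: "\<beta> \<in> cochains2 K M" and \<phi>: "\<phi> \<in> lagr_cochains1 K M"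
    and eq: "\<And>u v x. \<lbrakk>u \<in> carrier M; v \<in> carrier M; x \<in> carrier M\<rbrakk> \<Longrightarrow> \<beta> u v x = \<alpha> u v x \<oplus>\<^bsub>K\<^esub> M.cobd1 \<phi> u v x"
    using \<beta> unfolding M.cohomology_class_iff[OF \<alpha>] by blast
  let ?\<psi> = "\<lambda>u\<in>carrier L. \<lambda>v\<in>carrier L. \<phi> (f u) (f v)"
  have "(\<lambda>v. \<phi> (f u) (f v)) \<in> module_hom K L (scalar_space K)" if "u \<in> carrier L" for u
    using module_hom_comp[OF f, of "\<phi> (f u)"] \<phi> fc[OF that] by (auto simp: M.cochains1_iff)
  then have \<psi>: "?\<psi> \<in> lagr_cochains1 K L"
    using \<phi> fc by (auto simp: L.cochains1_iff M.cochains1_iff L.functional_restrict)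
  show ?thesis
    unfolding L.cohomology_class_iff[OF pc[OF \<alpha>]]
  proof (intro conjI pc[OF b] bexI[OF _ \<psi>] ballI)
    fix u v x assume u: "u \<in> carrier L" "v \<in> carrier L" "x \<in> carrier L"
    then show "pullback2 L f \<beta> u v x = pullback2 L f \<alpha> u v x \<oplus>\<^bsub>K\<^esub> L.cobd1 ?\<psi> u v x"
      by (simp add: pullback2_def eq fc L.cobd1_def M.cobd1_def br conn L.D_bil L.bracket_bil)
  qed
qed

lemma pullback2_inverse:
  assumes "lie_alg K L" "lie_alg K M" and f: "f \<in> module_hom K L M" and g: "g \<in> module_hom K M L"
    and inv: "\<And>x. x \<in> carrier L \<Longrightarrow> g (f x) = x" and \<alpha>: "\<alpha> \<in> cochains2 K L"
  shows "pullback2 L f (pullback2 M g \<alpha>) = \<alpha>"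
proof -
  interpret L: lie_alg K L by fact
  show ?thesis
  proof (rule L.cochains2_eqI[OF _ \<alpha>])
    show "pullback2 L f (pullback2 M g \<alpha>) \<in> cochains2 K L"
      by (intro pullback2_cochain[OF assms(1,2) f] pullback2_cochain[OF assms(2,1) g] \<alpha>)
  qed (simp add: pullback2_def inv module_hom_in_carrier[OF f])
qed

lemma lie_iso_inverse:
  assumes "lie_alg K L" "lie_iso K L M f"
  shows "lie_iso K M L (inv_into (carrier L) f)"
proof -
  interpret L: lie_alg K L by fact
  have f: "f \<in> module_hom K L M" and bij: "bij_betw f (carrier L) (carrier M)"
    and br: "\<And>x y. \<lbrakk>x \<in> carrier L; y \<in> carrier L\<rbrakk> \<Longrightarrow> f (bracket L x y) = bracket M (f x) (f y)"
    using assms(2) by (auto simp: lie_iso_def)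
  let ?g = "inv_into (carrier L) f"
  note g = bij_betw_inv_into_right[OF bij] bij_betw_inv_into_left[OF bij]
    bij_betwE[OF bij_betw_inv_into[OF bij], rule_format]
  have "?g (bracket M x y) = bracket L (?g x) (?g y)" if "x \<in> carrier M" "y \<in> carrier M" for x y
    using g(3)[OF that(1)] g(3)[OF that(2)] g(1)[OF that(1)] g(1)[OF that(2)] br[of "?g x" "?g y"]
      g(2)[OF L.bracket_bil(1)[of "?g x" "?g y"]] by simp
  then show ?thesis
    unfolding lie_iso_def
    using module_hom_inv_into[OF f L.module_axioms bij] bij_betw_inv_into[OF bij] by blast
qed

text \<open>Isomorphism of triples asks for equality of whole classes. For the inclusion from right
  to left, a member is pulled back along the inverse and recovered by pulling back along
  \<open>f\<close>.\<close>

lemma pullback2_class_image: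
  assumes flat: "flat_lie_alg K L D" "flat_lie_alg K M E" and iso: "lie_iso K L M f"
    and conn: "\<And>u v. \<lbrakk>u \<in> carrier L; v \<in> carrier L\<rbrakk> \<Longrightarrow> f (D u v) = E (f u) (f v)"
    and \<alpha>: "\<alpha> \<in> cochains2 K M"
  shows "pullback2 L f ` cohomology_class K M E \<alpha> = cohomology_class K L D (pullback2 L f \<alpha>)"
proof -
  interpret L: flat_lie_alg K L D by fact
  interpret M: flat_lie_alg K M E by fact
  note la = L.lie_alg_axioms M.lie_alg_axioms
  let ?g = "inv_into (carrier L) f"
  have iso': "lie_iso K M L ?g" by (rule lie_iso_inverse[OF la(1) iso])
  have f: "f \<in> module_hom K L M" and bij: "bij_betw f (carrier L) (carrier M)"
    and br: "\<And>x y. \<lbrakk>x \<in> carrier L; y \<in> carrier L\<rbrakk> \<Longrightarrow> f (bracket L x y) = bracket M (f x) (f y)"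
    using iso by (auto simp: lie_iso_def)
  have g: "?g \<in> module_hom K M L"
    and brg: "\<And>x y. \<lbrakk>x \<in> carrier M; y \<in> carrier M\<rbrakk> \<Longrightarrow> ?g (bracket M x y) = bracket L (?g x) (?g y)"
    using iso' by (auto simp: lie_iso_def)
  have fg: "f (?g x) = x" if "x \<in> carrier M" for x using bij_betw_inv_into_right[OF bij that] .
  have gf: "?g (f x) = x" if "x \<in> carrier L" for x using bij_betw_inv_into_left[OF bij that] .
  have conng: "?g (E x y) = D (?g x) (?g y)" if "x \<in> carrier M" "y \<in> carrier M" for x y
  proof -
    have "?g x \<in> carrier L" "?g y \<in> carrier L" using that module_hom_in_carrier[OF g] by auto
    then show ?thesis
      using conn[of "?g x" "?g y"] gf[OF L.D_bil(1)[of "?g x" "?g y"]] fg that by simp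
  qed
  note pf = pullback2_cochain[OF la f] and pg = pullback2_cochain[OF la(2,1) g]
  show ?thesis
  proof
    show "pullback2 L f ` cohomology_class K M E \<alpha> \<subseteq> cohomology_class K L D (pullback2 L f \<alpha>)"
    proof
      fix \<gamma> assume "\<gamma> \<in> pullback2 L f ` cohomology_class K M E \<alpha>"
      then obtain \<beta> where \<beta>: "\<beta> \<in> cohomology_class K M E \<alpha>" "\<gamma> = pullback2 L f \<beta>" by blast
      show "\<gamma> \<in> cohomology_class K L D (pullback2 L f \<alpha>)"
        unfolding \<beta>(2) by (rule pullback2_class_mem[OF flat f _ _ \<alpha> \<beta>(1)]) (simp_all add: br conn)
    qed
    show "cohomology_class K L D (pullback2 L f \<alpha>) \<subseteq> pullback2 L f ` cohomology_class K M E \<alpha>"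
    proof
      fix \<beta> assume \<beta>: "\<beta> \<in> cohomology_class K L D (pullback2 L f \<alpha>)"
      then have c: "\<beta> \<in> cochains2 K L" by (simp add: L.cohomology_class_iff[OF pf[OF \<alpha>]])
      have "pullback2 M ?g \<beta> \<in> cohomology_class K M E (pullback2 M ?g (pullback2 L f \<alpha>))"
        by (rule pullback2_class_mem[OF flat(2,1) g _ _ pf[OF \<alpha>] \<beta>]) (simp_all add: brg conng)
      then have "pullback2 M ?g \<beta> \<in> cohomology_class K M E \<alpha>"
        by (subst (asm) pullback2_inverse[OF la(2,1) g f _ \<alpha>]) (simp_all add: fg)
      moreover have "\<beta> = pullback2 L f (pullback2 M ?g \<beta>)"
        by (rule pullback2_inverse[OF la f g _ c, symmetric]) (simp add: gf)
      ultimately show "\<beta> \<in> pullback2 L f ` cohomology_class K M E \<alpha>" by blast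
    qed
  qed
qed

section \<open>Lagrangian ideals and their quotients\<close>

lemma (in cring) eq_neg_if_add_zero:
  assumes "a \<in> carrier R" "b \<in> carrier R" "a \<oplus> b = \<zero>"
  shows "a = \<ominus> b"
  using assms minus_equality by simp

lemma (in cring) eq_if_diff:
  "\<lbrakk>a \<ominus> b = \<zero>; a \<in> carrier R; b \<in> carrier R\<rbrakk> \<Longrightarrow> a = b"
  by simp

context lie_alg
begin

lemma bracket_skew:
  assumes "x \<in> carrier L" "y \<in> carrier L"
  shows "bracket L x y = \<ominus>\<^bsub>L\<^esub> bracket L y x"
proof -
  have "bracket L (x \<oplus>\<^bsub>L\<^esub> y) (x \<oplus>\<^bsub>L\<^esub> y) = \<zero>\<^bsub>L\<^esub>" using assms bracket_self by simp
  then have "bracket L x y \<oplus>\<^bsub>L\<^esub> bracket L y x = \<zero>\<^bsub>L\<^esub>"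
    using assms by (simp add: bracket_bil bracket_self[of x] bracket_self[of y] M.a_comm)
  then show ?thesis using assms bracket_bil(1) M.minus_equality by metis
qed

lemma bracket_homs:
  assumes "x \<in> carrier L"
  shows "(\<lambda>y. bracket L x y) \<in> module_hom K L L" "(\<lambda>y. bracket L y x) \<in> module_hom K L L"
  using assms bracket_bilinear by (auto simp: bilinear_map_def)

lemma bracket_zero [simp]:
  "x \<in> carrier L \<Longrightarrow> bracket L x \<zero>\<^bsub>L\<^esub> = \<zero>\<^bsub>L\<^esub>" "x \<in> carrier L \<Longrightarrow> bracket L \<zero>\<^bsub>L\<^esub> x = \<zero>\<^bsub>L\<^esub>"
  using bracket_bil(4)[of \<zero> x "\<zero>\<^bsub>L\<^esub>"] bracket_bil(5)[of \<zero> "\<zero>\<^bsub>L\<^esub>" x] bracket_bil(1) by auto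

lemma bracket_neg:
  "\<lbrakk>x \<in> carrier L; y \<in> carrier L\<rbrakk> \<Longrightarrow> bracket L x (\<ominus>\<^bsub>L\<^esub> y) = \<ominus>\<^bsub>L\<^esub> bracket L x y"
  "\<lbrakk>x \<in> carrier L; y \<in> carrier L\<rbrakk> \<Longrightarrow> bracket L (\<ominus>\<^bsub>L\<^esub> x) y = \<ominus>\<^bsub>L\<^esub> bracket L x y"
  using bracket_bil(4)[of "\<ominus> \<one>" x y] bracket_bil(5)[of "\<ominus> \<one>" x y]
    by (simp_all add: smult_minus_1 bracket_bil(1))

text \<open>The arrangement of signs that fits both flatness and the cocycle condition: a commutator
  of adjoint maps plus one remaining term.\<close>

lemma jacobi':
  assumes "x \<in> carrier L" "y \<in> carrier L" "z \<in> carrier L"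
  shows "bracket L x (bracket L y z) \<ominus>\<^bsub>L\<^esub> bracket L y (bracket L x z) \<oplus>\<^bsub>L\<^esub> bracket L z (bracket L x y) = \<zero>\<^bsub>L\<^esub>"
  using jacobi[OF assms] assms bracket_skew[of z x] by (simp add: bracket_neg bracket_bil a_minus_def)

end

locale sympl_lagr = lie_alg K L
  for K :: "('k, 'm) ring_scheme" (structure) and L :: "('k, 'v) lie_algebra" +
  fixes \<omega> :: "'v \<Rightarrow> 'v \<Rightarrow> 'k" and \<aa> :: "'v set"
  assumes sympl: "symplectic_form K L \<omega>" and ideal: "lie_ideal K L \<aa>"
    and lagrangian: "orthogonal K L \<omega> \<aa> = \<aa>"
begin

lemma form_bilinear: "bilinear_map K L L (scalar_space K) \<omega>"
  using sympl by (simp add: symplectic_form_def)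

lemmas form_bil = bilinear_mapD[OF form_bilinear, simplified]

lemma form_self [simp]: "u \<in> carrier L \<Longrightarrow> \<omega> u u = \<zero>"
  using sympl by (simp add: symplectic_form_def)

lemma nondegenerate: "\<lbrakk>u \<in> carrier L; \<And>v. v \<in> carrier L \<Longrightarrow> \<omega> u v = \<zero>\<rbrakk> \<Longrightarrow> u = \<zero>\<^bsub>L\<^esub>"
  using sympl by (simp add: symplectic_form_def)

lemma form_closed: "\<lbrakk>u \<in> carrier L; v \<in> carrier L; w \<in> carrier L\<rbrakk> \<Longrightarrow>
    \<omega> (bracket L u v) w \<oplus> \<omega> (bracket L w u) v \<oplus> \<omega> (bracket L v w) u = \<zero>"
  using sympl by (simp add: symplectic_form_def)

lemma form_skew:
  assumes "x \<in> carrier L" "y \<in> carrier L"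
  shows "\<omega> x y = \<ominus> \<omega> y x"
proof -
  have "\<omega> (x \<oplus>\<^bsub>L\<^esub> y) (x \<oplus>\<^bsub>L\<^esub> y) = \<zero>" using assms by simp
  then have "\<omega> x y \<oplus> \<omega> y x = \<zero>"
    using assms by (simp add: form_bil form_self[of x] form_self[of y] R.a_comm del: form_self)
  then show ?thesis using assms form_bil(1) R.eq_neg_if_add_zero by metis
qed

lemma form_homs:
  assumes "x \<in> carrier L"
  shows "\<omega> x \<in> module_hom K L (scalar_space K)" "(\<lambda>y. \<omega> y x) \<in> module_hom K L (scalar_space K)"
  using assms form_bilinear by (auto simp: bilinear_map_def)

lemma form_neg:
  "\<lbrakk>x \<in> carrier L; y \<in> carrier L\<rbrakk> \<Longrightarrow> \<omega> x (\<ominus>\<^bsub>L\<^esub> y) = \<ominus> \<omega> x y"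
  "\<lbrakk>x \<in> carrier L; y \<in> carrier L\<rbrakk> \<Longrightarrow> \<omega> (\<ominus>\<^bsub>L\<^esub> x) y = \<ominus> \<omega> x y"
  using form_bil(4)[of "\<ominus> \<one>" x y] form_bil(5)[of "\<ominus> \<one>" x y]
  by (simp_all add: smult_minus_1 form_bil(1) R.l_minus)

lemma form_diff:
  "\<lbrakk>x \<in> carrier L; y \<in> carrier L; z \<in> carrier L\<rbrakk> \<Longrightarrow> \<omega> x (y \<ominus>\<^bsub>L\<^esub> z) = \<omega> x y \<ominus> \<omega> x z"
  "\<lbrakk>x \<in> carrier L; y \<in> carrier L; z \<in> carrier L\<rbrakk> \<Longrightarrow> \<omega> (x \<ominus>\<^bsub>L\<^esub> y) z = \<omega> x z \<ominus> \<omega> y z"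
  by (simp_all add: a_minus_def form_bil form_neg)

lemma form_zero [simp]:
  "x \<in> carrier L \<Longrightarrow> \<omega> x \<zero>\<^bsub>L\<^esub> = \<zero>" "x \<in> carrier L \<Longrightarrow> \<omega> \<zero>\<^bsub>L\<^esub> x = \<zero>"
  using form_bil(4)[of \<zero> x "\<zero>\<^bsub>L\<^esub>"] form_bil(5)[of \<zero> "\<zero>\<^bsub>L\<^esub>" x] form_bil(1) by auto

text \<open>Nondegeneracy as a test for equality: identities between vectors of \<gg> are proved by
  pairing both sides with an arbitrary vector.\<close>

lemma form_eqI:
  assumes "x \<in> carrier L" "y \<in> carrier L" "\<And>z. z \<in> carrier L \<Longrightarrow> \<omega> x z = \<omega> y z"
  shows "x = y"
proof -
  have "x \<ominus>\<^bsub>L\<^esub> y = \<zero>\<^bsub>L\<^esub>"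
    using assms by (intro nondegenerate) (simp_all add: form_diff form_bil)
  then show ?thesis using assms(1,2) by simp
qed

lemma ideal_subspace: "LinearCombinations.submodule K \<aa> L"
  using ideal by (simp add: lie_ideal_def subspace_def)

lemma ideal_carrier [simp]: "a \<in> \<aa> \<Longrightarrow> a \<in> carrier L"
  using submodule.subset[OF ideal_subspace] by blast

lemma ideal_zero [simp]: "\<zero>\<^bsub>L\<^esub> \<in> \<aa>"
  using submodule.zero_closed[OF ideal_subspace] .

lemma ideal_add [simp]: "\<lbrakk>a \<in> \<aa>; b \<in> \<aa>\<rbrakk> \<Longrightarrow> a \<oplus>\<^bsub>L\<^esub> b \<in> \<aa>"
  using submodule.m_closed[OF ideal_subspace] .

lemma ideal_neg [simp]: "a \<in> \<aa> \<Longrightarrow> \<ominus>\<^bsub>L\<^esub> a \<in> \<aa>"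
  using submodule.smult_closed[OF ideal_subspace, of "\<ominus> \<one>" a] by (simp add: smult_minus_1)

lemma ideal_bracket [simp]: "\<lbrakk>x \<in> carrier L; a \<in> \<aa>\<rbrakk> \<Longrightarrow> bracket L x a \<in> \<aa>"
  using ideal by (simp add: lie_ideal_def)

lemma ideal_bracket' [simp]: "\<lbrakk>x \<in> carrier L; a \<in> \<aa>\<rbrakk> \<Longrightarrow> bracket L a x \<in> \<aa>"
  using bracket_skew[of a x] ideal_bracket[of x a] ideal_neg by simp

lemma isotropic [simp]: "\<lbrakk>a \<in> \<aa>; b \<in> \<aa>\<rbrakk> \<Longrightarrow> \<omega> a b = \<zero>"
  using lagrangian by (auto simp: orthogonal_def)

lemma ideal_memI: "\<lbrakk>x \<in> carrier L; \<And>b. b \<in> \<aa> \<Longrightarrow> \<omega> x b = \<zero>\<rbrakk> \<Longrightarrow> x \<in> \<aa>"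
  using lagrangian by (auto simp: orthogonal_def)

text \<open>Closedness of \<omega> at (a, b, z) leaves only \<omega>([a, b], z): in the other two
  terms the bracket with \<open>z\<close> stays in \<aa> and is paired with an element of
  \<aa>.\<close>

lemma ideal_abelian [simp]:
  assumes "a \<in> \<aa>" "b \<in> \<aa>"
  shows "bracket L a b = \<zero>\<^bsub>L\<^esub>"
proof (rule nondegenerate)
  show "\<omega> (bracket L a b) z = \<zero>" if "z \<in> carrier L" for z
    using form_closed[of a b z] assms that by (simp add: form_bil bracket_bil)
qed (use assms in \<open>simp add: bracket_bil\<close>)

end

text \<open>The quotient is any Lie algebra \<open>H\<close> with a surjective morphism of kernel
  \<aa> rather than the set of cosets. Cosets, their copies in another type and the first factor of
  the model are then treated alike.\<close>

locale lagr_quotient = sympl_lagr K L \<omega> \<aa> + H: lie_alg K H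
  for K :: "('k, 'm) ring_scheme" (structure) and L :: "('k, 'v) lie_algebra" and \<omega> \<aa>
    and H :: "('k, 'w) lie_algebra" +
  fixes p :: "'v \<Rightarrow> 'w"
  assumes p_hom: "p \<in> module_hom K L H" and p_surj: "p ` carrier L = carrier H"
    and p_kernel: "x \<in> carrier L \<Longrightarrow> p x = \<zero>\<^bsub>H\<^esub> \<longleftrightarrow> x \<in> \<aa>"
    and p_bracket: "\<lbrakk>x \<in> carrier L; y \<in> carrier L\<rbrakk> \<Longrightarrow> p (bracket L x y) = bracket H (p x) (p y)"
begin

interpretation p: linear_map K L H p
  by (intro linear_mapI vectorspace_axioms H.vectorspace_axioms p_hom)

lemmas p_simps [simp] = p.f_add p.f_smult p.f_im p.f_minus p.f_neg p.f0_is_0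

text \<open>Since \<aa> is its own orthogonal, the restriction of \<omega>(x, .) to \<aa> determines
  \<open>x\<close> modulo \<aa>. This is one half of the duality between \<hh> and \<aa>.\<close>

lemma p_eqI:
  assumes "x \<in> carrier L" "y \<in> carrier L" "\<And>b. b \<in> \<aa> \<Longrightarrow> \<omega> x b = \<omega> y b"
  shows "p x = p y"
proof -
  have "x \<ominus>\<^bsub>L\<^esub> y \<in> \<aa>"
    using assms by (intro ideal_memI) (simp_all add: form_diff form_bil)
  then have "p (x \<ominus>\<^bsub>L\<^esub> y) = \<zero>\<^bsub>H\<^esub>" using assms by (subst p_kernel) auto
  then show ?thesis using assms by simp
qed

lemma p_eqD:
  assumes "x \<in> carrier L" "y \<in> carrier L" "p x = p y"
  shows "x \<ominus>\<^bsub>L\<^esub> y \<in> \<aa>"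
  using assms p_kernel[of "x \<ominus>\<^bsub>L\<^esub> y"] by simp

lemma form_p_cong:
  assumes "x \<in> carrier L" "y \<in> carrier L" "p x = p y" "b \<in> \<aa>"
  shows "\<omega> x b = \<omega> y b" "\<omega> b x = \<omega> b y"
proof -
  have "\<omega> (x \<ominus>\<^bsub>L\<^esub> y) b = \<zero>" using p_eqD[OF assms(1-3)] assms(4) by simp
  then show "\<omega> x b = \<omega> y b" using assms by (simp add: form_diff form_bil)
  then show "\<omega> b x = \<omega> b y" using form_skew[of b] assms by simp
qed

text \<open>The other half of the duality. The functional f \<circ> p is represented by a vector of
  \<gg>; as it vanishes on \<aa>, that vector is orthogonal to \<aa> and hence in \<aa>.\<close>

lemma functional_represented:
  assumes f: "f \<in> module_hom K H (scalar_space K)"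
  shows "\<exists>!a. a \<in> \<aa> \<and> (\<forall>x\<in>carrier L. \<omega> a x = f (p x))"
proof -
  obtain a where a: "a \<in> carrier L" "\<And>x. x \<in> carrier L \<Longrightarrow> \<omega> a x = f (p x)"
    using nondegenerate_represents[OF finite_dimensional form_bilinear nondegenerate
        module_hom_comp[OF p_hom f]] by blast
  have "f \<zero>\<^bsub>H\<^esub> = \<zero>"
    using module_hom_smult[OF f, of \<zero> "\<zero>\<^bsub>H\<^esub>"] module_hom_in_carrier[OF f H.M.zero_closed] by simp
  then have "a \<in> \<aa>"
    using a by (intro ideal_memI) (auto simp: p_kernel[THEN iffD2])
  then show ?thesis using a by (intro ex1I[of _ a]) (auto intro!: form_eqI)
qed

text \<open>Uniqueness of the representing element makes it linear in the parameter. Parameters in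
  \<hh> serve to correct sections, parameters in \<gg> to build the isomorphism between two
  algebras.\<close>

lemma functional_family_represented:
  assumes V: "module K V"
    and l: "\<And>v. v \<in> carrier V \<Longrightarrow> \<phi> v \<in> module_hom K H (scalar_space K)"
    and r: "\<And>U. U \<in> carrier H \<Longrightarrow> (\<lambda>v. \<phi> v U) \<in> module_hom K V (scalar_space K)"
  obtains F where "F \<in> module_hom K V L" "\<And>v. v \<in> carrier V \<Longrightarrow> F v \<in> \<aa>"
    "\<And>v x. \<lbrakk>v \<in> carrier V; x \<in> carrier L\<rbrakk> \<Longrightarrow> \<omega> (F v) x = \<phi> v (p x)"
proof -
  interpret V: module K V by fact
  define F where "F v = (THE a. a \<in> \<aa> \<and> (\<forall>x\<in>carrier L. \<omega> a x = \<phi> v (p x)))" for v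
  have F: "F v \<in> \<aa>" "\<And>x. x \<in> carrier L \<Longrightarrow> \<omega> (F v) x = \<phi> v (p x)" if "v \<in> carrier V" for v
    using theI'[OF functional_represented[OF l[OF that]]] unfolding F_def by auto
  have "F \<in> module_hom K V L"
  proof (rule module_homI)
    fix v assume v: "v \<in> carrier V"
    show "F v \<in> carrier L" using F v by simp
    show "F (v \<oplus>\<^bsub>V\<^esub> w) = F v \<oplus>\<^bsub>L\<^esub> F w" if w: "w \<in> carrier V" for w
    proof (rule form_eqI)
      fix x assume x: "x \<in> carrier L"
      then show "\<omega> (F (v \<oplus>\<^bsub>V\<^esub> w)) x = \<omega> (F v \<oplus>\<^bsub>L\<^esub> F w) x"
        using v w module_hom_add[OF r[of "p x"] v w] by (simp add: F form_bil)
    qed (use F v w in auto)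
    show "F (k \<odot>\<^bsub>V\<^esub> v) = k \<odot>\<^bsub>L\<^esub> F v" if k: "k \<in> carrier K" for k
    proof (rule form_eqI)
      fix x assume x: "x \<in> carrier L"
      then show "\<omega> (F (k \<odot>\<^bsub>V\<^esub> v)) x = \<omega> (k \<odot>\<^bsub>L\<^esub> F v) x"
        using v k module_hom_smult[OF r[of "p x"] k v] by (simp add: F form_bil)
    qed (use F v k in auto)
  qed
  then show ?thesis using F that by blast
qed

end

lemma (in cring) torsion_arith:
  assumes "t \<in> carrier R" "a \<in> carrier R" "b \<in> carrier R" "t \<oplus> a \<oplus> \<ominus> b = \<zero>"
  shows "t = \<ominus> a \<ominus> \<ominus> b"
proof -
  have "t = \<ominus> (a \<oplus> \<ominus> b)" using assms by (intro eq_neg_if_add_zero) (simp_all add: a_assoc)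
  then show ?thesis using assms by (simp add: minus_add a_minus_def)
qed

lemma (in cring) flatness_arith:
  assumes "a \<in> carrier R" "b \<in> carrier R" "c \<in> carrier R" "a \<ominus> b \<oplus> c = \<zero>"
  shows "b \<ominus> a = c"
proof -
  have "c = \<ominus> (a \<ominus> b)" using assms by (intro eq_neg_if_add_zero) (simp_all add: a_comm)
  then show ?thesis using assms by (simp add: minus_add a_minus_def a_comm)
qed

text \<open>Here \<open>a\<close>, \<open>b\<close>, \<open>c\<close> are three nested brackets
  paired with a fixed vector, so the last hypothesis is the Jacobi identity; \<open>d\<close>,
  \<open>e\<close>, \<open>f\<close> are cocycle values at brackets in \<hh> and cancel.\<close>

lemma (in cring) cobd2_arith:
  assumes "a \<in> carrier R" "b \<in> carrier R" "c \<in> carrier R" "d \<in> carrier R" "e \<in> carrier R" "f \<in> carrier R"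
    and "a \<ominus> b \<oplus> c = \<zero>"
  shows "(a \<oplus> d) \<oplus> \<ominus> (b \<oplus> e) \<oplus> (c \<oplus> f) \<ominus> f \<oplus> e \<ominus> d = \<zero>"
proof -
  have *: "x \<oplus> \<ominus> y \<oplus> z \<ominus> f \<oplus> e \<ominus> d = (x \<ominus> d) \<ominus> (y \<ominus> e) \<oplus> (z \<ominus> f)"
    if "x \<in> carrier R" "y \<in> carrier R" "z \<in> carrier R" for x y z
    using assms that by (simp add: a_minus_def minus_add a_ac)
  have c: "x \<oplus> y \<ominus> y = x" if "x \<in> carrier R" "y \<in> carrier R" for x y
    using that by (simp add: a_minus_def a_assoc r_neg)
  show ?thesis using assms by (simp add: * c)
qed

section \<open>Sections of the projection and the induced flat connection\<close>

context lagr_quotient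
begin

text \<open>Stands for a Lagrangian complement: the complement is the image of \<open>s\<close>, and
  \<open>s\<close> is the lift into it.\<close>

definition isotropic_section :: "('w \<Rightarrow> 'v) \<Rightarrow> bool" where
  "isotropic_section s \<longleftrightarrow> s \<in> module_hom K H L \<and> (\<forall>U\<in>carrier H. p (s U) = U) \<and>
     (\<forall>U\<in>carrier H. \<forall>V\<in>carrier H. \<omega> (s U) (s V) = \<zero>)"

text \<open>The projection to \<aa> along the complement is left out, because the component in the
  image of an isotropic \<open>s\<close> pairs to zero with \<open>s W\<close>.\<close>

definition section_cocycle :: "('w \<Rightarrow> 'v) \<Rightarrow> 'w \<Rightarrow> 'w \<Rightarrow> 'w \<Rightarrow> 'k" where
  "section_cocycle s = (\<lambda>U\<in>carrier H. \<lambda>V\<in>carrier H. \<lambda>W\<in>carrier H. \<omega> (bracket L (s U) (s V)) (s W))"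

lemma lift: assumes "U \<in> carrier H" obtains u where "u \<in> carrier L" "p u = U"
  using assms unfolding p_surj[symmetric] by (elim imageE) simp

text \<open>Changing \<open>u\<close> by an element of \<aa> has no effect because \<aa> is abelian,
  and changing \<open>v\<close> has none because [u, b] lies in \<aa>. Hence the condition defining
  \<nabla> is independent of the lifts.\<close>

lemma lifts_cong:
  assumes "u \<in> carrier L" "u' \<in> carrier L" "v \<in> carrier L" "v' \<in> carrier L"
    and "p u = p u'" "p v = p v'" "b \<in> \<aa>"
  shows "\<omega> v (bracket L u b) = \<omega> v' (bracket L u' b)"
proof -
  have "bracket L (u \<ominus>\<^bsub>L\<^esub> u') b = \<zero>\<^bsub>L\<^esub>"
    using ideal_abelian[OF p_eqD[OF assms(1,2,5)] assms(7)] .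
  then have "bracket L u b = bracket L u' b"
    using assms by (simp add: a_minus_def[of L] bracket_bil bracket_neg)
      (metis M.minus_other_side a_minus_def bracket_bil(1) ideal_carrier)
  then show ?thesis
    using form_p_cong(1)[OF assms(3,4,6), of "bracket L u' b"] assms by simp
qed

text \<open>The required functional is prescribed on \<aa> only. It is extended to \<gg> by
  composition with x - s (p x), the projection to \<aa> along some linear section, and then
  represented through \<omega>.\<close>

lemma connection_lift_exists:
  assumes "u \<in> carrier L" "v \<in> carrier L"
  obtains w where "w \<in> carrier L" "\<And>b. b \<in> \<aa> \<Longrightarrow> \<omega> w b = \<ominus> \<omega> v (bracket L u b)"
proof -
  obtain s where s: "s \<in> module_hom K H L" "\<And>U. U \<in> carrier H \<Longrightarrow> p (s U) = U"
    using H.section_exists[OF H.finite_dimensional module_axioms p_hom p_surj] by blast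
  have sp: "(\<lambda>x. s (p x)) \<in> module_hom K L L" using module_hom_comp[OF p_hom s(1)] .
  let ?f = "\<lambda>x. \<ominus> \<omega> v (bracket L u (x \<ominus>\<^bsub>L\<^esub> s (p x)))"
  have hom: "?f \<in> module_hom K L (scalar_space K)"
  proof (rule module_homI)
    fix x y r assume x: "x \<in> carrier L"
    show "?f x \<in> carrier (scalar_space K)"
      using assms x module_hom_in_carrier[OF sp] by (simp add: form_bil bracket_bil)
    show "?f (x \<oplus>\<^bsub>L\<^esub> y) = ?f x \<oplus>\<^bsub>scalar_space K\<^esub> ?f y" if y: "y \<in> carrier L"
    proof -
      have "x \<oplus>\<^bsub>L\<^esub> y \<ominus>\<^bsub>L\<^esub> s (p (x \<oplus>\<^bsub>L\<^esub> y)) = (x \<ominus>\<^bsub>L\<^esub> s (p x)) \<oplus>\<^bsub>L\<^esub> (y \<ominus>\<^bsub>L\<^esub> s (p y))"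
        using module_hom_add[OF sp x y] x y module_hom_in_carrier[OF sp]
        by (simp add: a_minus_def[of L] M.minus_add M.a_ac)
      then show ?thesis
        using assms x y module_hom_in_carrier[OF sp] by (simp add: form_bil bracket_bil R.minus_add)
    qed
    show "?f (r \<odot>\<^bsub>L\<^esub> x) = r \<odot>\<^bsub>scalar_space K\<^esub> ?f x" if r: "r \<in> carrier K"
    proof -
      have "r \<odot>\<^bsub>L\<^esub> x \<ominus>\<^bsub>L\<^esub> s (p (r \<odot>\<^bsub>L\<^esub> x)) = r \<odot>\<^bsub>L\<^esub> (x \<ominus>\<^bsub>L\<^esub> s (p x))"
        using module_hom_smult[OF sp r x] x r module_hom_in_carrier[OF sp]
        by (simp add: smult_r_distr a_minus_def[of L] smult_r_minus)
      then show ?thesis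
        using assms x r module_hom_in_carrier[OF sp] by (simp add: form_bil bracket_bil R.r_minus)
    qed
  qed
  obtain w where w: "w \<in> carrier L" "\<And>x. x \<in> carrier L \<Longrightarrow> \<omega> w x = ?f x"
    using nondegenerate_represents[OF finite_dimensional form_bilinear nondegenerate hom] by blast
  have s0: "s \<zero>\<^bsub>H\<^esub> = \<zero>\<^bsub>L\<^esub>"
  proof -
    have "s (\<zero> \<odot>\<^bsub>H\<^esub> \<zero>\<^bsub>H\<^esub>) = \<zero>\<^bsub>L\<^esub>"
      using module_hom_smult[OF s(1), of \<zero> "\<zero>\<^bsub>H\<^esub>"] module_hom_in_carrier[OF s(1) H.M.zero_closed] by simp
    then show ?thesis by simp
  qed
  have "\<omega> w b = \<ominus> \<omega> v (bracket L u b)" if b: "b \<in> \<aa>" for b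
  proof -
    have "\<ominus>\<^bsub>L\<^esub> \<zero>\<^bsub>L\<^esub> = \<zero>\<^bsub>L\<^esub>" by simp
    then have "b \<ominus>\<^bsub>L\<^esub> \<zero>\<^bsub>L\<^esub> = b" using b by (simp only: a_minus_def[of L] M.r_zero ideal_carrier)
    then show ?thesis
      using w(2)[of b] b p_kernel[of b] s0 by simp
  qed
  with w(1) show ?thesis using that by blast
qed

end

text \<open>Apart from closure, only the defining property of \<nabla> is assumed, for all lifts at
  once; bilinearity, vanishing torsion and flatness are derived. Different descriptions of the
  connection are compared through this property.\<close>

locale lagr_connection = lagr_quotient K L \<omega> \<aa> H p
  for K :: "('k, 'm) ring_scheme" (structure) and L :: "('k, 'v) lie_algebra" and \<omega> \<aa>
    and H :: "('k, 'w) lie_algebra" and p :: "'v \<Rightarrow> 'w" +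
  fixes D :: "'w \<Rightarrow> 'w \<Rightarrow> 'w"
  assumes D_closed: "\<lbrakk>U \<in> carrier H; V \<in> carrier H\<rbrakk> \<Longrightarrow> D U V \<in> carrier H"
    and D_lift: "\<lbrakk>u \<in> carrier L; v \<in> carrier L; w \<in> carrier L; p w = D (p u) (p v); b \<in> \<aa>\<rbrakk> \<Longrightarrow>
      \<omega> w b = \<ominus> \<omega> v (bracket L u b)"
begin

lemma D_eqI:
  assumes "u \<in> carrier L" "v \<in> carrier L" "x \<in> carrier L"
    and "\<And>b. b \<in> \<aa> \<Longrightarrow> \<omega> x b = \<ominus> \<omega> v (bracket L u b)"
  shows "D (p u) (p v) = p x"
proof -
  obtain w where w: "w \<in> carrier L" "p w = D (p u) (p v)"
    using lift[OF D_closed[of "p u" "p v"]] assms by auto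
  have "p w = p x"
    using D_lift[OF assms(1,2) w] assms w by (intro p_eqI) auto
  then show ?thesis using w by simp
qed

text \<open>Everything is tested by pairing with \<open>b\<close> in \<aa>: vanishing torsion is
  closedness of \<omega> at (u, v, b), and flatness is the Jacobi identity for (u, v, b) paired with
  \<open>w\<close>.\<close>

lemma flat_connection_D: "flat_connection K H D"
  unfolding flat_connection_def
proof (intro conjI ballI)
  have D': "\<exists>w\<in>carrier L. p w = D (p u) (p v) \<and> (\<forall>b\<in>\<aa>. \<omega> w b = \<ominus> \<omega> v (bracket L u b))"
    if "u \<in> carrier L" "v \<in> carrier L" for u v
    using lift[OF D_closed[of "p u" "p v"]] D_lift[OF that] that by (metis p_simps(3))
  show "bilinear_map K H H H D"
  proof (rule bilinear_mapI)
    fix U V W r assume "U \<in> carrier H" "V \<in> carrier H"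
    then obtain u v where u: "u \<in> carrier L" "p u = U" "v \<in> carrier L" "p v = V" using lift by metis
    then obtain w where w: "w \<in> carrier L" "p w = D U V" "\<And>b. b \<in> \<aa> \<Longrightarrow> \<omega> w b = \<ominus> \<omega> v (bracket L u b)"
      using D'[of u v] by blast
    show "D U V \<in> carrier H" using D_closed u by auto
    { assume "W \<in> carrier H"
      then obtain x where x: "x \<in> carrier L" "p x = W" using lift by metis
      obtain y where y: "y \<in> carrier L" "p y = D U W" "\<And>b. b \<in> \<aa> \<Longrightarrow> \<omega> y b = \<ominus> \<omega> x (bracket L u b)"
        using D'[of u x] u x by blast
      have "D (p u) (p (v \<oplus>\<^bsub>L\<^esub> x)) = p (w \<oplus>\<^bsub>L\<^esub> y)"
        using u x w y by (intro D_eqI) (auto simp: form_bil R.minus_add bracket_bil)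
      then show "D U (V \<oplus>\<^bsub>H\<^esub> W) = D U V \<oplus>\<^bsub>H\<^esub> D U W" using u x w y by simp }
    { assume "W \<in> carrier H"
      then obtain x where x: "x \<in> carrier L" "p x = W" using lift by metis
      obtain y where y: "y \<in> carrier L" "p y = D W V" "\<And>b. b \<in> \<aa> \<Longrightarrow> \<omega> y b = \<ominus> \<omega> v (bracket L x b)"
        using D'[of x v] u x by blast
      have "D (p (u \<oplus>\<^bsub>L\<^esub> x)) (p v) = p (w \<oplus>\<^bsub>L\<^esub> y)"
        using u x w y by (intro D_eqI) (auto simp: form_bil R.minus_add bracket_bil)
      then show "D (U \<oplus>\<^bsub>H\<^esub> W) V = D U V \<oplus>\<^bsub>H\<^esub> D W V" using u x w y by simp }
    { assume r: "r \<in> carrier K"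
      have "D (p u) (p (r \<odot>\<^bsub>L\<^esub> v)) = p (r \<odot>\<^bsub>L\<^esub> w)"
        using u w r by (intro D_eqI) (auto simp: form_bil R.r_minus bracket_bil)
      then show "D U (r \<odot>\<^bsub>H\<^esub> V) = r \<odot>\<^bsub>H\<^esub> D U V" using u w r by simp }
    { assume r: "r \<in> carrier K"
      have "D (p (r \<odot>\<^bsub>L\<^esub> u)) (p v) = p (r \<odot>\<^bsub>L\<^esub> w)"
        using u w r by (intro D_eqI) (auto simp: form_bil R.r_minus bracket_bil)
      then show "D (r \<odot>\<^bsub>H\<^esub> U) V = r \<odot>\<^bsub>H\<^esub> D U V" using u w r by simp }
  qed
  fix U V assume "U \<in> carrier H" "V \<in> carrier H"
  then obtain u v where u: "u \<in> carrier L" "p u = U" "v \<in> carrier L" "p v = V" using lift by metis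
  show "D U V \<ominus>\<^bsub>H\<^esub> D V U = bracket H U V"
  proof -
    obtain w where w: "w \<in> carrier L" "p w = D U V" "\<And>b. b \<in> \<aa> \<Longrightarrow> \<omega> w b = \<ominus> \<omega> v (bracket L u b)"
      using D'[of u v] u by blast
    obtain y where y: "y \<in> carrier L" "p y = D V U" "\<And>b. b \<in> \<aa> \<Longrightarrow> \<omega> y b = \<ominus> \<omega> u (bracket L v b)"
      using D'[of v u] u by blast
    have "p (w \<ominus>\<^bsub>L\<^esub> y) = p (bracket L u v)"
    proof (rule p_eqI)
      fix b assume b: "b \<in> \<aa>"
      have "\<omega> (bracket L b u) v = \<omega> v (bracket L u b)"
        using b u bracket_skew[of b u] form_skew[of v "bracket L u b"] by (simp add: form_neg bracket_bil)
      moreover have "\<omega> (bracket L v b) u = \<ominus> \<omega> u (bracket L v b)"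
        using b u form_skew[of u "bracket L v b"] by (simp add: bracket_bil form_bil)
      ultimately have "\<omega> (bracket L u v) b \<oplus> \<omega> v (bracket L u b) \<oplus> \<ominus> \<omega> u (bracket L v b) = \<zero>"
        using form_closed[of u v b] u b by simp
      then have "\<omega> (bracket L u v) b = \<ominus> \<omega> v (bracket L u b) \<ominus> \<ominus> \<omega> u (bracket L v b)"
        using u b by (intro R.torsion_arith) (auto simp: form_bil bracket_bil)
      then show "\<omega> (w \<ominus>\<^bsub>L\<^esub> y) b = \<omega> (bracket L u v) b"
        using w y b by (simp add: form_diff)
    qed (use u w y in \<open>simp_all add: bracket_bil\<close>)
    then show ?thesis using u w y p_bracket by simp
  qed
  fix W assume "W \<in> carrier H"
  then obtain w where w: "w \<in> carrier L" "p w = W" using lift by metis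
  show "D U (D V W) \<ominus>\<^bsub>H\<^esub> D V (D U W) = D (bracket H U V) W"
  proof -
    obtain x where x: "x \<in> carrier L" "p x = D V W" "\<And>b. b \<in> \<aa> \<Longrightarrow> \<omega> x b = \<ominus> \<omega> w (bracket L v b)"
      using D'[of v w] u w by blast
    obtain y where y: "y \<in> carrier L" "p y = D U (D V W)" "\<And>b. b \<in> \<aa> \<Longrightarrow> \<omega> y b = \<ominus> \<omega> x (bracket L u b)"
      using D'[of u x] u x by metis
    obtain x' where x': "x' \<in> carrier L" "p x' = D U W" "\<And>b. b \<in> \<aa> \<Longrightarrow> \<omega> x' b = \<ominus> \<omega> w (bracket L u b)"
      using D'[of u w] u w by blast
    obtain y' where y': "y' \<in> carrier L" "p y' = D V (D U W)" "\<And>b. b \<in> \<aa> \<Longrightarrow> \<omega> y' b = \<ominus> \<omega> x' (bracket L v b)"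
      using D'[of v x'] u x' by metis
    have "D (p (bracket L u v)) (p w) = p (y \<ominus>\<^bsub>L\<^esub> y')"
    proof (rule D_eqI)
      fix b assume b: "b \<in> \<aa>"
      \<comment> \<open>Two uses of the defining property reverse the order of the brackets:
        \<omega>(y, b) = \<omega>(w, [v, [u, b]]), since [u, b] is again in \<aa>.\<close>
      have "\<omega> w (bracket L u (bracket L v b) \<ominus>\<^bsub>L\<^esub> bracket L v (bracket L u b) \<oplus>\<^bsub>L\<^esub> bracket L b (bracket L u v)) = \<zero>"
        using jacobi'[of u v b] u w b by simp
      then have "\<omega> w (bracket L u (bracket L v b)) \<ominus> \<omega> w (bracket L v (bracket L u b))
          \<oplus> \<omega> w (bracket L b (bracket L u v)) = \<zero>"
        using u w b by (simp add: form_bil form_diff bracket_bil)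
      then have "\<omega> w (bracket L v (bracket L u b)) \<ominus> \<omega> w (bracket L u (bracket L v b)) = \<omega> w (bracket L b (bracket L u v))"
        using u w b by (intro R.flatness_arith) (auto simp: form_bil bracket_bil)
      also have "\<dots> = \<ominus> \<omega> w (bracket L (bracket L u v) b)"
        using u w b bracket_skew[of b "bracket L u v"] by (simp add: form_neg bracket_bil)
      finally show "\<omega> (y \<ominus>\<^bsub>L\<^esub> y') b = \<ominus> \<omega> w (bracket L (bracket L u v) b)"
        using y y' x x' u w b by (simp add: form_diff form_bil bracket_bil)
    qed (use u w y y' in \<open>simp_all add: bracket_bil\<close>)
    then show ?thesis using y y' u w p_bracket by simp
  qed
qed

sublocale F: flat_lie_alg K H D
  by (intro flat_lie_alg.intro flat_lie_alg_axioms.intro flat_connection_D H.lie_alg_axioms)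

end

section \<open>Isotropic sections\<close>

lemma (in cring) form_by_section_arith:
  assumes "a \<in> carrier R" "b \<in> carrier R" "c \<in> carrier R" "(a \<ominus> \<ominus> b) \<ominus> c = \<zero>"
  shows "a = c \<ominus> b"
proof -
  have "a \<ominus> (c \<ominus> b) = (a \<ominus> \<ominus> b) \<ominus> c" using assms(1-3) by (simp add: a_minus_def minus_add a_ac)
  then show ?thesis using assms by simp
qed

lemma (in cring) section_cocycle_arith:
  assumes "t = c \<ominus> b" "c = \<ominus> a" "a \<in> carrier R" "b \<in> carrier R"
  shows "\<ominus> b = t \<oplus> a"
proof -
  have "t \<oplus> a = (\<ominus> b \<oplus> \<ominus> a) \<oplus> a"
    using assms by (simp add: a_minus_def a_comm[of "\<ominus> b" "\<ominus> a"])
  also have "\<dots> = \<ominus> b" using assms(3,4) by (simp add: a_assoc l_neg)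
  finally show ?thesis by simp
qed

lemma (in cring) neg_eqD: "\<lbrakk>\<ominus> a = b; a \<in> carrier R\<rbrakk> \<Longrightarrow> a = \<ominus> b"
  by auto

context lagr_quotient
begin

lemma isotropic_sectionD:
  assumes "isotropic_section s"
  shows "s \<in> module_hom K H L" "\<And>U. U \<in> carrier H \<Longrightarrow> s U \<in> carrier L"
    "\<And>U. U \<in> carrier H \<Longrightarrow> p (s U) = U"
    "\<And>U V. \<lbrakk>U \<in> carrier H; V \<in> carrier H\<rbrakk> \<Longrightarrow> \<omega> (s U) (s V) = \<zero>"
  using assms module_hom_in_carrier by (auto simp: isotropic_section_def)

text \<open>The component of \<open>x\<close> in \<aa> relative to the section; isotropy of
  \<open>s\<close> makes pairings with the section see this component only.\<close>

lemma ideal_part: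
  assumes s: "isotropic_section s" and x: "x \<in> carrier L"
  shows "x \<ominus>\<^bsub>L\<^esub> s (p x) \<in> \<aa>"
    and "Z \<in> carrier H \<Longrightarrow> \<omega> (x \<ominus>\<^bsub>L\<^esub> s (p x)) (s Z) = \<omega> x (s Z)"
    and "s (p x) \<oplus>\<^bsub>L\<^esub> (x \<ominus>\<^bsub>L\<^esub> s (p x)) = x"
proof -
  note sD = isotropic_sectionD[OF s]
  show "x \<ominus>\<^bsub>L\<^esub> s (p x) \<in> \<aa>" using x sD by (intro p_eqD) auto
  show "\<omega> (x \<ominus>\<^bsub>L\<^esub> s (p x)) (s Z) = \<omega> x (s Z)" if "Z \<in> carrier H"
    using x sD that by (simp add: form_diff form_bil a_minus_def[of K])
  show "s (p x) \<oplus>\<^bsub>L\<^esub> (x \<ominus>\<^bsub>L\<^esub> s (p x)) = x"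
    using x sD by (simp add: a_minus_def[of L] M.a_ac M.r_neg1 M.r_neg2 M.r_neg)
qed

text \<open>The components of \<open>x\<close> and \<open>y\<close> in \<aa> pair to zero, and
  expanding this gives the formula. In the coordinates (p x, \<omega>(x, s(.))) it exhibits \<omega>
  as the canonical form on \<hh> plus its dual.\<close>

lemma form_by_section:
  assumes s: "isotropic_section s" and x: "x \<in> carrier L" and y: "y \<in> carrier L"
  shows "\<omega> x y = \<omega> x (s (p y)) \<ominus> \<omega> y (s (p x))"
proof -
  note sD = isotropic_sectionD[OF s]
  have "\<omega> (x \<ominus>\<^bsub>L\<^esub> s (p x)) (y \<ominus>\<^bsub>L\<^esub> s (p y)) = \<zero>"
    using ideal_part(1)[OF s] x y by simp
  then have "(\<omega> x y \<ominus> \<omega> (s (p x)) y) \<ominus> \<omega> x (s (p y)) = \<zero>"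
    using form_diff(1)[of "x \<ominus>\<^bsub>L\<^esub> s (p x)" y "s (p y)"] form_diff(2)[of x "s (p x)" y]
      ideal_part(2)[OF s x, of "p y"] x y sD(2) by simp
  then have "(\<omega> x y \<ominus> \<ominus> \<omega> y (s (p x))) \<ominus> \<omega> x (s (p y)) = \<zero>"
    using form_skew[of "s (p x)" y] x y sD by simp
  then show ?thesis using x y sD by (intro R.form_by_section_arith) (auto simp: form_bil)
qed

text \<open>Values in \<aa> do not disturb the section property, and \<omega>(F U, F V) vanishes, so
  isotropy is an affine condition on \<open>F\<close>. It is used to make a section isotropic and to
  change the cocycle of an isotropic one.\<close>

lemma corrected_section:
  assumes s: "s \<in> module_hom K H L" "\<And>U. U \<in> carrier H \<Longrightarrow> p (s U) = U"
    and F: "F \<in> module_hom K H L" "\<And>U. U \<in> carrier H \<Longrightarrow> F U \<in> \<aa>"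
    and iso: "\<And>U V. \<lbrakk>U \<in> carrier H; V \<in> carrier H\<rbrakk> \<Longrightarrow>
      \<omega> (s U) (s V) \<oplus> \<omega> (F U) (s V) \<ominus> \<omega> (F V) (s U) = \<zero>"
  shows "isotropic_section (\<lambda>U. s U \<oplus>\<^bsub>L\<^esub> F U)"
  unfolding isotropic_section_def
proof (intro conjI ballI)
  have c: "s U \<in> carrier L" "F U \<in> carrier L" if "U \<in> carrier H" for U
    using module_hom_in_carrier[OF s(1) that] F(2)[OF that] by auto
  show "(\<lambda>U. s U \<oplus>\<^bsub>L\<^esub> F U) \<in> module_hom K H L"
    using c by (intro module_homI)
      (simp_all add: module_hom_add[OF s(1)] module_hom_add[OF F(1)] module_hom_smult[OF s(1)]
        module_hom_smult[OF F(1)] smult_r_distr M.a_ac)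
  fix U assume U: "U \<in> carrier H"
  show "p (s U \<oplus>\<^bsub>L\<^esub> F U) = U"
    using U c s(2) F(2) p_kernel[of "F U"] by simp
  fix V assume V: "V \<in> carrier H"
  have "\<omega> (s U \<oplus>\<^bsub>L\<^esub> F U) (s V \<oplus>\<^bsub>L\<^esub> F V) = \<omega> (s U) (s V) \<oplus> \<omega> (F U) (s V) \<oplus> \<omega> (s U) (F V)"
    using U V c F(2) by (simp add: form_bil R.a_ac)
  also have "\<dots> = \<zero>"
    using iso[OF U V] form_skew[of "s U" "F V"] U V c by (simp add: a_minus_def[of K])
  finally show "\<omega> (s U \<oplus>\<^bsub>L\<^esub> F U) (s V \<oplus>\<^bsub>L\<^esub> F V) = \<zero>" .
qed

lemma isotropic_section_exists:
  assumes "char_zero K"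
  obtains s where "isotropic_section s"
proof -
  obtain s where s: "s \<in> module_hom K H L" "\<And>U. U \<in> carrier H \<Longrightarrow> p (s U) = U"
    using H.section_exists[OF H.finite_dimensional module_axioms p_hom p_surj] by blast
  have c: "s U \<in> carrier L" if "U \<in> carrier H" for U
    using module_hom_in_carrier[OF s(1) that] .
  \<comment> \<open>The correction below needs one half; here characteristic 0 enters the choice of
    a section.\<close>
  have "[(2::nat)] \<cdot> \<one> = \<one> \<oplus> \<one>" by (simp add: numeral_2_eq_2)
  moreover have "[(2::nat)] \<cdot> \<one> \<noteq> \<zero>" using assms unfolding char_zero_def by (meson zero_less_numeral)
  ultimately have two: "\<one> \<oplus> \<one> \<noteq> \<zero>" by simp
  define h where "h = inv (\<one> \<oplus> \<one>)"
  have h: "h \<in> carrier K" unfolding h_def using two by simp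
  have "h \<otimes> (\<one> \<oplus> \<one>) = \<one>" unfolding h_def using two field_Units by (intro R.Units_l_inv) auto
  then have hh: "h \<oplus> h = \<one>" using h by (simp add: R.r_distr)
  txt \<open>Adding to \<open>s\<close> the map into \<open>\<aa>\<close> that represents \<open>- \<omega>(s U, s V) / 2\<close> makes it isotropic.\<close>
  let ?\<phi> = "\<lambda>U V. \<ominus> (h \<otimes> \<omega> (s U) (s V))"
  have hom1: "?\<phi> U \<in> module_hom K H (scalar_space K)" if "U \<in> carrier H" for U
    by (intro H.functional_neg H.functional_smult h module_hom_comp[OF s(1) form_homs(1)] c that)
  have hom2: "(\<lambda>V. ?\<phi> V U) \<in> module_hom K H (scalar_space K)" if "U \<in> carrier H" for U
    using c[OF that] h
    by (intro H.functional_neg H.functional_smult module_hom_comp[OF s(1), of "\<lambda>x. \<omega> x (s U)"]) (auto intro: form_homs)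
  obtain F where F: "F \<in> module_hom K H L" "\<And>U. U \<in> carrier H \<Longrightarrow> F U \<in> \<aa>"
    and Fw: "\<And>U x. \<lbrakk>U \<in> carrier H; x \<in> carrier L\<rbrakk> \<Longrightarrow> \<omega> (F U) x = ?\<phi> U (p x)"
    using functional_family_represented[of H ?\<phi>, OF H.module_axioms hom1 hom2] by blast
  have "isotropic_section (\<lambda>U. s U \<oplus>\<^bsub>L\<^esub> F U)"
  proof (rule corrected_section[OF s F])
    fix U V assume U: "U \<in> carrier H" "V \<in> carrier H"
    have w: "\<omega> (s U) (s V) \<in> carrier K" using U c by (simp add: form_bil)
    have "h \<otimes> \<omega> (s U) (s V) \<oplus> h \<otimes> \<omega> (s U) (s V) = \<omega> (s U) (s V)"
      using hh h w by (simp flip: R.l_distr)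
    moreover have "\<omega> (F V) (s U) = h \<otimes> \<omega> (s U) (s V)"
      using Fw[of V "s U"] form_skew[of "s V" "s U"] U c s(2) h w by (simp add: R.r_minus)
    moreover have "\<omega> (F U) (s V) = \<ominus> (h \<otimes> \<omega> (s U) (s V))"
      using Fw[of U "s V"] U c s(2) by simp
    moreover have "a \<oplus> a \<oplus> \<ominus> a \<ominus> a = \<zero>" if "a \<in> carrier K" for a
      using that by (simp add: a_minus_def R.a_ac R.r_neg R.r_neg1 R.r_neg2)
    ultimately show "\<omega> (s U) (s V) \<oplus> \<omega> (F U) (s V) \<ominus> \<omega> (F V) (s U) = \<zero>"
      using h w by (metis R.m_closed)
  qed (use s F in auto)
  then show ?thesis using that by blast
qed

end

section \<open>The trilinear form in coordinates, and the cocycle of a section\<close>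

context lagr_connection
begin

text \<open>The defining property of \<nabla> with \<open>s\<close> as lift; skew symmetry of
  \<omega> absorbs the sign.\<close>

lemma form_connection:
  assumes s: "isotropic_section s" and u: "u \<in> carrier L" "v \<in> carrier L" and b: "b \<in> \<aa>"
  shows "\<omega> b (s (D (p u) (p v))) = \<omega> v (bracket L u b)"
proof -
  note sD = isotropic_sectionD[OF s]
  have d: "D (p u) (p v) \<in> carrier H" using D_closed u by simp
  have "\<omega> (s (D (p u) (p v))) b = \<ominus> \<omega> v (bracket L u b)"
    using d sD u b by (intro D_lift) auto
  then show ?thesis using form_skew[of b "s (D (p u) (p v))"] d sD u b by (simp add: form_bil bracket_bil)
qed

text \<open>Each argument is split along the section and \<aa>. A term containing a component in
  \<aa> depends on the other two arguments only modulo \<aa>, which turns it into a value of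
  \<nabla> or of the bracket of \<hh>; the term without such a component is the cocycle.\<close>

lemma triple_by_section:
  assumes s: "isotropic_section s" and x: "x \<in> carrier L" and y: "y \<in> carrier L" and z: "z \<in> carrier L"
  shows "\<omega> (bracket L x y) z = section_cocycle s (p x) (p y) (p z) \<ominus> \<omega> y (s (D (p x) (p z)))
    \<oplus> \<omega> x (s (D (p y) (p z))) \<ominus> \<omega> z (s (bracket H (p x) (p y)))"
proof -
  note sD = isotropic_sectionD[OF s]
  define u v w where uvw: "u = s (p x)" "v = s (p y)" "w = s (p z)"
  define a b c where abc: "a = x \<ominus>\<^bsub>L\<^esub> u" "b = y \<ominus>\<^bsub>L\<^esub> v" "c = z \<ominus>\<^bsub>L\<^esub> w"
  have uc: "u \<in> carrier L" "v \<in> carrier L" "w \<in> carrier L" unfolding uvw using sD x y z by auto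
  have pu: "p u = p x" "p v = p y" "p w = p z" unfolding uvw using sD x y z by auto
  have ai: "a \<in> \<aa>" "b \<in> \<aa>" "c \<in> \<aa>" unfolding abc uvw using ideal_part(1)[OF s] x y z by auto
  have sum: "u \<oplus>\<^bsub>L\<^esub> a = x" "v \<oplus>\<^bsub>L\<^esub> b = y" "w \<oplus>\<^bsub>L\<^esub> c = z"
    unfolding abc uvw using ideal_part(3)[OF s] x y z by auto
  have part: "\<omega> a (s Z) = \<omega> x (s Z)" "\<omega> b (s Z) = \<omega> y (s Z)" "\<omega> c (s Z) = \<omega> z (s Z)" if "Z \<in> carrier H"
    for Z
    unfolding abc uvw using ideal_part(2)[OF s] x y z that by auto
  have H: "D (p x) (p z) \<in> carrier H" "D (p y) (p z) \<in> carrier H" "bracket H (p x) (p y) \<in> carrier H"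
    using x y z D_closed H.bracket_bil by auto
  have cl: "\<omega> r t \<in> carrier K" if "r \<in> carrier L" "t \<in> carrier L" for r t using form_bil(1)[OF that] .
  \<comment> \<open>The component in \<aa> is removed from \<open>z\<close> first, then from
    \<open>x\<close>, then from \<open>y\<close>, so that arguments not yet treated can remain
    unsplit.\<close>
  have 1: "\<omega> (bracket L x y) c = \<ominus> \<omega> z (s (bracket H (p x) (p y)))"
  proof -
    have "\<omega> (bracket L x y) c = \<omega> (s (bracket H (p x) (p y))) c"
      using x y sD H ai by (intro form_p_cong(1)) (auto simp: bracket_bil p_bracket)
    then show ?thesis
      using form_skew[of "s (bracket H (p x) (p y))" c] sD H ai part(3) by simp
  qed
  have 2: "\<omega> (bracket L a y) w = \<omega> x (s (D (p y) (p z)))"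
  proof -
    have "\<omega> (bracket L a y) w = \<omega> w (bracket L y a)"
      using bracket_skew[of a y] form_skew[of w "bracket L y a"] ai y uc by (simp add: form_neg bracket_bil)
    then show ?thesis using form_connection[OF s y uc(3) ai(1)] pu part(1) H by simp
  qed
  have 3: "\<omega> (bracket L u b) w = \<ominus> \<omega> y (s (D (p x) (p z)))"
    using form_connection[OF s uc(1,3) ai(2)] form_skew[of "bracket L u b" w] pu part(2) H uc ai
      by (simp add: bracket_bil)
  have "\<omega> (bracket L x y) z = \<omega> (bracket L x y) w \<oplus> \<omega> (bracket L x y) c"
    using form_bil(2)[of "bracket L x y" w c] sum(3) x y uc ai by (simp add: bracket_bil)
  moreover have "\<omega> (bracket L x y) w = \<omega> (bracket L u y) w \<oplus> \<omega> (bracket L a y) w"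
    using form_bil(3)[of "bracket L u y" "bracket L a y" w] bracket_bil(3)[of u a y] sum(1) y uc ai
    by (simp add: bracket_bil(1))
  moreover have "\<omega> (bracket L u y) w = \<omega> (bracket L u v) w \<oplus> \<omega> (bracket L u b) w"
    using form_bil(3)[of "bracket L u v" "bracket L u b" w] bracket_bil(2)[of u v b] sum(2) uc ai
    by (simp add: bracket_bil(1))
  moreover have "\<omega> (bracket L u v) w = section_cocycle s (p x) (p y) (p z)"
    using x y z by (simp add: section_cocycle_def uvw)
  ultimately show ?thesis
    using 1 2 3 by (simp add: a_minus_def[of K])
qed

lemma section_cocycle_apply:
  "\<lbrakk>U \<in> carrier H; V \<in> carrier H; W \<in> carrier H\<rbrakk> \<Longrightarrow> section_cocycle s U V W = \<omega> (bracket L (s U) (s V)) (s W)"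
  by (simp add: section_cocycle_def)

lemma section_cocycle_cochain:
  assumes s: "isotropic_section s"
  shows "section_cocycle s \<in> cochains2 K H"
  unfolding section_cocycle_def
proof (rule H.cochains2_restrictI)
  note sD = isotropic_sectionD[OF s]
  show "H.trilinear (\<lambda>U V W. \<omega> (bracket L (s U) (s V)) (s W))"
    unfolding H.trilinear_def
  proof (intro ballI conjI)
    fix U V assume U: "U \<in> carrier H" "V \<in> carrier H"
    note c = sD(2)[OF U(1)] sD(2)[OF U(2)]
    show "(\<lambda>W. \<omega> (bracket L (s U) (s V)) (s W)) \<in> module_hom K H (scalar_space K)"
      using c by (intro module_hom_comp[OF sD(1) form_homs(1)] bracket_bil)
    show "(\<lambda>W. \<omega> (bracket L (s U) (s W)) (s V)) \<in> module_hom K H (scalar_space K)"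
      using c by (intro module_hom_comp[OF module_hom_comp[OF sD(1) bracket_homs(1)] form_homs(2)])
    show "(\<lambda>W. \<omega> (bracket L (s W) (s U)) (s V)) \<in> module_hom K H (scalar_space K)"
      using c by (intro module_hom_comp[OF module_hom_comp[OF sD(1) bracket_homs(2)] form_homs(2)])
  qed
qed (use isotropic_sectionD[OF s] in \<open>simp add: bracket_self\<close>)

text \<open>The cyclic identity is closedness of \<omega> on the image of \<open>s\<close>. The
  cocycle condition is the Jacobi identity on that image, once each nested bracket is evaluated by
  the trilinear formula.\<close>

lemma section_cocycle_cocycle:
  assumes s: "isotropic_section s"
  shows "section_cocycle s \<in> lagr_cocycles2 K H D"
  unfolding F.lagr_cocycles2_iff
proof (intro conjI ballI section_cocycle_cochain[OF s])
  note sD = isotropic_sectionD[OF s]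
  fix U V W assume U: "U \<in> carrier H" "V \<in> carrier H" "W \<in> carrier H"
  note c = sD(2)[OF U(1)] sD(2)[OF U(2)] sD(2)[OF U(3)]
  show "section_cocycle s U V W \<oplus> section_cocycle s W U V \<oplus> section_cocycle s V W U = \<zero>"
    using U c form_closed[of "s U" "s V" "s W"] by (simp add: section_cocycle_apply)
  fix X assume X: "X \<in> carrier H"
  \<comment> \<open>The trilinear formula at s A, [s B, s C] and s X. The terms pairing s A or s X
    with a value of \<open>s\<close> vanish by isotropy, and two cocycle values remain.\<close>
  have key: "\<ominus> section_cocycle s B C (D A X) = \<omega> (bracket L (s A) (bracket L (s B) (s C))) (s X)
      \<oplus> section_cocycle s (bracket H B C) A X"
    if A: "A \<in> carrier H" "B \<in> carrier H" "C \<in> carrier H" for A B C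
  proof -
    have BC: "bracket H B C \<in> carrier H" using A by (simp add: H.bracket_bil)
    have DA: "D A X \<in> carrier H" "D (bracket H B C) X \<in> carrier H" "bracket H A (bracket H B C) \<in> carrier H"
      using A X BC by (simp_all add: D_closed H.bracket_bil)
    have "\<omega> (bracket L (s A) (bracket L (s B) (s C))) (s X) =
        section_cocycle s A (bracket H B C) X \<ominus> section_cocycle s B C (D A X)"
      using triple_by_section[OF s, of "s A" "bracket L (s B) (s C)" "s X"] A X BC DA sD
      by (simp add: bracket_bil p_bracket section_cocycle_apply form_bil a_minus_def[of K])
    moreover have "section_cocycle s A (bracket H B C) X = \<ominus> section_cocycle s (bracket H B C) A X"
      using bracket_skew[of "s A" "s (bracket H B C)"] A X BC sD
      by (simp add: section_cocycle_apply form_neg bracket_bil)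
    moreover have "section_cocycle s (bracket H B C) A X \<in> carrier K" "section_cocycle s B C (D A X) \<in> carrier K"
      using A X BC DA sD by (simp_all add: section_cocycle_apply form_bil bracket_bil)
    ultimately show ?thesis by (rule R.section_cocycle_arith)
  qed
  have cl: "section_cocycle s A B C \<in> carrier K" if "A \<in> carrier H" "B \<in> carrier H" "C \<in> carrier H"
    for A B C
    using that sD by (simp add: section_cocycle_apply form_bil bracket_bil)
  have HD: "D U X \<in> carrier H" "D V X \<in> carrier H" "D W X \<in> carrier H"
    "bracket H U V \<in> carrier H" "bracket H U W \<in> carrier H" "bracket H V W \<in> carrier H"
    using U X by (simp_all add: D_closed H.bracket_bil)
  have "\<omega> (bracket L (s U) (bracket L (s V) (s W)) \<ominus>\<^bsub>L\<^esub> bracket L (s V) (bracket L (s U) (s W))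
      \<oplus>\<^bsub>L\<^esub> bracket L (s W) (bracket L (s U) (s V))) (s X) = \<zero>"
    using jacobi'[OF c] sD(2)[OF X] by simp
  then have jac: "\<omega> (bracket L (s U) (bracket L (s V) (s W))) (s X) \<ominus> \<omega> (bracket L (s V) (bracket L (s U) (s W))) (s X)
      \<oplus> \<omega> (bracket L (s W) (bracket L (s U) (s V))) (s X) = \<zero>"
    using c sD(2)[OF X] by (simp add: form_bil form_diff bracket_bil)
  have 2: "section_cocycle s U W (D V X) = \<ominus> (\<omega> (bracket L (s V) (bracket L (s U) (s W))) (s X)
      \<oplus> section_cocycle s (bracket H U W) V X)"
    by (rule R.neg_eqD[OF key[OF U(2,1,3)] cl[OF U(1,3) HD(2)]])
  have 3: "x \<ominus> section_cocycle s U V (D W X) = x \<oplus> (\<omega> (bracket L (s W) (bracket L (s U) (s V))) (s X)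
      \<oplus> section_cocycle s (bracket H U V) W X)" for x
    using key[OF U(3,1,2)] by (simp add: a_minus_def[of K])
  show "F.cobd2 (section_cocycle s) U V W X = \<zero>"
    unfolding F.cobd2_def key[OF U(1,2,3)] 2 3
    by (rule R.cobd2_arith[OF _ _ _ _ _ _ jac]) (use c sD(2)[OF X] cl HD U X in \<open>simp_all add: form_bil bracket_bil\<close>)
qed

text \<open>Isotropy of \<open>t\<close>, read through \<open>form_by_section\<close>, is the
  symmetry of \<phi>; this symmetry then brings the last term of the trilinear formula into the
  shape it has in the coboundary.\<close>

lemma section_shift:
  assumes s: "isotropic_section s" and t: "isotropic_section t"
    and \<phi>: "\<And>U V. \<lbrakk>U \<in> carrier H; V \<in> carrier H\<rbrakk> \<Longrightarrow> \<phi> U V = \<omega> (t U) (s V)"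
    and U: "U \<in> carrier H" "V \<in> carrier H" "W \<in> carrier H"
  shows "\<phi> U V = \<phi> V U"
    and "section_cocycle t U V W = section_cocycle s U V W \<oplus> F.cobd1 \<phi> U V W"
proof -
  note sD = isotropic_sectionD[OF s] and tD = isotropic_sectionD[OF t]
  have sym: "\<phi> U V = \<phi> V U" if U: "U \<in> carrier H" "V \<in> carrier H" for U V
  proof -
    have "\<omega> (t U) (t V) = \<omega> (t U) (s V) \<ominus> \<omega> (t V) (s U)"
      using form_by_section[OF s tD(2)[OF U(1)] tD(2)[OF U(2)]] by (simp only: tD(3) U)
    then have "\<omega> (t U) (s V) \<ominus> \<omega> (t V) (s U) = \<zero>" using tD(4)[OF U] by simp
    then have "\<omega> (t U) (s V) = \<omega> (t V) (s U)"
      by (rule R.eq_if_diff) (use U sD(2) tD(2) form_bil(1) in auto)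
    then show ?thesis using \<phi> U by metis
  qed
  show "\<phi> U V = \<phi> V U" by (rule sym[OF U(1,2)])
  have HD: "D U W \<in> carrier H" "D V W \<in> carrier H" "bracket H U V \<in> carrier H"
    using U by (simp_all add: D_closed H.bracket_bil)
  have cl: "section_cocycle s U V W \<in> carrier K"
    using U sD by (simp add: section_cocycle_apply form_bil bracket_bil)
  have "section_cocycle t U V W = section_cocycle s U V W \<ominus> \<phi> V (D U W) \<oplus> \<phi> U (D V W) \<ominus> \<phi> W (bracket H U V)"
    using triple_by_section[OF s, of "t U" "t V" "t W"] U HD sD tD by (simp add: section_cocycle_apply \<phi>)
  then show "section_cocycle t U V W = section_cocycle s U V W \<oplus> F.cobd1 \<phi> U V W"
    using sym[OF U(3) HD(3)] U HD sD tD cl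
    by (simp add: F.cobd1_def a_minus_def[of K] \<phi> form_bil R.a_assoc)
qed

lemma section_cocycle_class:
  assumes s: "isotropic_section s" and t: "isotropic_section t"
  shows "section_cocycle t \<in> cohomology_class K H D (section_cocycle s)"
  unfolding F.cohomology_class_iff[OF section_cocycle_cochain[OF s]]
proof (intro conjI section_cocycle_cochain[OF t] bexI ballI)
  note sD = isotropic_sectionD[OF s] and tD = isotropic_sectionD[OF t]
  let ?\<phi> = "\<lambda>U\<in>carrier H. \<lambda>V\<in>carrier H. \<omega> (t U) (s V)"
  have "(\<lambda>V. \<omega> (t U) (s V)) \<in> module_hom K H (scalar_space K)" if "U \<in> carrier H" for U
    using module_hom_comp[OF sD(1) form_homs(1)[OF tD(2)[OF that]]] .
  then show "?\<phi> \<in> lagr_cochains1 K H"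
    using section_shift(1)[OF s t, of ?\<phi>] by (auto simp: H.cochains1_iff H.functional_restrict)
  show "section_cocycle t U V W = section_cocycle s U V W \<oplus> F.cobd1 ?\<phi> U V W"
    if "U \<in> carrier H" "V \<in> carrier H" "W \<in> carrier H" for U V W
    using section_shift(2)[OF s t, of ?\<phi>] that by simp
qed

text \<open>With this, equality of classes can be improved to equality of cocycles by changing the
  section, as the construction of isomorphisms requires.\<close>

lemma section_with_cocycle:
  assumes s: "isotropic_section s" and \<beta>: "\<beta> \<in> cohomology_class K H D (section_cocycle s)"
  obtains t where "isotropic_section t" "section_cocycle t = \<beta>"
proof -
  note sD = isotropic_sectionD[OF s]
  obtain \<phi> where b: "\<beta> \<in> cochains2 K H" and \<phi>: "\<phi> \<in> lagr_cochains1 K H"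
    and eq: "\<And>U V W. \<lbrakk>U \<in> carrier H; V \<in> carrier H; W \<in> carrier H\<rbrakk> \<Longrightarrow>
      \<beta> U V W = section_cocycle s U V W \<oplus> F.cobd1 \<phi> U V W"
    using \<beta> unfolding F.cohomology_class_iff[OF section_cocycle_cochain[OF s]] by blast
  have hom1: "\<phi> U \<in> module_hom K H (scalar_space K)" if "U \<in> carrier H" for U
    using \<phi> that by (simp add: H.cochains1_iff)
  have sym: "\<phi> U V = \<phi> V U" if "U \<in> carrier H" "V \<in> carrier H" for U V
    using \<phi> that by (auto simp: H.cochains1_iff)
  have hom2: "(\<lambda>V. \<phi> V U) \<in> module_hom K H (scalar_space K)" if "U \<in> carrier H" for U
    using hom1[OF that] sym[OF that] by (subst module_hom_cong[where g="\<phi> U"]) (auto intro: H.module_axioms)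
  obtain F where F: "F \<in> module_hom K H L" "\<And>U. U \<in> carrier H \<Longrightarrow> F U \<in> \<aa>"
    and Fw: "\<And>U x. \<lbrakk>U \<in> carrier H; x \<in> carrier L\<rbrakk> \<Longrightarrow> \<omega> (F U) x = \<phi> U (p x)"
    using functional_family_represented[of H \<phi>, OF H.module_axioms hom1 hom2] by blast
  have cl: "\<phi> U V \<in> carrier K" if "U \<in> carrier H" "V \<in> carrier H" for U V
    using module_hom_in_carrier[OF hom1[OF that(1)] that(2)] by simp
  let ?t = "\<lambda>U. s U \<oplus>\<^bsub>L\<^esub> F U"
  have t: "isotropic_section ?t"
  proof (rule corrected_section[OF sD(1,3) F])
    fix U V assume U: "U \<in> carrier H" "V \<in> carrier H"
    then show "\<omega> (s U) (s V) \<oplus> \<omega> (F U) (s V) \<ominus> \<omega> (F V) (s U) = \<zero>"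
      using Fw[of U "s V"] Fw[of V "s U"] sD sym[OF U] cl by simp
  qed
  have "\<phi> U V = \<omega> (?t U) (s V)" if "U \<in> carrier H" "V \<in> carrier H" for U V
    using Fw[of U "s V"] that sD F(2) cl by (simp add: form_bil)
  then have "section_cocycle ?t = \<beta>"
    using section_shift(2)[OF s t, of \<phi>] eq
    by (intro H.cochains2_eqI[OF section_cocycle_cochain[OF t] b]) simp
  with t show ?thesis using that by blast
qed

end

text \<open>\<Phi> is the map preserving the coordinates p x and \<omega>(x, s(.)). By
  \<open>form_by_section\<close> and \<open>triple_by_section\<close> these determine \<omega>(x, y)
  and \<omega>([x, y], z), so \<Phi> is an isometry and, by nondegeneracy, compatible with the
  brackets.\<close>

lemma sympl_lagr_isoI:
  assumes "lagr_connection K L \<omega> \<aa> H p D" "lagr_connection K L' \<omega>' \<aa>' H p' D"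
    and s: "lagr_quotient.isotropic_section K L \<omega> H p s"
    and s': "lagr_quotient.isotropic_section K L' \<omega>' H p' s'"
    and eq: "lagr_quotient.section_cocycle L \<omega> H s = lagr_quotient.section_cocycle L' \<omega>' H s'"
  shows "sympl_lagr_iso K (L, \<omega>, \<aa>) (L', \<omega>', \<aa>')"
proof -
  interpret X: lagr_connection K L \<omega> \<aa> H p D by fact
  interpret Y: lagr_connection K L' \<omega>' \<aa>' H p' D by fact
  note sD = X.isotropic_sectionD[OF s] and sD' = Y.isotropic_sectionD[OF s']
  have hom1: "(\<lambda>Z. \<omega> x (s Z)) \<in> module_hom K H (scalar_space K)" if "x \<in> carrier L" for x
    using module_hom_comp[OF sD(1) X.form_homs(1)[OF that]] .
  have hom2: "(\<lambda>x. \<omega> x (s Z)) \<in> module_hom K L (scalar_space K)" if "Z \<in> carrier H" for Z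
    using X.form_homs(2)[OF sD(2)[OF that]] .
  \<comment> \<open>\<open>F x\<close> represents the functional \<omega>(x, s(.)) by an element of
    the second ideal; added to s' (p x) it gives the vector with the coordinates of
    \<open>x\<close>.\<close>
  obtain F where F: "F \<in> module_hom K L L'" "\<And>x. x \<in> carrier L \<Longrightarrow> F x \<in> \<aa>'"
    and Fw: "\<And>x y. \<lbrakk>x \<in> carrier L; y \<in> carrier L'\<rbrakk> \<Longrightarrow> \<omega>' (F x) y = \<omega> x (s (p' y))"
    using Y.functional_family_represented[of L "\<lambda>x Z. \<omega> x (s Z)", OF X.module_axioms hom1 hom2] by blast
  define \<Phi> where "\<Phi> = (\<lambda>x. s' (p x) \<oplus>\<^bsub>L'\<^esub> F x)"
  have sp: "(\<lambda>x. s' (p x)) \<in> module_hom K L L'" using module_hom_comp[OF X.p_hom sD'(1)] .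
  have c: "s' (p x) \<in> carrier L'" "F x \<in> carrier L'" if "x \<in> carrier L" for x
    using module_hom_in_carrier[OF sp that] F(2)[OF that] by auto
  have hom: "\<Phi> \<in> module_hom K L L'"
    unfolding \<Phi>_def using c by (intro module_homI)
      (simp_all add: module_hom_add[OF sp] module_hom_add[OF F(1)] module_hom_smult[OF sp]
        module_hom_smult[OF F(1)] Y.smult_r_distr Y.M.a_ac del: X.p_simps Y.p_simps)
  have cl: "\<Phi> x \<in> carrier L'" if "x \<in> carrier L" for x using module_hom_in_carrier[OF hom that] .
  have p\<Phi>: "p' (\<Phi> x) = p x" if "x \<in> carrier L" for x
    unfolding \<Phi>_def using that c sD'(3) F(2) Y.p_kernel[of "F x"] by simp
  have \<Phi>s: "\<omega>' (\<Phi> x) (s' Z) = \<omega> x (s Z)" if "x \<in> carrier L" "Z \<in> carrier H" for x Z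
    unfolding \<Phi>_def using that c sD' sD Fw[of x "s' Z"] by (simp add: Y.form_bil X.form_bil)
  have isom: "\<omega>' (\<Phi> x) (\<Phi> y) = \<omega> x y" if "x \<in> carrier L" "y \<in> carrier L" for x y
    using that X.form_by_section[OF s that] Y.form_by_section[OF s' cl[OF that(1)] cl[OF that(2)]]
    by (simp add: p\<Phi> \<Phi>s)
  have surj: "\<Phi> ` carrier L = carrier L'"
  proof
    show "carrier L' \<subseteq> \<Phi> ` carrier L"
    proof
      fix y assume y: "y \<in> carrier L'"
      \<comment> \<open>The preimage is built from the coordinates of \<open>y\<close> in the same
        way, now with the section of the first algebra.\<close>
      obtain a where a: "a \<in> \<aa>" "\<And>x. x \<in> carrier L \<Longrightarrow> \<omega> a x = \<omega>' y (s' (p x))"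
        using X.functional_represented[OF module_hom_comp[OF sD'(1) Y.form_homs(1)[OF y]]] by blast
      define x where "x = s (p' y) \<oplus>\<^bsub>L\<^esub> a"
      have x: "x \<in> carrier L" using y a sD by (simp add: x_def)
      have px: "p x = p' y" using y a sD X.p_kernel[of a] by (simp add: x_def)
      have xs: "\<omega> x (s Z) = \<omega>' y (s' Z)" if "Z \<in> carrier H" for Z
        unfolding x_def using that y a(1) a(2)[of "s Z"] sD sD' by (simp add: X.form_bil Y.form_bil)
      have "\<Phi> x = y"
      proof (rule Y.form_eqI)
        fix z assume z: "z \<in> carrier L'"
        show "\<omega>' (\<Phi> x) z = \<omega>' y z"
          using Y.form_by_section[OF s' cl[OF x] z] Y.form_by_section[OF s' y z] x y z
          by (simp add: p\<Phi> \<Phi>s xs px)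
      qed (use x y cl in auto)
      then show "y \<in> \<Phi> ` carrier L" using x by blast
    qed
  qed (use cl in auto)
  have inj: "inj_on \<Phi> (carrier L)"
  proof (rule inj_onI, rule X.form_eqI)
    fix x y z assume "x \<in> carrier L" "y \<in> carrier L" "\<Phi> x = \<Phi> y" "z \<in> carrier L"
    then show "\<omega> x z = \<omega> y z" using isom[of x z] isom[of y z] by simp
  qed
  have br: "\<Phi> (bracket L x y) = bracket L' (\<Phi> x) (\<Phi> y)" if xy: "x \<in> carrier L" "y \<in> carrier L" for x y
  proof (rule Y.form_eqI)
    fix z' assume "z' \<in> carrier L'"
    then obtain z where z: "z \<in> carrier L" "z' = \<Phi> z" using surj by blast
    have H: "D (p x) (p z) \<in> carrier H" "D (p y) (p z) \<in> carrier H" "bracket H (p x) (p y) \<in> carrier H"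
      using xy z X.D_closed X.H.bracket_bil by auto
    have "\<omega>' (\<Phi> (bracket L x y)) z' = \<omega> (bracket L x y) z"
      using isom xy z by (simp add: X.bracket_bil)
    also have "\<dots> = \<omega>' (bracket L' (\<Phi> x) (\<Phi> y)) z'"
      using X.triple_by_section[OF s xy z(1)] Y.triple_by_section[OF s' cl[OF xy(1)] cl[OF xy(2)] cl[OF z(1)]] xy z H
      by (simp add: p\<Phi> \<Phi>s eq)
    finally show "\<omega>' (\<Phi> (bracket L x y)) z' = \<omega>' (bracket L' (\<Phi> x) (\<Phi> y)) z'" .
  qed (use xy cl in \<open>auto simp: X.bracket_bil Y.bracket_bil\<close>)
  \<comment> \<open>The ideals are the kernels of \<open>p\<close> and \<open>p'\<close>, and p'
    \<circ> \<Phi> = p.\<close>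
  have "\<Phi> ` \<aa> = \<aa>'"
  proof (intro subset_antisym subsetI)
    fix y assume "y \<in> \<Phi> ` \<aa>"
    then obtain x where x: "x \<in> \<aa>" "y = \<Phi> x" by blast
    then show "y \<in> \<aa>'" using X.p_kernel[of x] Y.p_kernel[of y] cl p\<Phi> by simp
  next
    fix y assume y: "y \<in> \<aa>'"
    then have "y \<in> carrier L'" by simp
    then obtain x where x: "x \<in> carrier L" "y = \<Phi> x" using surj by blast
    then have "x \<in> \<aa>" using X.p_kernel[of x] Y.p_kernel[of y] y p\<Phi> by simp
    then show "y \<in> \<Phi> ` \<aa>" using x by blast
  qed
  then show ?thesis
    using hom inj surj br isom by (auto simp: lie_iso_def bij_betw_def)
qed

section \<open>Presentations of triples by algebras\<close>

lemma lie_algI: "fin_dim_lie_algebra K L \<Longrightarrow> lie_alg K L"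
  by (simp add: lie_alg_def)

lemma sympl_lagr_algebras_iff: "(L, \<omega>, \<aa>) \<in> sympl_lagr_algebras K \<longleftrightarrow> sympl_lagr K L \<omega> \<aa>"
  by (auto simp: sympl_lagr_algebras_def sympl_lagr_def sympl_lagr_axioms_def lie_alg_def)

lemma flat_triples_iff:
  "(H, D, c) \<in> flat_triples K \<longleftrightarrow>
    flat_lie_alg K H D \<and> (\<exists>\<alpha>\<in>lagr_cocycles2 K H D. c = cohomology_class K H D \<alpha>)"
  by (auto simp: flat_triples_def flat_lie_alg_def flat_lie_alg_axioms_def lie_alg_def lagr_cohomology2_def)

text \<open>
  A form of ``\<open>T\<close> is isomorphic to the extension triple of \<open>X\<close>'' that mentions no cosets and is
  transported along isomorphisms on both sides by composing \<open>p\<close> and \<open>s\<close> with them.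
\<close>

fun presents :: "('k, 'm) ring_scheme \<Rightarrow> ('k, 'v) sympl_lagr \<Rightarrow> ('k, 'w) flat_triple \<Rightarrow> bool" where
  "presents K (L, \<omega>, \<aa>) (H, D, c) \<longleftrightarrow> (\<exists>p s. lagr_connection K L \<omega> \<aa> H p D \<and>
     lagr_quotient.isotropic_section K L \<omega> H p s \<and>
     c = cohomology_class K H D (lagr_quotient.section_cocycle L \<omega> H s))"

lemma presents_in_sets:
  assumes "presents K X T"
  shows "X \<in> sympl_lagr_algebras K" "T \<in> flat_triples K"
proof -
  obtain L \<omega> \<aa> H D c where XT: "X = (L, \<omega>, \<aa>)" "T = (H, D, c)" by (cases X, cases T)
  then obtain p s where "lagr_connection K L \<omega> \<aa> H p D"
    and s: "lagr_quotient.isotropic_section K L \<omega> H p s"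
    and c: "c = cohomology_class K H D (lagr_quotient.section_cocycle L \<omega> H s)"
    using assms by auto
  then interpret lagr_connection K L \<omega> \<aa> H p D by simp
  show "X \<in> sympl_lagr_algebras K"
    unfolding XT sympl_lagr_algebras_iff by (rule sympl_lagr_axioms)
  show "T \<in> flat_triples K"
    unfolding XT flat_triples_iff using section_cocycle_cocycle[OF s] c F.flat_lie_alg_axioms by blast
qed

text \<open>Equal classes place the cocycle of \<open>s'\<close> in the class of that of
  \<open>s\<close>, so the first algebra has another section with exactly this cocycle.\<close>

lemma presents_same_triple:
  assumes "presents K X T" "presents K Y T"
  shows "sympl_lagr_iso K X Y"
proof -
  obtain L \<omega> \<aa> L' \<omega>' \<aa>' H D c where XT: "X = (L, \<omega>, \<aa>)" "Y = (L', \<omega>', \<aa>')" "T = (H, D, c)"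
    by (cases X, cases Y, cases T)
  obtain p s where 1: "lagr_connection K L \<omega> \<aa> H p D"
    and s: "lagr_quotient.isotropic_section K L \<omega> H p s"
    and c: "c = cohomology_class K H D (lagr_quotient.section_cocycle L \<omega> H s)"
    using assms(1) XT by auto
  obtain p' s' where 2: "lagr_connection K L' \<omega>' \<aa>' H p' D"
    and s': "lagr_quotient.isotropic_section K L' \<omega>' H p' s'"
    and c': "c = cohomology_class K H D (lagr_quotient.section_cocycle L' \<omega>' H s')"
    using assms(2) XT by auto
  interpret X: lagr_connection K L \<omega> \<aa> H p D by (rule 1)
  interpret Y: lagr_connection K L' \<omega>' \<aa>' H p' D by (rule 2)
  have "Y.section_cocycle s' \<in> cohomology_class K H D (X.section_cocycle s)"
    using X.F.cohomology_class_self[OF Y.section_cocycle_cochain[OF s']] c c' by simp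
  then obtain t where t: "X.isotropic_section t" "X.section_cocycle t = Y.section_cocycle s'"
    using X.section_with_cocycle[OF s] by blast
  show ?thesis unfolding XT by (rule sympl_lagr_isoI[OF 1 2 t(1) s' t(2)])
qed

text \<open>The map f = p' \<circ> s satisfies f \<circ> p = p', because both projections have
  kernel \<aa>; this yields compatibility with brackets and connections. The section s' \<circ> f of
  \<open>p\<close> has the pullback of the cocycle of s' as its cocycle, and all isotropic sections
  give the same class.\<close>

lemma presented_triples_iso:
  assumes "presents K X T" "presents K X T'"
  shows "flat_triple_iso K T T'"
proof -
  obtain L \<omega> \<aa> H D c H' D' c' where XT: "X = (L, \<omega>, \<aa>)" "T = (H, D, c)" "T' = (H', D', c')"
    by (cases X, cases T, cases T')
  obtain p s where 1: "lagr_connection K L \<omega> \<aa> H p D"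
    and s: "lagr_quotient.isotropic_section K L \<omega> H p s"
    and c: "c = cohomology_class K H D (lagr_quotient.section_cocycle L \<omega> H s)"
    using assms(1) XT by auto
  obtain p' s' where 2: "lagr_connection K L \<omega> \<aa> H' p' D'"
    and s': "lagr_quotient.isotropic_section K L \<omega> H' p' s'"
    and c': "c' = cohomology_class K H' D' (lagr_quotient.section_cocycle L \<omega> H' s')"
    using assms(2) XT by auto
  interpret X: lagr_connection K L \<omega> \<aa> H p D by (rule 1)
  interpret Y: lagr_connection K L \<omega> \<aa> H' p' D' by (rule 2)
  note sD = X.isotropic_sectionD[OF s] and sD' = Y.isotropic_sectionD[OF s']
  define f where "f = (\<lambda>U. p' (s U))"
  have fp: "f (p x) = p' x" if x: "x \<in> carrier L" for x
    unfolding f_def using x sD X.form_p_cong(1)[of "s (p x)" x] by (intro Y.p_eqI) auto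
  have f: "f \<in> module_hom K H H'" unfolding f_def by (rule module_hom_comp[OF sD(1) Y.p_hom])
  have "inj_on f (carrier H)"
  proof (rule inj_onI)
    fix U V assume U: "U \<in> carrier H" "V \<in> carrier H" "f U = f V"
    have "p (s U) = p (s V)"
      using U sD Y.form_p_cong(1)[of "s U" "s V"] by (intro X.p_eqI) (auto simp: f_def)
    then show "U = V" using U sD by simp
  qed
  moreover have "f ` carrier H = carrier H'"
  proof -
    have "f ` p ` carrier L = p' ` carrier L" unfolding image_image using fp by (rule image_cong[OF refl])
    then show ?thesis by (simp only: X.p_surj Y.p_surj)
  qed
  ultimately have bij: "bij_betw f (carrier H) (carrier H')" by (simp add: bij_betw_def)
  have br: "f (bracket H U V) = bracket H' (f U) (f V)" if UV: "U \<in> carrier H" "V \<in> carrier H" for U V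
  proof -
    obtain u v where "u \<in> carrier L" "p u = U" "v \<in> carrier L" "p v = V"
      using X.lift[OF UV(1)] X.lift[OF UV(2)] by metis
    then show ?thesis using fp[of "bracket L u v"] fp[of u] fp[of v]
      by (simp add: X.p_bracket Y.p_bracket X.bracket_bil)
  qed
  have iso: "lie_iso K H H' f" using f bij br by (simp add: lie_iso_def)
  have conn: "f (D U V) = D' (f U) (f V)" if UV: "U \<in> carrier H" "V \<in> carrier H" for U V
  proof -
    obtain u v where u: "u \<in> carrier L" "p u = U" "v \<in> carrier L" "p v = V"
      using X.lift[OF UV(1)] X.lift[OF UV(2)] by metis
    obtain w where w: "w \<in> carrier L" "p w = D U V" by (rule X.lift[OF X.D_closed[OF UV]])
    have "D' (p' u) (p' v) = p' w"
      using u w X.D_lift[of u v w] by (intro Y.D_eqI) auto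
    then show ?thesis using fp u w by metis
  qed
  have fc: "f U \<in> carrier H'" if "U \<in> carrier H" for U using module_hom_in_carrier[OF f that] .
  have sf: "X.isotropic_section (\<lambda>U. s' (f U))"
    unfolding X.isotropic_section_def
  proof (intro conjI ballI)
    show "(\<lambda>U. s' (f U)) \<in> module_hom K H L" by (rule module_hom_comp[OF f sD'(1)])
    fix U assume U: "U \<in> carrier H"
    have "f (p (s' (f U))) = f U" using fp[of "s' (f U)"] sD' fc[OF U] by simp
    then show "p (s' (f U)) = U" using bij U sD'(2)[OF fc[OF U]] by (auto simp: bij_betw_def inj_on_def)
    fix V assume "V \<in> carrier H"
    then show "\<omega> (s' (f U)) (s' (f V)) = \<zero>\<^bsub>K\<^esub>" using sD' fc U by simp
  qed
  have "pullback2 H f (Y.section_cocycle s') = X.section_cocycle (\<lambda>U. s' (f U))"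
    using fc by (simp add: pullback2_def X.section_cocycle_def Y.section_cocycle_def cong: restrict_cong)
  then have "pullback2 H f ` c' = cohomology_class K H D (X.section_cocycle (\<lambda>U. s' (f U)))"
    unfolding c' by (subst pullback2_class_image[OF X.F.flat_lie_alg_axioms Y.F.flat_lie_alg_axioms iso _
        Y.section_cocycle_cochain[OF s']]) (simp_all add: conn)
  also have "\<dots> = c"
    unfolding c
      by (rule X.F.cohomology_class_eqI[OF X.section_cocycle_cochain[OF s] X.section_cocycle_class[OF s sf]])
  finally show ?thesis unfolding XT using iso conn by auto
qed

section \<open>Transport of presentations along isomorphisms\<close>

lemma lagr_connection_change_base:
  assumes "lagr_connection K L \<omega> \<aa> H p D" and s: "lagr_quotient.isotropic_section K L \<omega> H p s"
    and "lie_alg K M" and iso: "lie_iso K H M f"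
    and conn: "\<And>U V. \<lbrakk>U \<in> carrier H; V \<in> carrier H\<rbrakk> \<Longrightarrow> f (D U V) = E (f U) (f V)"
  defines "t \<equiv> \<lambda>U. s (inv_into (carrier H) f U)"
  shows "lagr_connection K L \<omega> \<aa> M (\<lambda>x. f (p x)) E"
    and "lagr_quotient.isotropic_section K L \<omega> M (\<lambda>x. f (p x)) t"
    and "lagr_quotient.section_cocycle L \<omega> M t =
      pullback2 M (inv_into (carrier H) f) (lagr_quotient.section_cocycle L \<omega> H s)"
proof -
  interpret X: lagr_connection K L \<omega> \<aa> H p D by fact
  interpret M: lie_alg K M by fact
  note sD = X.isotropic_sectionD[OF s]
  have f: "f \<in> module_hom K H M" and bij: "bij_betw f (carrier H) (carrier M)"
    and br: "\<And>U V. \<lbrakk>U \<in> carrier H; V \<in> carrier H\<rbrakk> \<Longrightarrow> f (bracket H U V) = bracket M (f U) (f V)"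
    using iso by (auto simp: lie_iso_def)
  let ?g = "inv_into (carrier H) f"
  have g: "?g \<in> module_hom K M H"
    using lie_iso_inverse[OF X.H.lie_alg_axioms iso] by (simp add: lie_iso_def)
  note gc = module_hom_in_carrier[OF g] and fc = module_hom_in_carrier[OF f]
  have fg: "f (?g x) = x" if "x \<in> carrier M" for x using bij_betw_inv_into_right[OF bij that] .
  have gf: "?g (f x) = x" if "x \<in> carrier H" for x using bij_betw_inv_into_left[OF bij that] .
  interpret f: linear_map K H M f
    by (intro linear_mapI X.H.vectorspace_axioms M.vectorspace_axioms f)
  have "lagr_quotient K L \<omega> \<aa> M (\<lambda>x. f (p x))"
  proof (intro lagr_quotient.intro lagr_quotient_axioms.intro X.sympl_lagr_axioms M.lie_alg_axioms)
    show "(\<lambda>x. f (p x)) \<in> module_hom K L M" by (rule module_hom_comp[OF X.p_hom f])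
    show "(\<lambda>x. f (p x)) ` carrier L = carrier M"
      using bij_betw_imp_surj_on[OF bij] unfolding X.p_surj[symmetric] image_image .
    fix x assume x: "x \<in> carrier L"
    have "f (p x) = \<zero>\<^bsub>M\<^esub> \<longleftrightarrow> p x = \<zero>\<^bsub>H\<^esub>"
    proof
      assume "f (p x) = \<zero>\<^bsub>M\<^esub>"
      then have "?g (f (p x)) = ?g (f \<zero>\<^bsub>H\<^esub>)" by simp
      then show "p x = \<zero>\<^bsub>H\<^esub>" using x gf[of "p x"] gf[of "\<zero>\<^bsub>H\<^esub>"] by simp
    qed simp
    then show "f (p x) = \<zero>\<^bsub>M\<^esub> \<longleftrightarrow> x \<in> \<aa>" using X.p_kernel[OF x] by simp
    show "f (p (bracket L x y)) = bracket M (f (p x)) (f (p y))" if "y \<in> carrier L" for y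
      using br x that by (simp add: X.p_bracket)
  qed
  then interpret Y: lagr_quotient K L \<omega> \<aa> M "\<lambda>x. f (p x)" .
  have E: "E U V = f (D (?g U) (?g V))" if "U \<in> carrier M" "V \<in> carrier M" for U V
    using conn[of "?g U" "?g V"] that gc fg by simp
  show "lagr_connection K L \<omega> \<aa> M (\<lambda>x. f (p x)) E"
  proof (intro lagr_connection.intro lagr_connection_axioms.intro Y.lagr_quotient_axioms)
    show "E U V \<in> carrier M" if "U \<in> carrier M" "V \<in> carrier M" for U V
      using that gc fc X.D_closed by (simp add: E)
    fix u v w b assume *: "u \<in> carrier L" "v \<in> carrier L" "w \<in> carrier L" "f (p w) = E (f (p u)) (f (p v))" "b \<in> \<aa>"
    have c: "p u \<in> carrier H" "p v \<in> carrier H" "p w \<in> carrier H" using * by simp_all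
    have "f (p w) = f (D (p u) (p v))" using *(4) conn[OF c(1,2)] by (simp only:)
    then have "?g (f (p w)) = ?g (f (D (p u) (p v)))" by (rule arg_cong)
    then have "p w = D (p u) (p v)" by (simp only: gf c X.D_closed)
    then show "\<omega> w b = \<ominus>\<^bsub>K\<^esub> \<omega> v (bracket L u b)" by (rule X.D_lift[OF *(1-3) _ *(5)])
  qed
  show "Y.isotropic_section t"
    unfolding Y.isotropic_section_def t_def
  proof (intro conjI ballI)
    show "(\<lambda>U. s (?g U)) \<in> module_hom K M L" by (rule module_hom_comp[OF g sD(1)])
  qed (use gc sD fg in auto)
  show "Y.section_cocycle t = pullback2 M ?g (X.section_cocycle s)"
    using gc by (simp add: pullback2_def X.section_cocycle_def Y.section_cocycle_def t_def cong: restrict_cong)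
qed

lemma presents_iso_triple:
  assumes "presents K X T" "flat_triple_iso K T T'" "T' \<in> flat_triples K"
  shows "presents K X T'"
proof -
  obtain L \<omega> \<aa> H D c H' D' c' where XT: "X = (L, \<omega>, \<aa>)" "T = (H, D, c)" "T' = (H', D', c')"
    by (cases X, cases T, cases T')
  obtain p s where 1: "lagr_connection K L \<omega> \<aa> H p D"
    and s: "lagr_quotient.isotropic_section K L \<omega> H p s"
    and c: "c = cohomology_class K H D (lagr_quotient.section_cocycle L \<omega> H s)"
    using assms(1) XT by auto
  interpret X: lagr_connection K L \<omega> \<aa> H p D by (rule 1)
  obtain f where iso: "lie_iso K H H' f"
    and conn: "\<And>U V. \<lbrakk>U \<in> carrier H; V \<in> carrier H\<rbrakk> \<Longrightarrow> f (D U V) = D' (f U) (f V)"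
    and fc: "pullback2 H f ` c' = c"
    using assms(2) XT by auto
  obtain \<alpha> where flat: "flat_lie_alg K H' D'" and \<alpha>: "\<alpha> \<in> lagr_cocycles2 K H' D'" "c' = cohomology_class K H' D' \<alpha>"
    using assms(3) unfolding XT flat_triples_iff by blast
  interpret M: flat_lie_alg K H' D' by (rule flat)
  have \<alpha>c: "\<alpha> \<in> cochains2 K H'" using \<alpha>(1) by (simp add: M.lagr_cocycles2_iff)
  let ?g = "inv_into (carrier H) f"
  note la = X.H.lie_alg_axioms M.lie_alg_axioms
  have isog: "lie_iso K H' H ?g" by (rule lie_iso_inverse[OF la(1) iso])
  have f: "f \<in> module_hom K H H'" and bij: "bij_betw f (carrier H) (carrier H')"
    and g: "?g \<in> module_hom K H' H" using iso isog by (auto simp: lie_iso_def)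
  have fg: "f (?g x) = x" if "x \<in> carrier H'" for x using bij_betw_inv_into_right[OF bij that] .
  have gf: "?g (f x) = x" if "x \<in> carrier H" for x using bij_betw_inv_into_left[OF bij that] .
  have conng: "?g (D' x y) = D (?g x) (?g y)" if "x \<in> carrier H'" "y \<in> carrier H'" for x y
    using conn[of "?g x" "?g y"] gf[of "D (?g x) (?g y)"] X.D_closed[of "?g x" "?g y"] that
      module_hom_in_carrier[OF g] fg by simp
  have base1: "lagr_connection K L \<omega> \<aa> H' (\<lambda>x. f (p x)) D'"
    by (rule lagr_connection_change_base(1)[OF 1 s la(2) iso]) (rule conn)
  have base2: "lagr_quotient.isotropic_section K L \<omega> H' (\<lambda>x. f (p x)) (\<lambda>U. s (?g U))"
    by (rule lagr_connection_change_base(2)[OF 1 s la(2) iso]) (rule conn)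
  have base3: "lagr_quotient.section_cocycle L \<omega> H' (\<lambda>U. s (?g U)) = pullback2 H' ?g (X.section_cocycle s)"
    by (rule lagr_connection_change_base(3)[OF 1 s la(2) iso]) (rule conn)
  \<comment> \<open>The hypothesis expresses the class of \<open>T\<close> as a pullback of the
    class of \<open>T'\<close>; pulling back along the inverse turns this around.\<close>
  have "pullback2 H' ?g ` c = c'"
  proof -
    have "pullback2 H' ?g (pullback2 H f \<beta>) = \<beta>" if "\<beta> \<in> c'" for \<beta>
    proof (rule pullback2_inverse[OF la(2,1) g f])
      show "\<beta> \<in> cochains2 K H'" using that \<alpha>(2) M.cohomology_class_iff[OF \<alpha>c] by blast
    qed (rule fg)
    then show ?thesis unfolding fc[symmetric] image_image by simp
  qed
  moreover have "pullback2 H' ?g ` c = cohomology_class K H' D' (pullback2 H' ?g (X.section_cocycle s))"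
    unfolding c
      by (rule pullback2_class_image[OF flat X.F.flat_lie_alg_axioms isog _ X.section_cocycle_cochain[OF s]])
      (rule conng)
  ultimately have "c' = cohomology_class K H' D' (lagr_quotient.section_cocycle L \<omega> H' (\<lambda>U. s (?g U)))"
    using base3 by simp
  then show ?thesis unfolding XT presents.simps
    by (intro exI[of _ "\<lambda>x. f (p x)"] exI[of _ "\<lambda>U. s (?g U)"] conjI base1 base2)
qed

lemma sympl_lagr_image:
  assumes "sympl_lagr K L \<omega> \<aa>" "lie_alg K M" and iso: "lie_iso K L M \<Phi>"
    and form: "\<And>x y. \<lbrakk>x \<in> carrier L; y \<in> carrier L\<rbrakk> \<Longrightarrow> \<omega>' (\<Phi> x) (\<Phi> y) = \<omega> x y"
  shows "sympl_lagr K M \<omega>' (\<Phi> ` \<aa>)"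
proof -
  interpret X: sympl_lagr K L \<omega> \<aa> by fact
  interpret M: lie_alg K M by fact
  have \<Phi>: "\<Phi> \<in> module_hom K L M" and bij: "bij_betw \<Phi> (carrier L) (carrier M)"
    and br: "\<And>x y. \<lbrakk>x \<in> carrier L; y \<in> carrier L\<rbrakk> \<Longrightarrow> bracket M (\<Phi> x) (\<Phi> y) = \<Phi> (bracket L x y)"
    using iso by (auto simp: lie_iso_def)
  interpret \<Phi>: linear_map K L M \<Phi>
    by (intro linear_mapI X.vectorspace_axioms M.vectorspace_axioms \<Phi>)
  have surj: "carrier M = \<Phi> ` carrier L" using bij by (simp add: bij_betw_def)
  note simps = \<Phi>.f_add[symmetric] \<Phi>.f_smult[symmetric] br form X.bracket_bil(1) X.form_bil
  show ?thesis
  proof (intro sympl_lagr.intro sympl_lagr_axioms.intro M.lie_alg_axioms)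
    have "bilinear_map K M M (scalar_space K) \<omega>'"
      unfolding surj
      by (rule bilinear_mapI) (auto simp: surj simps simp del: \<Phi>.f_add \<Phi>.f_smult)
    moreover have "u = \<zero>\<^bsub>M\<^esub>" if u: "u \<in> carrier M" and 0: "\<And>v. v \<in> carrier M \<Longrightarrow> \<omega>' u v = \<zero>\<^bsub>K\<^esub>" for u
    proof -
      obtain x where x: "x \<in> carrier L" "u = \<Phi> x" using u surj by blast
      have "x = \<zero>\<^bsub>L\<^esub>"
      proof (rule X.nondegenerate[OF x(1)])
        show "\<omega> x v = \<zero>\<^bsub>K\<^esub>" if "v \<in> carrier L" for v
          using 0[of "\<Phi> v"] form[OF x(1) that] x that by simp
      qed
      then show ?thesis using x by simp
    qed
    moreover have "\<omega>' (bracket M u v) w \<oplus>\<^bsub>K\<^esub> \<omega>' (bracket M w u) v \<oplus>\<^bsub>K\<^esub> \<omega>' (bracket M v w) u = \<zero>\<^bsub>K\<^esub>"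
      if "u \<in> carrier M" "v \<in> carrier M" "w \<in> carrier M" for u v w
      using that X.form_closed by (auto simp: surj br form X.bracket_bil)
    moreover have "\<omega>' u u = \<zero>\<^bsub>K\<^esub>" if "u \<in> carrier M" for u using that by (auto simp: surj form)
    ultimately show "symplectic_form K M \<omega>'" by (simp add: symplectic_form_def)
    have "LinearCombinations.submodule K (\<Phi> ` \<aa>) M"
    proof (rule submodule.intro[OF M.module_axioms])
      show "\<zero>\<^bsub>M\<^esub> \<in> \<Phi> ` \<aa>" by (metis X.ideal_zero \<Phi>.f0_is_0 imageI)
      show "v \<oplus>\<^bsub>M\<^esub> w \<in> \<Phi> ` \<aa>" if "v \<in> \<Phi> ` \<aa>" "w \<in> \<Phi> ` \<aa>" for v w
        using that by (auto simp: \<Phi>.f_add[symmetric] simp del: \<Phi>.f_add intro!: imageI)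
      show "c \<odot>\<^bsub>M\<^esub> v \<in> \<Phi> ` \<aa>" if "c \<in> carrier K" "v \<in> \<Phi> ` \<aa>" for c v
        using that submodule.smult_closed[OF X.ideal_subspace]
        by (auto simp: \<Phi>.f_smult[symmetric] simp del: \<Phi>.f_smult intro!: imageI)
    qed auto
    then show "lie_ideal K M (\<Phi> ` \<aa>)"
      by (auto simp: lie_ideal_def subspace_def M.vectorspace_axioms surj br intro!: imageI)
    show "orthogonal K M \<omega>' (\<Phi> ` \<aa>) = \<Phi> ` \<aa>"
    proof (intro subset_antisym subsetI)
      fix y assume "y \<in> orthogonal K M \<omega>' (\<Phi> ` \<aa>)"
      then obtain x where x: "x \<in> carrier L" "y = \<Phi> x" "\<And>b. b \<in> \<aa> \<Longrightarrow> \<omega>' y (\<Phi> b) = \<zero>\<^bsub>K\<^esub>"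
        by (auto simp: orthogonal_def surj)
      then have "x \<in> \<aa>" using form by (intro X.ideal_memI) auto
      then show "y \<in> \<Phi> ` \<aa>" using x by blast
    qed (auto simp: orthogonal_def form)
  qed
qed

text \<open>Composing the projection with the inverse of \<Phi> and the section with \<Phi> leaves
  the cocycle unchanged, so the new algebra presents literally the same triple.\<close>

lemma presents_iso_algebra:
  assumes "presents K X T" "sympl_lagr_iso K X Y" "Y \<in> sympl_lagr_algebras K"
  shows "presents K Y T"
proof -
  obtain L \<omega> \<aa> L' \<omega>' \<aa>' H D c where XT: "X = (L, \<omega>, \<aa>)" "Y = (L', \<omega>', \<aa>')" "T = (H, D, c)"
    by (cases X, cases Y, cases T)
  obtain p s where 1: "lagr_connection K L \<omega> \<aa> H p D"
    and s: "lagr_quotient.isotropic_section K L \<omega> H p s"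
    and c: "c = cohomology_class K H D (lagr_quotient.section_cocycle L \<omega> H s)"
    using assms(1) XT by auto
  interpret X: lagr_connection K L \<omega> \<aa> H p D by (rule 1)
  interpret Y: sympl_lagr K L' \<omega>' \<aa>' using assms(3) unfolding XT sympl_lagr_algebras_iff .
  obtain \<Phi> where iso: "lie_iso K L L' \<Phi>"
    and form: "\<And>x y. \<lbrakk>x \<in> carrier L; y \<in> carrier L\<rbrakk> \<Longrightarrow> \<omega>' (\<Phi> x) (\<Phi> y) = \<omega> x y"
    and im: "\<Phi> ` \<aa> = \<aa>'"
    using assms(2) XT by auto
  let ?g = "inv_into (carrier L) \<Phi>"
  have isog: "lie_iso K L' L ?g" by (rule lie_iso_inverse[OF X.lie_alg_axioms iso])
  have \<Phi>: "\<Phi> \<in> module_hom K L L'" and bij: "bij_betw \<Phi> (carrier L) (carrier L')"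
    and br: "\<And>x y. \<lbrakk>x \<in> carrier L; y \<in> carrier L\<rbrakk> \<Longrightarrow> \<Phi> (bracket L x y) = bracket L' (\<Phi> x) (\<Phi> y)"
    and g: "?g \<in> module_hom K L' L" and bijg: "bij_betw ?g (carrier L') (carrier L)"
    and brg: "\<And>x y. \<lbrakk>x \<in> carrier L'; y \<in> carrier L'\<rbrakk> \<Longrightarrow> ?g (bracket L' x y) = bracket L (?g x) (?g y)"
    using iso isog by (auto simp: lie_iso_def)
  have fg: "\<Phi> (?g x) = x" if "x \<in> carrier L'" for x using bij_betw_inv_into_right[OF bij that] .
  have gf: "?g (\<Phi> x) = x" if "x \<in> carrier L" for x using bij_betw_inv_into_left[OF bij that] .
  note gc = module_hom_in_carrier[OF g] and fc = module_hom_in_carrier[OF \<Phi>]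
  have formg: "\<omega> (?g x) (?g y) = \<omega>' x y" if "x \<in> carrier L'" "y \<in> carrier L'" for x y
    using form[of "?g x" "?g y"] that gc fg by simp
  have img: "?g x \<in> \<aa> \<longleftrightarrow> x \<in> \<aa>'" if "x \<in> carrier L'" for x
  proof
    assume "?g x \<in> \<aa>"
    then show "x \<in> \<aa>'" unfolding im[symmetric] by (rule rev_image_eqI) (simp add: fg[OF that])
  next
    assume "x \<in> \<aa>'"
    then obtain a where "a \<in> \<aa>" "x = \<Phi> a" unfolding im[symmetric] by blast
    then show "?g x \<in> \<aa>" using gf[of a] by simp
  qed
  have "lagr_quotient K L' \<omega>' \<aa>' H (\<lambda>x. p (?g x))"
  proof (intro lagr_quotient.intro lagr_quotient_axioms.intro Y.sympl_lagr_axioms X.H.lie_alg_axioms)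
    show "(\<lambda>x. p (?g x)) \<in> module_hom K L' H" by (rule module_hom_comp[OF g X.p_hom])
    show "(\<lambda>x. p (?g x)) ` carrier L' = carrier H"
    proof -
      have "p ` ?g ` carrier L' = carrier H" by (simp only: bij_betw_imp_surj_on[OF bijg] X.p_surj)
      then show ?thesis unfolding image_image .
    qed
  qed (simp_all add: gc X.p_kernel img brg X.p_bracket)
  then interpret Q: lagr_quotient K L' \<omega>' \<aa>' H "\<lambda>x. p (?g x)" .
  have "lagr_connection K L' \<omega>' \<aa>' H (\<lambda>x. p (?g x)) D"
  proof (intro lagr_connection.intro lagr_connection_axioms.intro Q.lagr_quotient_axioms X.D_closed)
    fix u v w b assume *: "u \<in> carrier L'" "v \<in> carrier L'" "w \<in> carrier L'"
      "p (?g w) = D (p (?g u)) (p (?g v))" "b \<in> \<aa>'"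
    then have "\<omega> (?g w) (?g b) = \<ominus>\<^bsub>K\<^esub> \<omega> (?g v) (bracket L (?g u) (?g b))"
      using gc img by (intro X.D_lift) auto
    then show "\<omega>' w b = \<ominus>\<^bsub>K\<^esub> \<omega>' v (bracket L' u b)"
      using * formg brg[symmetric] by (simp add: Y.bracket_bil)
  qed
  moreover have "Q.isotropic_section (\<lambda>U. \<Phi> (s U))"
    unfolding Q.isotropic_section_def
  proof (intro conjI)
    show "(\<lambda>U. \<Phi> (s U)) \<in> module_hom K H L'"
      by (rule module_hom_comp[OF X.isotropic_sectionD(1)[OF s] \<Phi>])
  qed (use X.isotropic_sectionD[OF s] gf form in auto)
  moreover have "Q.section_cocycle (\<lambda>U. \<Phi> (s U)) = X.section_cocycle s"
    unfolding Q.section_cocycle_def X.section_cocycle_def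
    using X.isotropic_sectionD(2)[OF s] form br[symmetric]
    by (intro restrict_ext) (simp add: X.bracket_bil cong: restrict_cong)
  ultimately show ?thesis unfolding XT presents.simps c
    by (intro exI[of _ "\<lambda>x. p (?g x)"] exI[of _ "\<lambda>U. \<Phi> (s U)"]) simp
qed

text \<open>Transport of structure along an injection, used to move the model into the type of the
  algebras and quotients into the type of the triples.\<close>

definition image_lie :: "('k, 'v) lie_algebra \<Rightarrow> ('v \<Rightarrow> 'w) \<Rightarrow> ('k, 'w) lie_algebra" where
  "image_lie L j = (let g = inv_into (carrier L) j in
    \<lparr>carrier = j ` carrier L, mult = undefined, one = undefined,
     zero = j \<zero>\<^bsub>L\<^esub>, add = (\<lambda>x y. j (g x \<oplus>\<^bsub>L\<^esub> g y)), smult = (\<lambda>r x. j (r \<odot>\<^bsub>L\<^esub> g x)),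
     bracket = (\<lambda>x y. j (bracket L (g x) (g y)))\<rparr>)"

lemma image_lie_iso:
  assumes "lie_alg K L" and j: "inj_on j (carrier L)"
  shows "lie_alg K (image_lie L j)" "lie_iso K L (image_lie L j) j"
proof -
  interpret L: lie_alg K L by fact
  have hom: "j \<in> module_hom K L (image_lie L j)"
    using j by (intro module_homI) (simp_all add: image_lie_def Let_def)
  have br: "j (bracket L x y) = bracket (image_lie L j) (j x) (j y)" if "x \<in> carrier L" "y \<in> carrier L"
    for x y
    using j that by (simp add: image_lie_def Let_def)
  show "lie_alg K (image_lie L j)"
    by (rule lie_algI, rule fin_dim_lie_algebra_hom_image[OF L.fin_dim_lie_algebra_axioms hom _ _ br])
      (simp_all add: image_lie_def Let_def)
  show "lie_iso K L (image_lie L j) j"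
    using hom br j by (simp add: lie_iso_def bij_betw_def) (simp add: image_lie_def Let_def)
qed

section \<open>The extension triple\<close>

context sympl_lagr
begin

lemma coset_eq:
  assumes x: "x \<in> carrier L"
  shows "\<aa> +>\<^bsub>L\<^esub> x = {y \<in> carrier L. y \<ominus>\<^bsub>L\<^esub> x \<in> \<aa>}"
proof (intro subset_antisym subsetI)
  fix y assume "y \<in> \<aa> +>\<^bsub>L\<^esub> x"
  then obtain a where a: "a \<in> \<aa>" "y = a \<oplus>\<^bsub>L\<^esub> x" unfolding a_r_coset_def' by blast
  have "a \<oplus>\<^bsub>L\<^esub> x \<ominus>\<^bsub>L\<^esub> x = a" using a x by (simp add: a_minus_def[of L] M.a_assoc M.r_neg)
  then show "y \<in> {y \<in> carrier L. y \<ominus>\<^bsub>L\<^esub> x \<in> \<aa>}" using a x by simp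
next
  fix y assume "y \<in> {y \<in> carrier L. y \<ominus>\<^bsub>L\<^esub> x \<in> \<aa>}"
  then have y: "y \<in> carrier L" "y \<ominus>\<^bsub>L\<^esub> x \<in> \<aa>" by auto
  have "y = (y \<ominus>\<^bsub>L\<^esub> x) \<oplus>\<^bsub>L\<^esub> x" using x y(1) by (simp add: a_minus_def[of L] M.a_assoc M.l_neg)
  then show "y \<in> \<aa> +>\<^bsub>L\<^esub> x" using y(2) unfolding a_r_coset_def' by blast
qed

lemma coset_self: "x \<in> carrier L \<Longrightarrow> x \<in> \<aa> +>\<^bsub>L\<^esub> x"
proof -
  assume x: "x \<in> carrier L"
  then have eq: "x \<ominus>\<^bsub>L\<^esub> x = \<zero>\<^bsub>L\<^esub>" by simp
  show ?thesis using x by (simp add: coset_eq eq)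
qed

lemma coset_eq_iff:
  assumes "x \<in> carrier L" "y \<in> carrier L"
  shows "\<aa> +>\<^bsub>L\<^esub> x = \<aa> +>\<^bsub>L\<^esub> y \<longleftrightarrow> x \<ominus>\<^bsub>L\<^esub> y \<in> \<aa>"
proof
  assume "\<aa> +>\<^bsub>L\<^esub> x = \<aa> +>\<^bsub>L\<^esub> y"
  then show "x \<ominus>\<^bsub>L\<^esub> y \<in> \<aa>" using coset_self[OF assms(1)] coset_eq[OF assms(2)] by auto
next
  assume d: "x \<ominus>\<^bsub>L\<^esub> y \<in> \<aa>"
  have "z \<ominus>\<^bsub>L\<^esub> x \<in> \<aa> \<longleftrightarrow> z \<ominus>\<^bsub>L\<^esub> y \<in> \<aa>" if z: "z \<in> carrier L" for z
  proof
    \<comment> \<open>Pairing with an arbitrary vector moves this identity into the field.\<close>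
    have tri: "z \<ominus>\<^bsub>L\<^esub> y = (z \<ominus>\<^bsub>L\<^esub> x) \<oplus>\<^bsub>L\<^esub> (x \<ominus>\<^bsub>L\<^esub> y)"
      if "x \<in> carrier L" "y \<in> carrier L" for x y
      using that z
        by (intro form_eqI) (simp_all add: form_bil form_diff a_minus_def[of K] R.a_assoc R.r_neg1)
    have "y \<ominus>\<^bsub>L\<^esub> x = \<ominus>\<^bsub>L\<^esub> (x \<ominus>\<^bsub>L\<^esub> y)"
      using assms by (simp add: a_minus_def[of L] M.minus_add M.a_comm)
    then have d': "y \<ominus>\<^bsub>L\<^esub> x \<in> \<aa>" using d by simp
    note 1 = tri[OF assms] and 2 = tri[OF assms(2,1)]
    show "z \<ominus>\<^bsub>L\<^esub> y \<in> \<aa>" if "z \<ominus>\<^bsub>L\<^esub> x \<in> \<aa>" unfolding 1 using that d by simp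
    show "z \<ominus>\<^bsub>L\<^esub> x \<in> \<aa>" if "z \<ominus>\<^bsub>L\<^esub> y \<in> \<aa>" unfolding 2 using that d' by simp
  qed
  then show "\<aa> +>\<^bsub>L\<^esub> x = \<aa> +>\<^bsub>L\<^esub> y" using assms by (auto simp: coset_eq)
qed

abbreviation quot :: "('k, 'v set) lie_algebra" where "quot \<equiv> quotient_lie L \<aa>"
abbreviation proj :: "'v \<Rightarrow> 'v set" where "proj \<equiv> \<lambda>x. \<aa> +>\<^bsub>L\<^esub> x"

lemma proj_memD: "\<lbrakk>x \<in> carrier L; y \<in> proj x\<rbrakk> \<Longrightarrow> y \<in> carrier L \<and> proj y = proj x"
  using coset_eq[of x] coset_eq_iff[of y x] by auto

lemma quot_carrier: "carrier quot = proj ` carrier L"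
  by (auto simp: quotient_lie_def A_RCOSETS_def')

lemma proj_hom: "proj \<in> module_hom K L quot"
proof (rule module_homI)
  fix x y r assume x: "x \<in> carrier L"
  show "proj x \<in> carrier quot" using x by (simp add: quot_carrier)
  show "proj (x \<oplus>\<^bsub>L\<^esub> y) = proj x \<oplus>\<^bsub>quot\<^esub> proj y" if y: "y \<in> carrier L"
  proof -
    have "proj x <+>\<^bsub>L\<^esub> proj y = proj (x \<oplus>\<^bsub>L\<^esub> y)"
    proof (intro subset_antisym subsetI)
      fix z assume "z \<in> proj x <+>\<^bsub>L\<^esub> proj y"
      then obtain x' y' where *: "x' \<in> proj x" "y' \<in> proj y" "z = x' \<oplus>\<^bsub>L\<^esub> y'"
        unfolding set_add_def' by blast
      then have c: "x' \<in> carrier L" "x' \<ominus>\<^bsub>L\<^esub> x \<in> \<aa>" "y' \<in> carrier L" "y' \<ominus>\<^bsub>L\<^esub> y \<in> \<aa>"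
        using x y by (auto simp: coset_eq)
      have "z \<ominus>\<^bsub>L\<^esub> (x \<oplus>\<^bsub>L\<^esub> y) = (x' \<ominus>\<^bsub>L\<^esub> x) \<oplus>\<^bsub>L\<^esub> (y' \<ominus>\<^bsub>L\<^esub> y)"
        using c x y * by (simp add: a_minus_def[of L] M.minus_add M.a_ac)
      then show "z \<in> proj (x \<oplus>\<^bsub>L\<^esub> y)" using c x y * by (simp add: coset_eq)
    next
      fix z assume "z \<in> proj (x \<oplus>\<^bsub>L\<^esub> y)"
      then obtain a where "a \<in> \<aa>" "z = a \<oplus>\<^bsub>L\<^esub> (x \<oplus>\<^bsub>L\<^esub> y)" unfolding a_r_coset_def' by blast
      then have "z = (a \<oplus>\<^bsub>L\<^esub> x) \<oplus>\<^bsub>L\<^esub> y" "a \<oplus>\<^bsub>L\<^esub> x \<in> proj x" "y \<in> proj y"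
        using x y coset_self[OF y] unfolding a_r_coset_def'[of _ _ x] by (auto simp: M.a_assoc)
      then show "z \<in> proj x <+>\<^bsub>L\<^esub> proj y" unfolding set_add_def' by blast
    qed
    then show ?thesis by (simp add: quotient_lie_def)
  qed
  show "proj (r \<odot>\<^bsub>L\<^esub> x) = r \<odot>\<^bsub>quot\<^esub> proj x" if r: "r \<in> carrier K"
  proof -
    have "proj (r \<odot>\<^bsub>L\<^esub> x') = proj (r \<odot>\<^bsub>L\<^esub> x)" if "x' \<in> proj x" for x'
    proof -
      have c: "x' \<in> carrier L" "x' \<ominus>\<^bsub>L\<^esub> x \<in> \<aa>" using x that by (auto simp: coset_eq)
      have "r \<odot>\<^bsub>L\<^esub> x' \<ominus>\<^bsub>L\<^esub> r \<odot>\<^bsub>L\<^esub> x = r \<odot>\<^bsub>L\<^esub> (x' \<ominus>\<^bsub>L\<^esub> x)"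
        using c x r by (simp add: a_minus_def[of L] smult_r_distr smult_r_minus)
      then show ?thesis
        using c x r submodule.smult_closed[OF ideal_subspace r c(2)] by (subst coset_eq_iff) auto
    qed
    note r_eq = this
    have "(\<Union>x'\<in>proj x. proj (r \<odot>\<^bsub>L\<^esub> x')) = proj (r \<odot>\<^bsub>L\<^esub> x)"
      by (rule SUP_eq_const) (use coset_self[OF x] in blast, rule r_eq)
    then show ?thesis by (simp add: quotient_lie_def)
  qed
qed

text \<open>The bracket of two cosets is a union over representatives. Changing these one at a time
  alters the bracket by an element of the ideal, so all members of the union are the same
  coset.\<close>

lemma proj_bracket:
  assumes x: "x \<in> carrier L" and y: "y \<in> carrier L"
  shows "proj (bracket L x y) = bracket quot (proj x) (proj y)"
proof -
  have "proj (bracket L x' y') = proj (bracket L x y)" if "x' \<in> proj x" "y' \<in> proj y" for x' y'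
  proof -
    have c: "x' \<in> carrier L" "x' \<ominus>\<^bsub>L\<^esub> x \<in> \<aa>" "y' \<in> carrier L" "y' \<ominus>\<^bsub>L\<^esub> y \<in> \<aa>"
      using x y that by (auto simp: coset_eq)
    have 1: "bracket L x' y' \<ominus>\<^bsub>L\<^esub> bracket L x y' = bracket L (x' \<ominus>\<^bsub>L\<^esub> x) y'"
      using c x by (simp add: a_minus_def[of L] bracket_bil bracket_neg)
    have 2: "bracket L x y' \<ominus>\<^bsub>L\<^esub> bracket L x y = bracket L x (y' \<ominus>\<^bsub>L\<^esub> y)"
      using c x y by (simp add: a_minus_def[of L] bracket_bil bracket_neg)
    have "proj (bracket L x' y') = proj (bracket L x y')"
      using c x 1 ideal_bracket'[OF c(3,2)] by (subst coset_eq_iff) (auto simp: bracket_bil)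
    also have "\<dots> = proj (bracket L x y)"
      using c x y 2 ideal_bracket[OF x c(4)] by (subst coset_eq_iff) (auto simp: bracket_bil)
    finally show ?thesis .
  qed
  note br_eq = this
  have "(\<Union>x'\<in>proj x. \<Union>y'\<in>proj y. proj (bracket L x' y')) = proj (bracket L x y)"
    by (rule SUP_eq_const, use coset_self[OF x] in blast, rule SUP_eq_const, use coset_self[OF y] in blast)
      (rule br_eq)
  then show ?thesis by (simp add: quotient_lie_def)
qed

lemma proj_zero: "proj \<zero>\<^bsub>L\<^esub> = \<zero>\<^bsub>quot\<^esub>"
  by (auto simp: quotient_lie_def a_r_coset_def')

lemma lagr_quotient_quot: "lagr_quotient K L \<omega> \<aa> quot proj"
proof (intro lagr_quotient.intro lagr_quotient_axioms.intro sympl_lagr_axioms lie_algI proj_hom proj_bracket)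
  show "fin_dim_lie_algebra K quot"
    by (rule fin_dim_lie_algebra_hom_image[OF fin_dim_lie_algebra_axioms proj_hom quot_carrier[symmetric] proj_zero proj_bracket])
  show "proj ` carrier L = carrier quot" by (simp add: quot_carrier)
  show "(proj x = \<zero>\<^bsub>quot\<^esub>) = (x \<in> \<aa>)" if "x \<in> carrier L" for x
  proof -
    have "x \<ominus>\<^bsub>L\<^esub> \<zero>\<^bsub>L\<^esub> = x"
      using that by (intro form_eqI) (simp_all add: form_diff form_bil a_minus_def[of K])
    then show ?thesis using coset_eq_iff[OF that M.zero_closed] proj_zero by simp
  qed
qed

end

sublocale sympl_lagr \<subseteq> Q: lagr_quotient K L \<omega> \<aa> "quotient_lie L \<aa>" "\<lambda>x. \<aa> +>\<^bsub>L\<^esub> x"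
  by (rule lagr_quotient_quot)

section \<open>Evaluation of the definite descriptions in the extension triple\<close>

context sympl_lagr
begin

text \<open>A solution exists because the defining condition is independent of the representatives,
  and it is unique because pairing with \<aa> determines a coset.\<close>

lemma extension_connection_eq:
  assumes u: "u \<in> carrier L" and v: "v \<in> carrier L" and w: "w \<in> carrier L"
    and eq: "\<And>b. b \<in> \<aa> \<Longrightarrow> \<omega> w b = \<ominus> \<omega> v (bracket L u b)"
  shows "extension_connection K (L, \<omega>, \<aa>) (proj u) (proj v) = proj w"
  unfolding extension_connection_def prod.case
proof (rule the_equality)
  show "proj w \<in> carrier quot \<and> (\<forall>u\<in>proj u. \<forall>v\<in>proj v. \<forall>w\<in>proj w. \<forall>a\<in>\<aa>. \<omega> w a = \<ominus> \<omega> v (bracket L u a))"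
  proof (intro conjI ballI)
    show "proj w \<in> carrier quot" using w by (simp add: quot_carrier)
    fix u' v' w' a assume *: "u' \<in> proj u" "v' \<in> proj v" "w' \<in> proj w" "a \<in> \<aa>"
    note c = proj_memD[OF u *(1)] proj_memD[OF v *(2)] proj_memD[OF w *(3)]
    have "\<omega> w' a = \<omega> w a" using c w * Q.form_p_cong(1)[of w' w a] by simp
    moreover have "\<omega> v' (bracket L u' a) = \<omega> v (bracket L u a)"
      using c u v * by (intro Q.lifts_cong) auto
    ultimately show "\<omega> w' a = \<ominus> \<omega> v' (bracket L u' a)" using eq * by simp
  qed
next
  fix W assume W: "W \<in> carrier quot \<and> (\<forall>u\<in>proj u. \<forall>v\<in>proj v. \<forall>w\<in>W. \<forall>a\<in>\<aa>. \<omega> w a = \<ominus> \<omega> v (bracket L u a))"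
  then obtain x where x: "x \<in> carrier L" "W = proj x" by (auto simp: quot_carrier)
  then have "\<omega> x a = \<ominus> \<omega> v (bracket L u a)" if "a \<in> \<aa>" for a
    using W coset_self[OF u] coset_self[OF v] coset_self[OF x(1)] that by blast
  then show "W = proj w" unfolding x(2) using x(1) w eq by (intro Q.p_eqI) auto
qed

lemma lagr_connection_extension:
  "lagr_connection K L \<omega> \<aa> quot proj (extension_connection K (L, \<omega>, \<aa>))" (is "lagr_connection _ _ _ _ _ _ ?D")
proof (intro lagr_connection.intro lagr_connection_axioms.intro lagr_quotient_quot)
  fix U V assume "U \<in> carrier quot" "V \<in> carrier quot"
  then obtain u v where u: "u \<in> carrier L" "U = proj u" "v \<in> carrier L" "V = proj v"
    by (auto simp: quot_carrier)
  obtain w where w: "w \<in> carrier L" "\<And>b. b \<in> \<aa> \<Longrightarrow> \<omega> w b = \<ominus> \<omega> v (bracket L u b)"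
    using Q.connection_lift_exists[OF u(1,3)] by blast
  show "?D U V \<in> carrier quot"
    unfolding u(2,4) using extension_connection_eq[OF u(1,3) w] w(1) by (simp add: quot_carrier)
next
  fix u v x b assume *: "u \<in> carrier L" "v \<in> carrier L" "x \<in> carrier L" "proj x = ?D (proj u) (proj v)" "b \<in> \<aa>"
  obtain w where w: "w \<in> carrier L" "\<And>b. b \<in> \<aa> \<Longrightarrow> \<omega> w b = \<ominus> \<omega> v (bracket L u b)"
    using Q.connection_lift_exists[OF *(1,2)] by blast
  have "proj x = proj w" using extension_connection_eq[OF *(1,2) w] *(4) by simp
  then show "\<omega> x b = \<ominus> \<omega> v (bracket L u b)"
    using Q.form_p_cong(1)[OF *(3) w(1) _ *(5)] w(2)[OF *(5)] by simp
qed

sublocale E: lagr_connection K L \<omega> \<aa> "quotient_lie L \<aa>" "\<lambda>x. \<aa> +>\<^bsub>L\<^esub> x" "extension_connection K (L, \<omega>, \<aa>)"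
  by (rule lagr_connection_extension)

text \<open>If \<open>x\<close> is orthogonal to the image of \<open>s\<close>, then
  \<open>form_by_section\<close> gives \<omega>(x, z) = \<omega>(s (p x), z) for all
  \<open>z\<close>, where \<open>p\<close> is the projection, so \<open>x\<close> lies in the image.
  The other conditions express the splitting along \<open>s\<close>.\<close>

lemma lagr_complement_of_section:
  assumes s: "Q.isotropic_section s"
  shows "lagr_complement K (L, \<omega>, \<aa>) (s ` carrier quot)"
proof -
  note sD = Q.isotropic_sectionD[OF s]
  interpret s: linear_map K quot L s
    by (intro linear_mapI vectorspace_axioms Q.H.vectorspace_axioms sD(1))
  let ?N = "s ` carrier quot"
  have "subspace K ?N L" using s.imT_is_subspace by (simp add: s.im_def)
  moreover have "orthogonal K L \<omega> ?N = ?N"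
  proof (intro subset_antisym subsetI)
    fix x assume "x \<in> orthogonal K L \<omega> ?N"
    then have x: "x \<in> carrier L" and o: "\<And>Z. Z \<in> carrier quot \<Longrightarrow> \<omega> x (s Z) = \<zero>"
      by (auto simp: orthogonal_def)
    have px: "proj x \<in> carrier quot" using x by (simp add: quot_carrier)
    have "x = s (proj x)"
    proof (rule form_eqI[OF x sD(2)[OF px]])
      fix z assume z: "z \<in> carrier L"
      then have pz: "proj z \<in> carrier quot" by (simp add: quot_carrier)
      show "\<omega> x z = \<omega> (s (proj x)) z"
        using Q.form_by_section[OF s x z] Q.form_by_section[OF s sD(2)[OF px] z] o[OF pz] sD(3)[OF px] sD(4)[OF px pz]
        by simp
    qed
    then show "x \<in> ?N" using px by blast
  next
    fix x assume "x \<in> ?N"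
    then show "x \<in> orthogonal K L \<omega> ?N" using sD by (auto simp: orthogonal_def)
  qed
  moreover have "?N \<inter> \<aa> = {\<zero>\<^bsub>L\<^esub>}"
  proof (intro subset_antisym subsetI)
    fix x assume "x \<in> ?N \<inter> \<aa>"
    then obtain U where U: "U \<in> carrier quot" "x = s U" "s U \<in> \<aa>" by blast
    then have "U = \<zero>\<^bsub>quot\<^esub>" using Q.p_kernel[OF sD(2)[OF U(1)]] sD(3) by simp
    then show "x \<in> {\<zero>\<^bsub>L\<^esub>}" using U by simp
  next
    fix x assume "x \<in> {\<zero>\<^bsub>L\<^esub>}"
    moreover have "\<zero>\<^bsub>L\<^esub> \<in> ?N" using s.f0_is_0 Q.H.M.zero_closed by (metis imageI)
    ultimately show "x \<in> ?N \<inter> \<aa>" by simp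
  qed
  moreover have "?N <+>\<^bsub>L\<^esub> \<aa> = carrier L"
  proof (intro subset_antisym subsetI)
    fix x assume "x \<in> ?N <+>\<^bsub>L\<^esub> \<aa>"
    then show "x \<in> carrier L" using sD(2) unfolding set_add_def' by auto
  next
    fix x assume x: "x \<in> carrier L"
    then have "s (proj x) \<in> ?N" by (auto simp: quot_carrier)
    then show "x \<in> ?N <+>\<^bsub>L\<^esub> \<aa>"
      using Q.ideal_part(1,3)[OF s x] unfolding set_add_def' by blast
  qed
  ultimately show ?thesis by (simp add: lagr_complement_def)
qed

text \<open>As \<open>N\<close> meets \<aa> trivially, each coset has one representative in
  \<open>N\<close>, and closure of \<open>N\<close> under the operations makes this choice linear.
  The cocycles agree because a vector and its projection to \<aa> differ by an element of the
  isotropic \<open>N\<close>.\<close>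

lemma section_of_lagr_complement:
  assumes N: "lagr_complement K (L, \<omega>, \<aa>) N"
  shows "Q.isotropic_section (coset_lift N)"
    and "extension_cocycle (L, \<omega>, \<aa>) N = Q.section_cocycle (coset_lift N)"
proof -
  have sub: "LinearCombinations.submodule K N L" and orth: "orthogonal K L \<omega> N = N"
    and int: "N \<inter> \<aa> = {\<zero>\<^bsub>L\<^esub>}" and sum: "N <+>\<^bsub>L\<^esub> \<aa> = carrier L"
    using N by (auto simp: lagr_complement_def subspace_def)
  have Nc: "n \<in> carrier L" if "n \<in> N" for n using submodule.subset[OF sub] that by blast
  have Nadd: "n \<oplus>\<^bsub>L\<^esub> m \<in> N" if "n \<in> N" "m \<in> N" for n m using submodule.m_closed[OF sub that] .
  have Nsm: "r \<odot>\<^bsub>L\<^esub> n \<in> N" if "r \<in> carrier K" "n \<in> N" for r n using submodule.smult_closed[OF sub that] .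
  have Nneg: "\<ominus>\<^bsub>L\<^esub> n \<in> N" if "n \<in> N" for n using Nsm[of "\<ominus> \<one>" n] Nc that by (simp add: smult_minus_1)
  have iso: "\<omega> n m = \<zero>" if "n \<in> N" "m \<in> N" for n m using orth that by (auto simp: orthogonal_def)
  have unique: "n = m" if "n \<in> N" "m \<in> N" "n \<ominus>\<^bsub>L\<^esub> m \<in> \<aa>" for n m
  proof -
    have "n \<ominus>\<^bsub>L\<^esub> m \<in> N \<inter> \<aa>" using that Nadd Nneg by (simp add: a_minus_def[of L])
    then show ?thesis using int that Nc by simp
  qed
  have ex: "\<exists>n\<in>N. \<exists>a\<in>\<aa>. x = n \<oplus>\<^bsub>L\<^esub> a" if "x \<in> carrier L" for x
    using that unfolding sum[symmetric] set_add_def' by blast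
  have lift: "coset_lift N (proj x) = n" if "n \<in> N" "x \<in> carrier L" "x \<ominus>\<^bsub>L\<^esub> n \<in> \<aa>" for x n
    unfolding coset_lift_def
  proof (rule the_equality)
    have eq: "proj x = proj n" using that Nc by (simp add: coset_eq_iff)
    then show "n \<in> proj x \<and> n \<in> N" using that(1) coset_self[OF Nc] by simp
    fix m assume "m \<in> proj x \<and> m \<in> N"
    then show "m = n" using unique[of m n] that(1) eq Nc by (simp add: coset_eq)
  qed
  let ?l = "coset_lift N"
  have ln: "?l (proj x) \<in> N \<and> x \<ominus>\<^bsub>L\<^esub> ?l (proj x) \<in> \<aa>" if x: "x \<in> carrier L" for x
  proof -
    obtain n a where n: "n \<in> N" "a \<in> \<aa>" "x = n \<oplus>\<^bsub>L\<^esub> a" using ex[OF x] by blast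
    have "x \<ominus>\<^bsub>L\<^esub> n = a"
      using n Nc[OF n(1)] by (simp add: a_minus_def[of L] M.a_comm[of n a] M.a_assoc M.r_neg)
    then show ?thesis using lift[OF n(1) x] n by simp
  qed
  have lN: "?l U \<in> N" "proj (?l U) = U" if U: "U \<in> carrier quot" for U
  proof -
    obtain x where x: "x \<in> carrier L" "U = proj x" using U by (auto simp: quot_carrier)
    show "?l U \<in> N" using ln[OF x(1)] x(2) by simp
    show "proj (?l U) = U" using ln[OF x(1)] x Nc coset_eq_iff[of x "?l U"] by simp
  qed
  have lift': "?l (proj n) = n" if "n \<in> N" for n
  proof -
    have "n \<ominus>\<^bsub>L\<^esub> n = \<zero>\<^bsub>L\<^esub>" using Nc[OF that] by simp
    then have "n \<ominus>\<^bsub>L\<^esub> n \<in> \<aa>" by (simp only: ideal_zero)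
    then show ?thesis by (rule lift[OF that Nc[OF that]])
  qed
  have hom: "?l \<in> module_hom K quot L"
  proof (rule module_homI)
    fix U V r assume U: "U \<in> carrier quot"
    show "?l U \<in> carrier L" using lN(1)[OF U] Nc by simp
    show "?l (U \<oplus>\<^bsub>quot\<^esub> V) = ?l U \<oplus>\<^bsub>L\<^esub> ?l V" if V: "V \<in> carrier quot"
      using module_hom_add[OF proj_hom Nc[OF lN(1)[OF U]] Nc[OF lN(1)[OF V]]] lN(2)[OF U] lN(2)[OF V]
        lift'[OF Nadd[OF lN(1)[OF U] lN(1)[OF V]]] by simp
    show "?l (r \<odot>\<^bsub>quot\<^esub> U) = r \<odot>\<^bsub>L\<^esub> ?l U" if r: "r \<in> carrier K"
      using module_hom_smult[OF proj_hom r Nc[OF lN(1)[OF U]]] lN(2)[OF U] lift'[OF Nsm[OF r lN(1)[OF U]]]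
        by simp
  qed
  show "Q.isotropic_section ?l"
    unfolding Q.isotropic_section_def using hom lN iso by blast
  have proj_along: "\<omega> (proj_along L \<aa> N x) m = \<omega> x m" if x: "x \<in> carrier L" and m: "m \<in> N" for x m
  proof -
    obtain n a where n: "n \<in> N" "a \<in> \<aa>" "x = n \<oplus>\<^bsub>L\<^esub> a" using ex[OF x] by blast
    have "proj_along L \<aa> N x = a"
      unfolding proj_along_def
    proof (rule the_equality)
      show "a \<in> \<aa> \<and> (\<exists>n\<in>N. x = a \<oplus>\<^bsub>L\<^esub> n)" using n Nc[OF n(1)] by (auto simp: M.a_comm)
      fix b assume "b \<in> \<aa> \<and> (\<exists>n\<in>N. x = b \<oplus>\<^bsub>L\<^esub> n)"
      then obtain k where k: "b \<in> \<aa>" "k \<in> N" "x = b \<oplus>\<^bsub>L\<^esub> k" by blast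
      have c: "a \<in> carrier L" "b \<in> carrier L" "n \<in> carrier L" "k \<in> carrier L" using n k Nc by auto
      have 1: "x \<ominus>\<^bsub>L\<^esub> n = a" using n c by (simp add: a_minus_def[of L] M.a_comm[of n a] M.a_assoc M.r_neg)
      have 2: "x \<ominus>\<^bsub>L\<^esub> k = b" using k c by (simp add: a_minus_def[of L] M.a_assoc M.r_neg)
      have "n = k" using lift[OF n(1) x] lift[OF k(2) x] 1 2 n k by simp
      then show "b = a" using 1 2 by simp
    qed
    then show ?thesis using n m iso[OF n(1) m] Nc by (simp add: form_bil)
  qed
  show "extension_cocycle (L, \<omega>, \<aa>) N = Q.section_cocycle ?l"
    unfolding extension_cocycle_def Q.section_cocycle_def prod.case
    using proj_along lN(1) Nc by (intro restrict_ext) (simp add: bracket_bil cong: restrict_cong)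
qed

text \<open>Every complement gives this class, so it satisfies the description. It is the only
  solution because the image of \<open>s\<close> is a complement, which keeps the quantifier from
  being vacuous.\<close>

lemma extension_class_eq:
  assumes s: "Q.isotropic_section s"
  shows "extension_class K (L, \<omega>, \<aa>) =
    cohomology_class K quot (extension_connection K (L, \<omega>, \<aa>)) (Q.section_cocycle s)"
proof -
  let ?c = "cohomology_class K quot (extension_connection K (L, \<omega>, \<aa>))"
  have eq: "?c (extension_cocycle (L, \<omega>, \<aa>) N) = ?c (Q.section_cocycle s)"
    if "lagr_complement K (L, \<omega>, \<aa>) N" for N
    unfolding section_of_lagr_complement(2)[OF that]
    by (rule E.F.cohomology_class_eqI[OF E.section_cocycle_cochain[OF s]
          E.section_cocycle_class[OF s section_of_lagr_complement(1)[OF that]]])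
  show ?thesis
    unfolding extension_class_def prod.case
  proof (rule the_equality)
    show "\<forall>N. lagr_complement K (L, \<omega>, \<aa>) N \<longrightarrow> ?c (Q.section_cocycle s) = ?c (extension_cocycle (L, \<omega>, \<aa>) N)"
      using eq by simp
    show "c = ?c (Q.section_cocycle s)"
      if "\<forall>N. lagr_complement K (L, \<omega>, \<aa>) N \<longrightarrow> c = ?c (extension_cocycle (L, \<omega>, \<aa>) N)" for c
      using that lagr_complement_of_section[OF s] eq by metis
  qed
qed

end

text \<open>The link between the coset construction and \<open>presents\<close>; the final argument
  uses the extension triple only through this fact.\<close>

lemma presents_extension_triple:
  assumes "char_zero K" "X \<in> sympl_lagr_algebras K"
  shows "presents K X (extension_triple K X)"
proof -
  obtain L \<omega> \<aa> where X: "X = (L, \<omega>, \<aa>)" by (cases X)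
  interpret sympl_lagr K L \<omega> \<aa> using assms(2) unfolding X sympl_lagr_algebras_iff .
  obtain s where s: "Q.isotropic_section s" using Q.isotropic_section_exists[OF assms(1)] .
  show ?thesis
    unfolding X extension_triple_def prod.case presents.simps
    using lagr_connection_extension s extension_class_eq[OF s] by blast
qed

section \<open>The model on \<open>\<hh> \<oplus> \<hh>\<^sup>*\<close>\<close>

lemma (in cring) zero_of_diff_eq:
  assumes "a \<in> carrier R" "b \<in> carrier R" "a \<ominus> b = c"
  shows "a \<ominus> b \<ominus> c = \<zero>"
  using assms by auto

text \<open>Bookkeeping for the dual component of the Jacobi identity of the model: the
  \<open>a\<close> and \<open>b\<close> are values of \<alpha>, and \<open>x\<close>,
  \<open>y\<close>, \<open>z\<close> belong to the three functionals. The sum is the cocycle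
  expression minus three curvature terms.\<close>

lemma (in cring) model_jacobi_arith:
  assumes "a1 \<in> carrier R" "a2 \<in> carrier R" "a3 \<in> carrier R" "b1 \<in> carrier R" "b2 \<in> carrier R" "b3 \<in> carrier R"
    "x1 \<in> carrier R" "x2 \<in> carrier R" "x3 \<in> carrier R" "y1 \<in> carrier R" "y2 \<in> carrier R" "y3 \<in> carrier R"
    "z1 \<in> carrier R" "z2 \<in> carrier R" "z3 \<in> carrier R"
    and "\<ominus> b1 \<oplus> \<ominus> b2 \<ominus> b3 \<ominus> \<ominus> a3 \<oplus> a2 \<ominus> \<ominus> a1 = \<zero>"
    and "z2 \<ominus> z1 = z3" "x3 \<ominus> x2 = x1" "y1 \<ominus> y3 = y2"
  shows "(a1 \<ominus> (b1 \<ominus> z1 \<oplus> y1) \<oplus> x1) \<oplus> (a2 \<ominus> (b2 \<ominus> x2 \<oplus> z2) \<oplus> y2) \<oplus> (a3 \<ominus> (b3 \<ominus> y3 \<oplus> x3) \<oplus> z3) = \<zero>"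
proof -
  have "(a1 \<ominus> (b1 \<ominus> z1 \<oplus> y1) \<oplus> x1) \<oplus> (a2 \<ominus> (b2 \<ominus> x2 \<oplus> z2) \<oplus> y2) \<oplus> (a3 \<ominus> (b3 \<ominus> y3 \<oplus> x3) \<oplus> z3)
    = (\<ominus> b1 \<oplus> \<ominus> b2 \<ominus> b3 \<ominus> \<ominus> a3 \<oplus> a2 \<ominus> \<ominus> a1) \<ominus> (z2 \<ominus> z1 \<ominus> z3) \<ominus> (x3 \<ominus> x2 \<ominus> x1) \<ominus> (y1 \<ominus> y3 \<ominus> y2)"
    using assms(1-15) by (simp add: a_minus_def minus_add a_ac)
  moreover have "z2 \<ominus> z1 \<ominus> z3 = \<zero>" "x3 \<ominus> x2 \<ominus> x1 = \<zero>" "y1 \<ominus> y3 \<ominus> y2 = \<zero>"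
    by (rule zero_of_diff_eq; use assms in blast)+
  ultimately show ?thesis using assms(16) by (simp add: a_minus_def)
qed

text \<open>Bookkeeping for closedness of the form on the model: the \<open>a\<close> make up the
  cyclic sum of \<alpha>, and each of \<open>x\<close>, \<open>y\<close>, \<open>z\<close>
  contributes one torsion identity.\<close>

lemma (in cring) model_closed_arith:
  assumes "a1 \<in> carrier R" "a2 \<in> carrier R" "a3 \<in> carrier R" "x1 \<in> carrier R" "x2 \<in> carrier R" "x3 \<in> carrier R"
    "y1 \<in> carrier R" "y2 \<in> carrier R" "y3 \<in> carrier R" "z1 \<in> carrier R" "z2 \<in> carrier R" "z3 \<in> carrier R"
    and "a1 \<oplus> a2 \<oplus> a3 = \<zero>" "x1 \<ominus> x2 = x3" "y1 \<ominus> y2 = y3" "z1 \<ominus> z2 = z3"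
  shows "((a1 \<ominus> y2 \<oplus> x1) \<ominus> z3) \<oplus> ((a2 \<ominus> x2 \<oplus> z1) \<ominus> y3) \<oplus> ((a3 \<ominus> z2 \<oplus> y1) \<ominus> x3) = \<zero>"
proof -
  have "((a1 \<ominus> y2 \<oplus> x1) \<ominus> z3) \<oplus> ((a2 \<ominus> x2 \<oplus> z1) \<ominus> y3) \<oplus> ((a3 \<ominus> z2 \<oplus> y1) \<ominus> x3)
    = (a1 \<oplus> a2 \<oplus> a3) \<oplus> (x1 \<ominus> x2 \<ominus> x3) \<oplus> (y1 \<ominus> y2 \<ominus> y3) \<oplus> (z1 \<ominus> z2 \<ominus> z3)"
    using assms(1-12) by (simp add: a_minus_def minus_add a_ac)
  moreover have "z1 \<ominus> z2 \<ominus> z3 = \<zero>" "x1 \<ominus> x2 \<ominus> x3 = \<zero>" "y1 \<ominus> y2 \<ominus> y3 = \<zero>"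
    by (rule zero_of_diff_eq; use assms in blast)+
  ultimately show ?thesis using assms(13) by simp
qed

lemma (in module) hom_image_span:
  assumes "module R N" and f: "f \<in> module_hom R M N" and A: "A \<subseteq> carrier M" and x: "x \<in> span A"
  shows "f x \<in> LinearCombinations.module.span R N (f ` A)"
proof -
  interpret N: module R N by fact
  interpret f: mod_hom R M N f by (simp add: mod_hom_def mod_hom_axioms_def module_axioms N.module_axioms f)
  have fA: "f ` A \<subseteq> carrier N" using A by auto
  have S: "LinearCombinations.submodule R (N.span (f ` A)) N" using N.span_is_submodule[OF fA] .
  have "LinearCombinations.submodule R {x \<in> carrier M. f x \<in> N.span (f ` A)} M"
    using submodule.m_closed[OF S] submodule.zero_closed[OF S] submodule.smult_closed[OF S]
    by (intro submodule.intro module_axioms) auto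
  moreover have "A \<subseteq> {x \<in> carrier M. f x \<in> N.span (f ` A)}"
    using A N.in_own_span[OF fA] by auto
  ultimately show ?thesis using span_is_subset[of A "{x \<in> carrier M. f x \<in> N.span (f ` A)}"] x by auto
qed

text \<open>Generating sets of the two summands map to a generating set of \<open>W\<close>. This
  gives the finite dimension of the model from that of \<hh> and of its dual.\<close>

lemma fin_dim_sum:
  assumes "vectorspace K V" "vectorspace K V'" "vectorspace K W"
    and "vectorspace.fin_dim K V" "vectorspace.fin_dim K V'"
    and f: "f \<in> module_hom K V W" and g: "g \<in> module_hom K V' W"
    and sum: "\<And>w. w \<in> carrier W \<Longrightarrow> \<exists>x\<in>carrier V. \<exists>y\<in>carrier V'. w = f x \<oplus>\<^bsub>W\<^esub> g y"
  shows "vectorspace.fin_dim K W"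
proof -
  interpret V: vectorspace K V by fact
  interpret V': vectorspace K V' by fact
  interpret W: vectorspace K W by fact
  obtain A B where A: "finite A" "A \<subseteq> carrier V" "V.gen_set A" and B: "finite B" "B \<subseteq> carrier V'" "V'.gen_set B"
    using assms(4,5) unfolding V.fin_dim_def V'.fin_dim_def by blast
  let ?C = "f ` A \<union> g ` B"
  have C: "?C \<subseteq> carrier W" using A(2) B(2) module_hom_in_carrier[OF f] module_hom_in_carrier[OF g] by auto
  have S: "LinearCombinations.submodule K (W.span ?C) W" using W.span_is_submodule[OF C] .
  have "carrier W \<subseteq> W.span ?C"
  proof
    fix w assume "w \<in> carrier W"
    then obtain x y where xy: "x \<in> carrier V" "y \<in> carrier V'" "w = f x \<oplus>\<^bsub>W\<^esub> g y"
      using sum by meson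
    have "f x \<in> W.span (f ` A)" using V.hom_image_span[OF W.module_axioms f A(2)] A(3) xy by simp
    then have "f x \<in> W.span ?C" using W.span_is_monotone[of "f ` A" ?C] by blast
    moreover have "g y \<in> W.span (g ` B)" using V'.hom_image_span[OF W.module_axioms g B(2)] B(3) xy by simp
    then have "g y \<in> W.span ?C" using W.span_is_monotone[of "g ` B" ?C] by blast
    ultimately show "w \<in> W.span ?C" unfolding xy(3) by (rule submodule.m_closed[OF S])
  qed
  then have "W.gen_set ?C" using W.span_is_subset2[OF C] by blast
  moreover have "finite ?C" using A(1) B(1) by simp
  ultimately show ?thesis unfolding W.fin_dim_def using C by (intro exI[of _ ?C] conjI)
qed

context lie_alg
begin

lemma dual_lin:
  assumes "\<xi> \<in> carrier (dual_space K L)"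
  shows "\<lbrakk>x \<in> carrier L; y \<in> carrier L\<rbrakk> \<Longrightarrow> \<xi> (x \<oplus>\<^bsub>L\<^esub> y) = \<xi> x \<oplus> \<xi> y"
    and "\<lbrakk>r \<in> carrier K; x \<in> carrier L\<rbrakk> \<Longrightarrow> \<xi> (r \<odot>\<^bsub>L\<^esub> x) = r \<otimes> \<xi> x"
    and "\<lbrakk>x \<in> carrier L; y \<in> carrier L\<rbrakk> \<Longrightarrow> \<xi> (x \<ominus>\<^bsub>L\<^esub> y) = \<xi> x \<ominus> \<xi> y"
    and "\<xi> \<zero>\<^bsub>L\<^esub> = \<zero>"
proof -
  have h: "\<xi> \<in> module_hom K L (scalar_space K)" using assms by (simp add: dual_simps)
  interpret \<xi>: mod_hom K L "scalar_space K" \<xi>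
    using h module_scalar_space[OF R.cring_axioms]
      by (simp add: mod_hom_def mod_hom_axioms_def module_axioms)
  show "\<lbrakk>x \<in> carrier L; y \<in> carrier L\<rbrakk> \<Longrightarrow> \<xi> (x \<oplus>\<^bsub>L\<^esub> y) = \<xi> x \<oplus> \<xi> y" by simp
  show "\<lbrakk>r \<in> carrier K; x \<in> carrier L\<rbrakk> \<Longrightarrow> \<xi> (r \<odot>\<^bsub>L\<^esub> x) = r \<otimes> \<xi> x" by simp
  show "\<lbrakk>x \<in> carrier L; y \<in> carrier L\<rbrakk> \<Longrightarrow> \<xi> (x \<ominus>\<^bsub>L\<^esub> y) = \<xi> x \<ominus> \<xi> y"
    by (simp add: a_minus_def[of "scalar_space K"] a_minus_def[of K])
  show "\<xi> \<zero>\<^bsub>L\<^esub> = \<zero>" using \<xi>.f0_is_0 by simp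
qed

text \<open>The coordinate functionals of a basis already separate points. For the model this yields
  nondegeneracy and the fact that the fibre is its own orthogonal.\<close>

lemma dual_separates:
  assumes u: "u \<in> carrier L" and 0: "\<And>\<eta>. \<eta> \<in> carrier (dual_space K L) \<Longrightarrow> \<eta> u = \<zero>"
  shows "u = \<zero>\<^bsub>L\<^esub>"
proof -
  obtain B where B: "finite B" "basis B" using finite_basis_exists finite_dimensional by blast
  then have BL: "B \<subseteq> carrier L" by (simp add: basis_def)
  obtain c where c: "c \<in> module_hom K L (func_space B)"
    and lc: "\<And>x. x \<in> carrier L \<Longrightarrow> lincomb (c x) B = x"
    using coordinates[OF B] by blast
  have "c u b = \<zero>" if b: "b \<in> B" for b
  proof -
    have "(\<lambda>x. c x b) \<in> module_hom K L (scalar_space K)"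
    proof (rule module_homI)
      fix x y r assume x: "x \<in> carrier L"
      show "c x b \<in> carrier (scalar_space K)"
        using module_hom_in_carrier[OF c x] b by (auto simp: func_space_def)
      show "c (x \<oplus>\<^bsub>L\<^esub> y) b = c x b \<oplus>\<^bsub>scalar_space K\<^esub> c y b" if "y \<in> carrier L"
        unfolding module_hom_add[OF c x that] using b by (simp add: func_space_def)
      show "c (r \<odot>\<^bsub>L\<^esub> x) b = r \<odot>\<^bsub>scalar_space K\<^esub> c x b" if "r \<in> carrier K"
        unfolding module_hom_smult[OF c that x] using b by (simp add: func_space_def)
    qed
    then have "(\<lambda>x\<in>carrier L. c x b) \<in> carrier (dual_space K L)"
      by (simp add: dual_simps(1) functional_restrict)
    then show ?thesis using 0 u by fastforce
  qed
  then have "lincomb (c u) B = (\<Oplus>\<^bsub>L\<^esub>b\<in>B. \<zero>\<^bsub>L\<^esub>)"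
    unfolding lincomb_def using BL by (intro M.finsum_cong') auto
  then show ?thesis using lc[OF u] by simp
qed

lemma dual_restrictI:
  "f \<in> module_hom K L (scalar_space K) \<Longrightarrow> (\<lambda>x\<in>carrier L. f x) \<in> carrier (dual_space K L)"
  by (simp add: dual_simps(1) functional_restrict)

lemma dual_hom: "\<xi> \<in> carrier (dual_space K L) \<Longrightarrow> \<xi> \<in> module_hom K L (scalar_space K)"
  by (simp add: dual_simps(1))

end

section \<open>The twisted bracket and the canonical form on the model\<close>

locale flat_cocycle = flat_lie_alg K H D
  for K :: "('k, 'm) ring_scheme" (structure) and H :: "('k, 'w) lie_algebra" and D +
  fixes \<alpha> :: "'w \<Rightarrow> 'w \<Rightarrow> 'w \<Rightarrow> 'k"
  assumes cocycle: "\<alpha> \<in> lagr_cocycles2 K H D"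
begin

lemma cochain: "\<alpha> \<in> cochains2 K H"
  using cocycle by (simp add: lagr_cocycles2_iff)

lemma alpha_homs:
  assumes "u \<in> carrier H" "v \<in> carrier H"
  shows "\<alpha> u v \<in> module_hom K H (scalar_space K)" "(\<lambda>w. \<alpha> u w v) \<in> module_hom K H (scalar_space K)"
    "(\<lambda>w. \<alpha> w u v) \<in> module_hom K H (scalar_space K)"
  using cochain assms by (auto simp: cochains2_iff trilinear_def)

lemma alpha_closed [simp]:
  "\<lbrakk>u \<in> carrier H; v \<in> carrier H; w \<in> carrier H\<rbrakk> \<Longrightarrow> \<alpha> u v w \<in> carrier K"
  using module_hom_in_carrier[OF alpha_homs(1)] by simp

lemma alpha_lin:
  assumes "u \<in> carrier H" "w \<in> carrier H" "v \<in> carrier H"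
  shows "v' \<in> carrier H \<Longrightarrow> \<alpha> u (v \<oplus>\<^bsub>H\<^esub> v') w = \<alpha> u v w \<oplus> \<alpha> u v' w"
    and "v' \<in> carrier H \<Longrightarrow> \<alpha> (v \<oplus>\<^bsub>H\<^esub> v') u w = \<alpha> v u w \<oplus> \<alpha> v' u w"
    and "r \<in> carrier K \<Longrightarrow> \<alpha> u (r \<odot>\<^bsub>H\<^esub> v) w = r \<otimes> \<alpha> u v w"
    and "r \<in> carrier K \<Longrightarrow> \<alpha> (r \<odot>\<^bsub>H\<^esub> v) u w = r \<otimes> \<alpha> v u w"
  using module_hom_add[OF alpha_homs(2)[OF assms(1,2)] assms(3)] module_hom_add[OF alpha_homs(3)[OF assms(1,2)] assms(3)]
    module_hom_smult[OF alpha_homs(2)[OF assms(1,2)] _ assms(3)] module_hom_smult[OF alpha_homs(3)[OF assms(1,2)] _ assms(3)]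
  by simp_all

lemma alpha_self [simp]: "\<lbrakk>u \<in> carrier H; w \<in> carrier H\<rbrakk> \<Longrightarrow> \<alpha> u u w = \<zero>"
  using cochain by (simp add: cochains2_iff)

lemma alpha_zero [simp]: "\<lbrakk>u \<in> carrier H; w \<in> carrier H\<rbrakk> \<Longrightarrow> \<alpha> u \<zero>\<^bsub>H\<^esub> w = \<zero>"
  using alpha_lin(3)[of u w "\<zero>\<^bsub>H\<^esub>" \<zero>] by simp

lemma alpha_skew:
  assumes "u \<in> carrier H" "v \<in> carrier H" "w \<in> carrier H"
  shows "\<alpha> u v w = \<ominus> \<alpha> v u w"
proof -
  have "\<alpha> (u \<oplus>\<^bsub>H\<^esub> v) (u \<oplus>\<^bsub>H\<^esub> v) w = \<zero>" using assms by simp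
  then have "\<alpha> u v w \<oplus> \<alpha> v u w = \<zero>"
    using assms by (simp add: alpha_lin R.a_comm del: alpha_self) (simp add: R.a_comm)
  then show ?thesis using assms by (intro R.eq_neg_if_add_zero) auto
qed

text \<open>
  The bracket is \<open>[(u, \<xi>), (v, \<eta>)] = ([u, v], \<alpha>(u, v) + \<rho>(u)\<eta> - \<rho>(v)\<xi>)\<close> with
  \<open>\<rho>(u)\<eta> = - \<eta> \<circ> \<nabla>\<^sub>u\<close>.
\<close>

definition model :: "('k, 'w \<times> ('w \<Rightarrow> 'k)) lie_algebra" where
  "model = \<lparr>carrier = carrier H \<times> carrier (dual_space K H), mult = undefined, one = undefined,
     zero = (\<zero>\<^bsub>H\<^esub>, \<zero>\<^bsub>dual_space K H\<^esub>),
     add = (\<lambda>X Y. (fst X \<oplus>\<^bsub>H\<^esub> fst Y, snd X \<oplus>\<^bsub>dual_space K H\<^esub> snd Y)),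
     smult = (\<lambda>r X. (r \<odot>\<^bsub>H\<^esub> fst X, r \<odot>\<^bsub>dual_space K H\<^esub> snd X)),
     bracket = (\<lambda>X Y. (bracket H (fst X) (fst Y),
       \<lambda>x\<in>carrier H. \<alpha> (fst X) (fst Y) x \<ominus> snd Y (D (fst X) x) \<oplus> snd X (D (fst Y) x)))\<rparr>"

text \<open>The sign makes \<open>snd X\<close> the functional sending \<open>w\<close> to the
  pairing of \<open>X\<close> with (w, 0), so the two components of a pair are its coordinates
  relative to the section \<open>u\<close> to (u, 0).\<close>

definition model_form :: "'w \<times> ('w \<Rightarrow> 'k) \<Rightarrow> 'w \<times> ('w \<Rightarrow> 'k) \<Rightarrow> 'k" where
  "model_form X Y = snd X (fst Y) \<ominus> snd Y (fst X)"

lemma model_simps [simp]: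
  "X \<in> carrier model \<longleftrightarrow> fst X \<in> carrier H \<and> snd X \<in> carrier (dual_space K H)"
  "\<zero>\<^bsub>model\<^esub> = (\<zero>\<^bsub>H\<^esub>, \<zero>\<^bsub>dual_space K H\<^esub>)"
  "X \<oplus>\<^bsub>model\<^esub> Y = (fst X \<oplus>\<^bsub>H\<^esub> fst Y, snd X \<oplus>\<^bsub>dual_space K H\<^esub> snd Y)"
  "r \<odot>\<^bsub>model\<^esub> X = (r \<odot>\<^bsub>H\<^esub> fst X, r \<odot>\<^bsub>dual_space K H\<^esub> snd X)"
  "fst (bracket model X Y) = bracket H (fst X) (fst Y)"
  "x \<in> carrier H \<Longrightarrow> snd (bracket model X Y) x =
     \<alpha> (fst X) (fst Y) x \<ominus> snd Y (D (fst X) x) \<oplus> snd X (D (fst Y) x)"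
  by (auto simp: model_def mem_Times_iff)

lemma model_bracket_closed:
  assumes "X \<in> carrier model" "Y \<in> carrier model"
  shows "bracket model X Y \<in> carrier model"
  using assms
  by (auto simp: model_def bracket_bil intro!: dual_restrictI functional_add functional_diff alpha_homs
      module_hom_comp[OF endo_homs(1) dual_hom])

lemma model_eqI:
  assumes "X \<in> carrier model" "Y \<in> carrier model" "fst X = fst Y"
    and "\<And>x. x \<in> carrier H \<Longrightarrow> snd X x = snd Y x"
  shows "X = Y"
  using assms by (intro prod_eqI) (auto intro: dual_eqI)

text \<open>Carrier and operations coincide with those of the direct sum, so the identity map
  transports the structure.\<close>

lemma model_vectorspace: "vectorspace K model"
proof (rule vectorspace_hom_image)
  show "vectorspace K (direct_sum H (dual_space K H))"
    by (rule direct_sum_is_vs[OF vectorspace_axioms dual_vectorspace])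
  show "(\<lambda>x. x) \<in> module_hom K (direct_sum H (dual_space K H)) model"
    by (rule module_homI) (auto simp: direct_sum_def)
qed (auto simp: direct_sum_def model_def)

lemma model_inj1: "(\<lambda>u. (u, \<zero>\<^bsub>dual_space K H\<^esub>)) \<in> module_hom K H model"
  by (rule module_homI) (simp_all)

lemma model_inj2: "(\<lambda>\<xi>. (\<zero>\<^bsub>H\<^esub>, \<xi>)) \<in> module_hom K (dual_space K H) model"
  by (rule module_homI) (simp_all)

lemma dual_smult: "x \<in> carrier H \<Longrightarrow> (r \<odot>\<^bsub>dual_space K H\<^esub> \<xi>) x = r \<otimes> \<xi> x"
  by (simp add: dual_simps(3))

lemma dual_zero [simp]: "x \<in> carrier H \<Longrightarrow> \<zero>\<^bsub>dual_space K H\<^esub> x = \<zero>"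
  by (simp add: dual_simps(4))

text \<open>The first component of the Jacobi identity is that of \<hh>. In the second, the terms in
  \<alpha> cancel by the cocycle condition and the terms in each functional by flatness.\<close>

lemma model_lie_alg: "lie_alg K model"
proof (intro lie_algI fin_dim_lie_algebra.intro fin_dim_lie_algebra_axioms.intro model_vectorspace)
  interpret M: vectorspace K model by (rule model_vectorspace)
  show "M.fin_dim"
  proof (rule fin_dim_sum[OF vectorspace_axioms dual_vectorspace model_vectorspace finite_dimensional dual_fin_dim model_inj1 model_inj2])
    fix w assume w: "w \<in> carrier model"
    then show "\<exists>x\<in>carrier H. \<exists>y\<in>carrier (dual_space K H). w = (x, \<zero>\<^bsub>dual_space K H\<^esub>) \<oplus>\<^bsub>model\<^esub> (\<zero>\<^bsub>H\<^esub>, y)"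
      by (intro bexI[of _ "fst w"] bexI[of _ "snd w"]) auto
  qed
  note cl = model_bracket_closed
  note lin = bracket_bil D_bil alpha_lin dual_lin dual_add dual_smult
  show "bilinear_map K model model model (bracket model)"
  proof (rule bilinear_mapI)
    fix X Y Z r assume X: "X \<in> carrier model" and Y: "Y \<in> carrier model"
    show "bracket model X Y \<in> carrier model" using cl X Y .
    show "bracket model X (Y \<oplus>\<^bsub>model\<^esub> Z) = bracket model X Y \<oplus>\<^bsub>model\<^esub> bracket model X Z"
      if Z: "Z \<in> carrier model"
    proof (rule model_eqI[OF cl[OF X M.M.a_closed[OF Y Z]] M.M.a_closed[OF cl[OF X Y] cl[OF X Z]]])
    qed (use X Y Z in \<open>simp_all add: lin a_minus_def[of K] R.minus_add R.a_ac\<close>)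
    show "bracket model (X \<oplus>\<^bsub>model\<^esub> Z) Y = bracket model X Y \<oplus>\<^bsub>model\<^esub> bracket model Z Y"
      if Z: "Z \<in> carrier model"
    proof (rule model_eqI[OF cl[OF M.M.a_closed[OF X Z] Y] M.M.a_closed[OF cl[OF X Y] cl[OF Z Y]]])
    qed (use X Y Z in \<open>simp_all add: lin a_minus_def[of K] R.minus_add R.a_ac\<close>)
    show "bracket model X (r \<odot>\<^bsub>model\<^esub> Y) = r \<odot>\<^bsub>model\<^esub> bracket model X Y" if r: "r \<in> carrier K"
    proof (rule model_eqI[OF cl[OF X M.smult_closed[OF r Y]] M.smult_closed[OF r cl[OF X Y]]])
    qed (use X Y r in \<open>simp_all add: lin a_minus_def[of K] R.r_distr R.r_minus\<close>)
    show "bracket model (r \<odot>\<^bsub>model\<^esub> X) Y = r \<odot>\<^bsub>model\<^esub> bracket model X Y" if r: "r \<in> carrier K"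
    proof (rule model_eqI[OF cl[OF M.smult_closed[OF r X] Y] M.smult_closed[OF r cl[OF X Y]]])
    qed (use X Y r in \<open>simp_all add: lin a_minus_def[of K] R.r_distr R.r_minus\<close>)
  qed
  show "bracket model X X = \<zero>\<^bsub>model\<^esub>" if X: "X \<in> carrier model" for X
  proof (rule model_eqI[OF cl[OF X X] M.M.zero_closed])
    show "snd (bracket model X X) x = snd \<zero>\<^bsub>model\<^esub> x" if "x \<in> carrier H" for x
      using X that by (simp add: D_bil a_minus_def[of K] R.l_neg)
  qed (use X in \<open>simp add: bracket_self\<close>)
  fix X Y Z assume X: "X \<in> carrier model" and Y: "Y \<in> carrier model" and Z: "Z \<in> carrier model"
  define u v w where uvw: "u = fst X" "v = fst Y" "w = fst Z"
  define \<xi> \<eta> \<zeta> where xez: "\<xi> = snd X" "\<eta> = snd Y" "\<zeta> = snd Z"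
  have u: "u \<in> carrier H" "v \<in> carrier H" "w \<in> carrier H" using X Y Z by (auto simp: uvw)
  have d: "\<xi> \<in> carrier (dual_space K H)" "\<eta> \<in> carrier (dual_space K H)" "\<zeta> \<in> carrier (dual_space K H)"
    using X Y Z by (auto simp: xez)
  note br = cl[OF X cl[OF Y Z]] cl[OF Y cl[OF Z X]] cl[OF Z cl[OF X Y]]
  show "bracket model X (bracket model Y Z) \<oplus>\<^bsub>model\<^esub> bracket model Y (bracket model Z X)
        \<oplus>\<^bsub>model\<^esub> bracket model Z (bracket model X Y) = \<zero>\<^bsub>model\<^esub>" (is "?l = _")
  proof (rule model_eqI)
    show "?l \<in> carrier model" using br by (intro M.M.a_closed)
    show "\<zero>\<^bsub>model\<^esub> \<in> carrier model" by (rule M.M.zero_closed)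
    show "fst ?l = fst \<zero>\<^bsub>model\<^esub>" using jacobi[of "fst X" "fst Y" "fst Z"] X Y Z by simp
    fix x assume x: "x \<in> carrier H"
    have Dx: "D u x \<in> carrier H" "D v x \<in> carrier H" "D w x \<in> carrier H"
      and b: "bracket H u v \<in> carrier H" "bracket H v w \<in> carrier H" "bracket H w u \<in> carrier H"
      using u x by (auto simp: D_bil bracket_bil)
    have snd_l: "snd ?l x =
      (\<alpha> u (bracket H v w) x \<ominus> (\<alpha> v w (D u x) \<ominus> \<zeta> (D v (D u x)) \<oplus> \<eta> (D w (D u x))) \<oplus> \<xi> (D (bracket H v w) x)) \<oplus>
      (\<alpha> v (bracket H w u) x \<ominus> (\<alpha> w u (D v x) \<ominus> \<xi> (D w (D v x)) \<oplus> \<zeta> (D u (D v x))) \<oplus> \<eta> (D (bracket H w u) x)) \<oplus>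
      (\<alpha> w (bracket H u v) x \<ominus> (\<alpha> u v (D w x) \<ominus> \<eta> (D u (D w x)) \<oplus> \<xi> (D v (D w x))) \<oplus> \<zeta> (D (bracket H u v) x))"
      using x Dx by (simp add: dual_add uvw xez)
    have cob: "\<ominus> \<alpha> v w (D u x) \<oplus> \<alpha> u w (D v x) \<ominus> \<alpha> u v (D w x)
       \<ominus> \<alpha> (bracket H u v) w x \<oplus> \<alpha> (bracket H u w) v x \<ominus> \<alpha> (bracket H v w) u x = \<zero>"
      using cocycle u x by (simp add: lagr_cocycles2_iff cobd2_def)
    \<comment> \<open>The cocycle condition contains [u, w] and \<alpha>(u, w), the Jacobi sum their
      cyclic counterparts; skew symmetry translates one into the other.\<close>
    have "bracket H u w = (\<ominus> \<one>) \<odot>\<^bsub>H\<^esub> bracket H w u"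
      using bracket_skew[OF u(1,3)] b by (simp add: smult_minus_1)
    then have "\<alpha> (bracket H u w) v x = \<ominus> \<alpha> (bracket H w u) v x"
      using alpha_lin(4)[of v x "bracket H w u" "\<ominus> \<one>"] u x b by (simp add: R.l_minus)
    also have "\<dots> = \<alpha> v (bracket H w u) x" using alpha_skew[of v "bracket H w u" x] u x b by simp
    finally have A2: "\<alpha> (bracket H u w) v x = \<alpha> v (bracket H w u) x" .
    have A: "\<alpha> u w (D v x) = \<ominus> \<alpha> w u (D v x)" "\<alpha> (bracket H u v) w x = \<ominus> \<alpha> w (bracket H u v) x"
      "\<alpha> (bracket H v w) u x = \<ominus> \<alpha> u (bracket H v w) x"
      by (rule alpha_skew; use u x b Dx in simp)+
    have flat_dual: "\<nu> (D a (D b x)) \<ominus> \<nu> (D b (D a x)) = \<nu> (D (bracket H a b) x)"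
      if "\<nu> \<in> carrier (dual_space K H)" "a \<in> carrier H" "b \<in> carrier H" for \<nu> a b
      using flatness[of a b x] dual_lin(3)[OF that(1), of "D a (D b x)" "D b (D a x)"] that x
        by (simp add: D_bil)
    show "snd ?l x = snd \<zero>\<^bsub>model\<^esub> x"
      unfolding snd_l
    proof (subst R.model_jacobi_arith)
      show "\<ominus> \<alpha> v w (D u x) \<oplus> \<ominus> \<alpha> w u (D v x) \<ominus> \<alpha> u v (D w x) \<ominus> \<ominus> \<alpha> w (bracket H u v) x
          \<oplus> \<alpha> v (bracket H w u) x \<ominus> \<ominus> \<alpha> u (bracket H v w) x = \<zero>"
        using cob unfolding A A2 .
    qed (use u x d b Dx flat_dual in \<open>simp_all add: D_bil\<close>)
  qed
qed

lemma model_form_bilinear: "bilinear_map K model model (scalar_space K) model_form"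
  by (rule bilinear_mapI)
    (simp_all add: model_form_def dual_lin dual_add dual_smult a_minus_def[of K] R.minus_add R.a_ac R.r_distr R.r_minus)

abbreviation (input) "fibre \<equiv> {\<zero>\<^bsub>H\<^esub>} \<times> carrier (dual_space K H)"

text \<open>Closedness combines the cyclic identity of \<alpha> with vanishing torsion applied to
  each functional. Pairing with the vectors (0, \<eta>) detects the first component, pairing with
  (x, 0) the second.\<close>

lemma model_sympl_lagr: "sympl_lagr K model model_form fibre"
proof (intro sympl_lagr.intro sympl_lagr_axioms.intro model_lie_alg)
  interpret M: lie_alg K model by (rule model_lie_alg)
  have "X = \<zero>\<^bsub>model\<^esub>" if X: "X \<in> carrier model" and 0: "\<And>Y. Y \<in> carrier model \<Longrightarrow> model_form X Y = \<zero>" for X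
  proof -
    have "fst X = \<zero>\<^bsub>H\<^esub>"
    proof (rule dual_separates)
      fix \<eta> assume \<eta>: "\<eta> \<in> carrier (dual_space K H)"
      have "model_form X (\<zero>\<^bsub>H\<^esub>, \<eta>) = \<zero> \<ominus> \<eta> (fst X)" using \<eta> X by (simp add: model_form_def dual_lin)
      moreover have "model_form X (\<zero>\<^bsub>H\<^esub>, \<eta>) = \<zero>" using 0[of "(\<zero>\<^bsub>H\<^esub>, \<eta>)"] \<eta> by simp
      ultimately have "\<zero> \<ominus> \<eta> (fst X) = \<zero>" by (simp only:)
      then show "\<eta> (fst X) = \<zero>" by (rule R.eq_if_diff[symmetric]) (use \<eta> X in simp_all)
    qed (use X in simp)
    moreover have "snd X = \<zero>\<^bsub>dual_space K H\<^esub>"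
    proof (rule dual_eqI)
      fix x assume x: "x \<in> carrier H"
      then have "snd X x \<ominus> \<zero>\<^bsub>dual_space K H\<^esub> (fst X) = \<zero>"
        using 0[of "(x, \<zero>\<^bsub>dual_space K H\<^esub>)"] by (simp add: model_form_def)
      then show "snd X x = \<zero>\<^bsub>dual_space K H\<^esub> x" using x X by (simp add: a_minus_def[of K])
    qed (use X in auto)
    ultimately show ?thesis by (simp add: prod_eq_iff)
  qed
  moreover have "model_form (bracket model X Y) Z \<oplus> model_form (bracket model Z X) Y \<oplus> model_form (bracket model Y Z) X = \<zero>"
    if X: "X \<in> carrier model" and Y: "Y \<in> carrier model" and Z: "Z \<in> carrier model" for X Y Z
  proof -
    have tors: "\<nu> (D a b) \<ominus> \<nu> (D b a) = \<nu> (bracket H a b)"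
      if "\<nu> \<in> carrier (dual_space K H)" "a \<in> carrier H" "b \<in> carrier H" for \<nu> a b
      using torsion_free[of a b] dual_lin(3)[OF that(1), of "D a b" "D b a"] that by (simp add: D_bil)
    have "\<alpha> (fst X) (fst Y) (fst Z) \<oplus> \<alpha> (fst Z) (fst X) (fst Y) \<oplus> \<alpha> (fst Y) (fst Z) (fst X) = \<zero>"
      using cocycle X Y Z by (simp add: lagr_cocycles2_iff)
    then have "((\<alpha> (fst X) (fst Y) (fst Z) \<ominus> snd Y (D (fst X) (fst Z)) \<oplus> snd X (D (fst Y) (fst Z))) \<ominus> snd Z (bracket H (fst X) (fst Y))) \<oplus>
      ((\<alpha> (fst Z) (fst X) (fst Y) \<ominus> snd X (D (fst Z) (fst Y)) \<oplus> snd Z (D (fst X) (fst Y))) \<ominus> snd Y (bracket H (fst Z) (fst X))) \<oplus>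
      ((\<alpha> (fst Y) (fst Z) (fst X) \<ominus> snd Z (D (fst Y) (fst X)) \<oplus> snd Y (D (fst Z) (fst X))) \<ominus> snd X (bracket H (fst Y) (fst Z))) = \<zero>"
      using X Y Z by (intro R.model_closed_arith) (simp_all add: tors D_bil bracket_bil)
    then show ?thesis using X Y Z by (simp add: model_form_def)
  qed
  moreover have "model_form X X = \<zero>" if "X \<in> carrier model" for X
    using that by (simp add: model_form_def)
  ultimately show "symplectic_form K model model_form"
    unfolding symplectic_form_def using model_form_bilinear by blast
  have "LinearCombinations.submodule K fibre model"
    by (rule submodule.intro[OF M.module_axioms]) (auto simp: model_def)
  then show "lie_ideal K model fibre"
    unfolding lie_ideal_def subspace_def
    using model_bracket_closed by (auto simp: M.vectorspace_axioms mem_Times_iff simp del: model_simps(6))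
  show "orthogonal K model model_form fibre = fibre"
  proof (intro subset_antisym subsetI)
    fix X assume "X \<in> orthogonal K model model_form fibre"
    then have X: "X \<in> carrier model" and 0: "\<And>\<eta>. \<eta> \<in> carrier (dual_space K H) \<Longrightarrow> model_form X (\<zero>\<^bsub>H\<^esub>, \<eta>) = \<zero>"
      unfolding orthogonal_def by auto
    have "fst X = \<zero>\<^bsub>H\<^esub>"
    proof (rule dual_separates)
      fix \<eta> assume \<eta>: "\<eta> \<in> carrier (dual_space K H)"
      have "model_form X (\<zero>\<^bsub>H\<^esub>, \<eta>) = \<zero> \<ominus> \<eta> (fst X)" using \<eta> X by (simp add: model_form_def dual_lin)
      moreover have "model_form X (\<zero>\<^bsub>H\<^esub>, \<eta>) = \<zero>" using 0[of \<eta>] \<eta> by simp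
      ultimately have "\<zero> \<ominus> \<eta> (fst X) = \<zero>" by (simp only:)
      then show "\<eta> (fst X) = \<zero>" by (rule R.eq_if_diff[symmetric]) (use \<eta> X in simp_all)
    qed (use X in simp)
    then show "X \<in> fibre" using X by (simp add: mem_Times_iff)
  next
    fix X assume "X \<in> fibre"
    then show "X \<in> orthogonal K model model_form fibre"
      by (auto simp: orthogonal_def model_form_def dual_lin mem_Times_iff)
  qed
qed

text \<open>On the isotropic section \<open>u\<close> to (u, 0) the trilinear form takes the values
  \<alpha>(u, v)(w), so \<alpha> itself comes back and not merely its class.\<close>

lemma presents_model: "presents K (model, model_form, fibre) (H, D, cohomology_class K H D \<alpha>)"
proof -
  interpret M: sympl_lagr K model model_form fibre by (rule model_sympl_lagr)
  have "lagr_quotient K model model_form fibre H fst"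
  proof (intro lagr_quotient.intro lagr_quotient_axioms.intro M.sympl_lagr_axioms lie_alg_axioms)
    show "fst \<in> module_hom K model H" by (rule module_homI) auto
    show "fst ` carrier model = carrier H"
      using dual.M.zero_closed by (force simp: model_def)
  qed (auto simp: mem_Times_iff)
  then interpret Q: lagr_quotient K model model_form fibre H fst .
  have conn: "lagr_connection K model model_form fibre H fst D"
  proof (intro lagr_connection.intro lagr_connection_axioms.intro Q.lagr_quotient_axioms D_bil(1))
    fix u v w b assume *: "u \<in> carrier model" "v \<in> carrier model" "w \<in> carrier model"
      "fst w = D (fst u) (fst v)" "b \<in> fibre"
    \<comment> \<open>The fibre vector \<open>b\<close> has first component zero, so in the bracket
      of \<open>u\<close> with \<open>b\<close> the functional of \<open>u\<close> is evaluated at D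
      0 (fst v).\<close>
    have z: "D \<zero>\<^bsub>H\<^esub> (fst v) = \<zero>\<^bsub>H\<^esub>" using D_bil(5)[of \<zero> "\<zero>\<^bsub>H\<^esub>" "fst v"] * D_bil(1) by simp
    show "model_form w b = \<ominus> model_form v (bracket model u b)"
      using * by (simp add: model_form_def mem_Times_iff dual_lin D_bil a_minus_def[of K] z)
  qed
  then interpret C: lagr_connection K model model_form fibre H fst D .
  let ?s = "\<lambda>u. (u, \<zero>\<^bsub>dual_space K H\<^esub>)"
  have s: "Q.isotropic_section ?s"
    unfolding Q.isotropic_section_def
    using model_inj1 by (simp add: model_form_def a_minus_def[of K])
  have "Q.section_cocycle ?s = \<alpha>"
    using C.section_cocycle_cochain[OF s] cochain
    by (rule cochains2_eqI) (simp add: Q.section_cocycle_def model_form_def D_bil bracket_bil a_minus_def[of K])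
  then show ?thesis unfolding presents.simps using conn s by metis
qed

end

section \<open>The bijection\<close>

text \<open>A bare injection of the carrier is enough, since the structure is carried over
  afterwards by \<open>image_lie\<close>.\<close>

lemma embedding_exists:
  fixes \<iota> :: "'k \<Rightarrow> 'z" and V :: "('k, 'v, 'n) module_scheme"
  assumes "vectorspace K V" "vectorspace.fin_dim K V" "infinite (carrier K)" "inj_on \<iota> (carrier K)"
  obtains j :: "'v \<Rightarrow> 'z" where "inj_on j (carrier V)"
proof -
  obtain f where f: "inj_on f (carrier V)" "f ` carrier V \<subseteq> carrier K"
    using vectorspace.carrier_lepoll_field[OF assms(1-3)] by (auto simp: lepoll_def)
  have "inj_on (\<iota> \<circ> f) (carrier V)"
    using f assms(4) by (meson comp_inj_on inj_on_subset)
  then show ?thesis using that by blast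
qed

text \<open>The quotient is replaced by an isomorphic copy in the prescribed type, with projection
  and section composed accordingly.\<close>

lemma presented_in_type:
  fixes \<kappa> :: "'k \<Rightarrow> 'h"
  assumes "presents K X T" "infinite (carrier K)" "inj_on \<kappa> (carrier K)"
  obtains T' :: "('k, 'h) flat_triple" where "presents K X T'"
proof -
  obtain L \<omega> \<aa> H D c where XT: "X = (L, \<omega>, \<aa>)" "T = (H, D, c)" by (cases X, cases T)
  then obtain p s where 1: "lagr_connection K L \<omega> \<aa> H p D"
    and s: "lagr_quotient.isotropic_section K L \<omega> H p s"
    using assms(1) by auto
  interpret X: lagr_connection K L \<omega> \<aa> H p D by (rule 1)
  obtain j :: "_ \<Rightarrow> 'h" where j: "inj_on j (carrier H)"
    using embedding_exists[OF X.H.vectorspace_axioms X.H.finite_dimensional assms(2,3)] .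
  note im = image_lie_iso[OF X.H.lie_alg_axioms j]
  let ?g = "inv_into (carrier H) j"
  let ?E = "\<lambda>U V. j (D (?g U) (?g V))"
  have "j (D U V) = ?E (j U) (j V)" if "U \<in> carrier H" "V \<in> carrier H" for U V
    using j that by simp
  note base = lagr_connection_change_base(1,2)[OF 1 s im, of ?E, OF this]
  let ?s = "\<lambda>U. s (?g U)"
  have "presents K X (image_lie H j, ?E, cohomology_class K (image_lie H j) ?E
      (lagr_quotient.section_cocycle L \<omega> (image_lie H j) ?s))"
    unfolding XT presents.simps
    by (intro exI[of _ "\<lambda>x. j (p x)"] exI[of _ ?s] conjI refl) (rule base; assumption)+
  then show ?thesis by (rule that)
qed

text \<open>The model consists of pairs of a vector and a functional; its copy in the prescribed
  type presents the same triple by \<open>presents_iso_algebra\<close>.\<close>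

lemma flat_triple_presented:
  fixes \<iota> :: "'k \<Rightarrow> 'g"
  assumes "T \<in> flat_triples K" "infinite (carrier K)" "inj_on \<iota> (carrier K)"
  obtains X :: "('k, 'g) sympl_lagr" where "presents K X T"
proof -
  obtain H D c where T: "T = (H, D, c)" by (cases T)
  then obtain \<alpha> where flat: "flat_lie_alg K H D" and \<alpha>: "\<alpha> \<in> lagr_cocycles2 K H D" "c = cohomology_class K H D \<alpha>"
    using assms(1) flat_triples_iff by blast
  interpret F: flat_cocycle K H D \<alpha>
    using flat \<alpha>(1) by (intro flat_cocycle.intro flat_cocycle_axioms.intro)
  interpret M: sympl_lagr K F.model F.model_form "{\<zero>\<^bsub>H\<^esub>} \<times> carrier (dual_space K H)"
    by (rule F.model_sympl_lagr)
  obtain j :: "_ \<Rightarrow> 'g" where j: "inj_on j (carrier F.model)"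
    using embedding_exists[OF M.vectorspace_axioms M.finite_dimensional assms(2,3)] .
  note im = image_lie_iso[OF M.lie_alg_axioms j]
  let ?g = "inv_into (carrier F.model) j"
  let ?\<omega> = "\<lambda>x y. F.model_form (?g x) (?g y)"
  have form: "?\<omega> (j x) (j y) = F.model_form x y" if "x \<in> carrier F.model" "y \<in> carrier F.model" for x y
    using j that by (simp del: F.model_simps(1))
  have X: "sympl_lagr K (image_lie F.model j) ?\<omega> (j ` ({\<zero>\<^bsub>H\<^esub>} \<times> carrier (dual_space K H)))"
    by (rule sympl_lagr_image[OF M.sympl_lagr_axioms im]) (rule form)
  have "sympl_lagr_iso K (F.model, F.model_form, {\<zero>\<^bsub>H\<^esub>} \<times> carrier (dual_space K H))
      (image_lie F.model j, ?\<omega>, j ` ({\<zero>\<^bsub>H\<^esub>} \<times> carrier (dual_space K H)))"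
    unfolding sympl_lagr_iso.simps using im(2) form by (intro exI[of _ j]) simp
  then have "presents K (image_lie F.model j, ?\<omega>, j ` ({\<zero>\<^bsub>H\<^esub>} \<times> carrier (dual_space K H))) T"
    unfolding T \<alpha>(2)
    by (rule presents_iso_algebra[OF F.presents_model _ X[folded sympl_lagr_algebras_iff]])
  then show ?thesis using that by blast
qed

text \<open>Together with \<open>flat_triple_iso_iff\<close> this expresses both notions of
  isomorphism by \<open>presents\<close>, so that classes on either side become fibres of one
  relation.\<close>

lemma sympl_lagr_iso_iff:
  assumes "presents K X T" "Y \<in> sympl_lagr_algebras K"
  shows "sympl_lagr_iso K X Y \<longleftrightarrow> presents K Y T"
  using presents_iso_algebra[OF assms(1) _ assms(2)] presents_same_triple[OF assms(1)] by blast

lemma flat_triple_iso_iff: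
  assumes "presents K X T" "T' \<in> flat_triples K"
  shows "flat_triple_iso K T T' \<longleftrightarrow> presents K X T'"
  using presents_iso_triple[OF assms(1) _ assms(2)] presented_triples_iso[OF assms(1)] by blast

theorem corollary5p14:
  fixes K :: "('k, 'm) ring_scheme"
    and \<iota> :: "'k \<Rightarrow> 'g" and \<kappa> :: "'k \<Rightarrow> 'h"
  assumes "field K" and "char_zero K"
    and "inj_on \<iota> (carrier K)" and "inj_on \<kappa> (carrier K)"
  shows "(\<forall>X \<in> (sympl_lagr_algebras K :: ('k, 'g) sympl_lagr set).
            extension_triple K X \<in> flat_triples K) \<and>
         (\<forall>X \<in> (sympl_lagr_algebras K :: ('k, 'g) sympl_lagr set).
          \<forall>Y \<in> (sympl_lagr_algebras K :: ('k, 'g) sympl_lagr set).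
            sympl_lagr_iso K X Y \<longrightarrow>
            flat_triple_iso K (extension_triple K X) (extension_triple K Y)) \<and>
         bij_betw (extension_class_map K)
           (sympl_lagr_classes K :: ('k, 'g) sympl_lagr set set)
           (flat_triple_classes K :: ('k, 'h) flat_triple set set)"
proof (intro conjI ballI impI)
  let ?A = "sympl_lagr_algebras K :: ('k, 'g) sympl_lagr set"
  let ?F = "flat_triples K :: ('k, 'h) flat_triple set"
  let ?r = "{(X, Y). X \<in> ?A \<and> Y \<in> ?A \<and> sympl_lagr_iso K X Y}"
  let ?q = "{(S, T). S \<in> ?F \<and> T \<in> ?F \<and> flat_triple_iso K S T}"
  let ?R = "presents K :: ('k, 'g) sympl_lagr \<Rightarrow> ('k, 'h) flat_triple \<Rightarrow> bool"
  have inf: "infinite (carrier K)" using char_zero_infinite[OF assms(1,2)] .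
  have ext: "presents K X (extension_triple K X)" if "X \<in> ?A" for X
    using presents_extension_triple[OF assms(2) that] .
  show "extension_triple K X \<in> flat_triples K" if "X \<in> ?A" for X
    using presents_in_sets(2)[OF ext[OF that]] .
  show "flat_triple_iso K (extension_triple K X) (extension_triple K Y)"
    if "X \<in> ?A" "Y \<in> ?A" "sympl_lagr_iso K X Y" for X Y
    using presented_triples_iso[OF presents_iso_algebra[OF ext[OF that(1)] that(3,2)] ext[OF that(2)]] .
  have total: "\<exists>T. ?R X T" if "X \<in> ?A" for X
    using presented_in_type[OF ext[OF that] inf assms(4)] by blast
  \<comment> \<open>With \<open>qclass\<close>, this description of a class takes the place of the
    equivalence laws for the two isomorphism relations.\<close>
  have rclass: "?r `` {X} = {Y. ?R Y T}" if "?R X T" for X T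
    using sympl_lagr_iso_iff[OF that] presents_in_sets that by blast
  have qclass: "?q `` {T} = {T'. ?R X T'}" if "?R X T" for X T
    using flat_triple_iso_iff[OF that] presents_in_sets that by blast
  have map: "extension_class_map K (?r `` {X}) = ?q `` {T}" if XT: "?R X T" for X T
  proof -
    have iff: "flat_triple_iso K (extension_triple K Y) T' \<longleftrightarrow> ?R Y T'" if "?R Y T" "T' \<in> ?F" for Y T'
      by (rule flat_triple_iso_iff[OF ext[OF presents_in_sets(1)[OF that(1)]] that(2)])
    \<comment> \<open>A triple isomorphic to the extension triple of some \<open>Y\<close> in the
      class is the same as a triple presented by such a \<open>Y\<close>.\<close>
    have "extension_class_map K (?r `` {X}) = {T' \<in> ?F. \<exists>Y. ?R Y T \<and> ?R Y T'}"
      unfolding extension_class_map_def rclass[OF XT] using iff by blast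
    also have "\<dots> = {T'. ?R X T'}"
    proof (intro subset_antisym subsetI CollectI)
      fix T' assume "T' \<in> {T' \<in> ?F. \<exists>Y. ?R Y T \<and> ?R Y T'}"
      then obtain Y where "T' \<in> ?F" "?R Y T" "?R Y T'" by blast
      \<comment> \<open>\<open>Y\<close> presents \<open>T\<close> and \<open>T'\<close>, which are
        therefore isomorphic, and \<open>X\<close> presents \<open>T\<close>.\<close>
      then show "?R X T'" using flat_triple_iso_iff[of K Y T T'] flat_triple_iso_iff[OF XT, of T'] by blast
    next
      fix T' assume "T' \<in> {T'. ?R X T'}"
      then show "T' \<in> ?F \<and> (\<exists>Y. ?R Y T \<and> ?R Y T')" using XT presents_in_sets(2) by blast
    qed
    also have "\<dots> = ?q `` {T}" using qclass[OF XT] by blast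
    finally show ?thesis .
  qed
  show "bij_betw (extension_class_map K) (sympl_lagr_classes K :: ('k, 'g) sympl_lagr set set)
      (flat_triple_classes K :: ('k, 'h) flat_triple set set)"
    unfolding bij_betw_def
  proof
    show "inj_on (extension_class_map K :: _ \<Rightarrow> ('k, 'h) flat_triple set) (sympl_lagr_classes K :: ('k, 'g) sympl_lagr set set)"
    proof (rule inj_onI)
      fix C C' :: "('k, 'g) sympl_lagr set"
      assume C: "C \<in> sympl_lagr_classes K" "C' \<in> sympl_lagr_classes K"
        and eq: "(extension_class_map K C :: ('k, 'h) flat_triple set) = extension_class_map K C'"
      obtain X Y where XY: "X \<in> ?A" "C = ?r `` {X}" "Y \<in> ?A" "C' = ?r `` {Y}"
        using C unfolding sympl_lagr_classes_def by (auto elim!: quotientE)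
      obtain T S where T: "?R X T" "?R Y S" using total XY by blast
      have "T \<in> ?q `` {T}" using qclass[OF T(1)] T(1) by blast
      \<comment> \<open>Equal images put \<open>T\<close> into the class of \<open>S\<close>, so
        \<open>Y\<close> presents \<open>T\<close> as well, and both classes are the fibre over
        \<open>T\<close>.\<close>
      then have "T \<in> ?q `` {S}" using eq unfolding XY map[OF T(1)] map[OF T(2)] by (rule subst[rotated])
      then have YT: "?R Y T" using qclass[OF T(2)] by blast
      show "C = C'" unfolding XY rclass[OF T(1)] rclass[OF YT] by (rule refl)
    qed
    show "extension_class_map K ` (sympl_lagr_classes K :: ('k, 'g) sympl_lagr set set) =
        (flat_triple_classes K :: ('k, 'h) flat_triple set set)"
    proof (intro subset_antisym subsetI)
      fix E :: "('k, 'h) flat_triple set"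
      assume "E \<in> extension_class_map K ` (sympl_lagr_classes K :: ('k, 'g) sympl_lagr set set)"
      then obtain X where X: "X \<in> ?A" "E = extension_class_map K (?r `` {X})"
        unfolding sympl_lagr_classes_def by (auto elim!: quotientE)
      obtain T where T: "?R X T" using total X by blast
      then show "E \<in> flat_triple_classes K"
        unfolding X(2) map[OF T] flat_triple_classes_def
          using presents_in_sets(2)[OF T] by (intro quotientI)
    next
      fix E :: "('k, 'h) flat_triple set"
      assume "E \<in> flat_triple_classes K"
      then obtain T where T: "T \<in> ?F" "E = ?q `` {T}"
        unfolding flat_triple_classes_def by (auto elim!: quotientE)
      obtain X where X: "?R X T" using flat_triple_presented[OF T(1) inf assms(3)] by blast
      have "?r `` {X} \<in> sympl_lagr_classes K"
        unfolding sympl_lagr_classes_def using presents_in_sets(1)[OF X] by (intro quotientI)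
      then show "E \<in> extension_class_map K ` (sympl_lagr_classes K :: ('k, 'g) sympl_lagr set set)"
        unfolding T(2) map[OF X, symmetric] by (rule imageI)
    qed
  qed
qed

end
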